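(* Let $0<p_1\le p_2<\infty$, $0<\theta\le\infty$, $v_1,v_2\in\mathcal W(\mathbb{R}^n)$ and $\omega\in{}^c\Omega_\theta$. Write $J:=\|\mathrm{Id}\|_{{}^cLM_{p_2\theta,\omega}(\mathbb{R}^n,v_2)\to L_{p_1}(\mathbb{R}^n,v_1)}$ and $s:=\frac{p_1p_2}{p_2-p_1}$ (with $s=\infty$ when $p_1=p_2$). (a) If $0<\theta\le p_1\le p_2<\infty$, then, uniformly in $\omega\in{}^c\Omega_\theta$, $$J\approx\sup_{t>0}\|\omega\|_{\theta,(0,t)}^{-1}\big\|v_1^{1/p_1}v_2^{-1/p_2}\big\|_{s,B(0,t)}.$$ (b) If $0<p_1\le p_2<\infty$ and $p_1<\theta\le\infty$, then, with $\rho:=\frac{p_1\theta}{\theta-p_1}$ ($\rho=p_1$ when $\theta=\infty$), uniformly in $\omega\in{}^c\Omega_\theta$, $$J\approx\Big(\int_{(0,\infty)}\big\|v_1^{1/p_1}v_2^{-1/p_2}\big\|_{s,B(0,t)}^{\rho}\,d\Big(-\|\omega\|_{\theta,(0,t+)}^{-\rho}\Big)\Big)^{1/\rho}+\|\omega\|_{\theta,(0,\infty)}^{-1}\big\|v_1^{1/p_1}v_2^{-1/p_2}\big\|_{s,\mathbb{R}^n}.$$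
   Context: $B(0,r)$ is the open ball of radius $r$ centered at $0$ in $\mathbb{R}^n$; ${}^cB(0,r):=\mathbb{R}^n\setminus B(0,r)$. For measurable $A$, $0<p\le\infty$, measurable $w\ge0$: $\|f\|_{p,A,w}:=(\int_A|f|^pw)^{1/p}$ if $p<\infty$, $\operatorname{ess\,sup}_A|f|w$ if $p=\infty$; $\|f\|_{p,A}:=\|f\|_{p,A,1}$. $\mathcal W(\mathbb{R}^n)$: measurable functions positive and finite a.e. Conventions $0/0=0$, $0\cdot(\pm\infty)=0$, $1/(\pm\infty)=0$. $L_p(\mathbb{R}^n,v)=\{f:\|f\|_{p,\mathbb{R}^n,v}<\infty\}$. ${}^cLM_{p\theta,\omega}(\mathbb{R}^n,v)$ is the set of $f$ with $f\in L_p({}^cB(0,t),v)$ for all $t>0$ and $\|f\|:=\big\|\omega(r)\|f\|_{p,{}^cB(0,r),v}\big\|_{\theta,(0,\infty)}<\infty$. ${}^c\Omega_\theta$: measurable $\omega\ge0$ on $(0,\infty)$ with $0<\|\omega\|_{\theta,(0,t)}<\infty$ for all $t>0$. $\|\mathrm{Id}\|_{X\to Y}:=\sup_{f\in X, f\not\sim0}\|f\|_Y/\|f\|_X\in[0,\infty]$. $\|\omega\|_{\theta,(0,t+)}:=\lim_{s\to t+}\|\omega\|_{\theta,(0,s)}$; the integral is the Lebesgue–Stieltjes integral with respect to the non-decreasing, right-continuous function $t\mapsto-\|\omega\|_{\theta,(0,t+)}^{-\rho}$. "Uniformly in $\omega$" means the constants in $\approx$ may depend on $n,p_1,p_2,\theta,v_1,v_2$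 but not on $\omega$. *)

theory Defs
  imports "HOL-Analysis.Analysis" "HOL-Probability.Essential_Supremum"
begin

definition epow :: "ennreal \<Rightarrow> real \<Rightarrow> ennreal" where
  "epow x a =
    (if x = top then (if a > 0 then top else if a < 0 then 0 else 1)
     else if x = 0 then (if a > 0 then 0 else if a < 0 then top else 1)
     else ennreal (enn2real x powr a))"

definition wnorm :: "'a measure \<Rightarrow> ennreal \<Rightarrow> 'a set \<Rightarrow> ('a \<Rightarrow> ennreal) \<Rightarrow> ('a \<Rightarrow> ennreal) \<Rightarrow> ennreal" where
  "wnorm M p A w f =
    (if p = top then esssup M (\<lambda>x. indicator A x * (f x * w x))
     else epow (\<integral>\<^sup>+x\<in>A. epow (f x) (enn2real p) * w x \<partial>M) (1 / enn2real p))"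

definition weights :: "('a::euclidean_space \<Rightarrow> real) set" where
  "weights = {v. v \<in> borel_measurable lebesgue \<and> (AE x in lebesgue. 0 < v x)}"

definition cOmega :: "ennreal \<Rightarrow> (real \<Rightarrow> real) set" where
  "cOmega \<theta> = {\<omega>. \<omega> \<in> borel_measurable lebesgue \<and> (\<forall>t>0. 0 \<le> \<omega> t) \<and>
     (\<forall>t>0. 0 < wnorm lebesgue \<theta> {0<..<t} (\<lambda>_. 1) (\<lambda>r. ennreal \<bar>\<omega> r\<bar>) \<and>
            wnorm lebesgue \<theta> {0<..<t} (\<lambda>_. 1) (\<lambda>r. ennreal \<bar>\<omega> r\<bar>) < top)}"

definition cLM_norm :: "real \<Rightarrow> ennreal \<Rightarrow> (real \<Rightarrow> real) \<Rightarrow> ('a::euclidean_space \<Rightarrow> real)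
    \<Rightarrow> ('a \<Rightarrow> real) \<Rightarrow> ennreal" where
  "cLM_norm p \<theta> \<omega> v f =
     wnorm lebesgue \<theta> {0<..} (\<lambda>_. 1)
       (\<lambda>r. ennreal \<bar>\<omega> r\<bar> *
            wnorm lebesgue (ennreal p) (- ball 0 r) (\<lambda>x. ennreal (v x)) (\<lambda>x. ennreal \<bar>f x\<bar>))"

definition cLM :: "real \<Rightarrow> ennreal \<Rightarrow> (real \<Rightarrow> real) \<Rightarrow> ('a::euclidean_space \<Rightarrow> real)
    \<Rightarrow> ('a \<Rightarrow> real) set" where
  "cLM p \<theta> \<omega> v = {f. f \<in> borel_measurable lebesgue \<and>
     (\<forall>t>0. wnorm lebesgue (ennreal p) (- ball 0 t) (\<lambda>x. ennreal (v x)) (\<lambda>x. ennreal \<bar>f x\<bar>) < top) \<and>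
     cLM_norm p \<theta> \<omega> v f < top}"

definition embed_norm :: "real \<Rightarrow> real \<Rightarrow> ennreal \<Rightarrow> (real \<Rightarrow> real) \<Rightarrow> ('a::euclidean_space \<Rightarrow> real)
    \<Rightarrow> ('a \<Rightarrow> real) \<Rightarrow> ennreal" where
  "embed_norm p1 p2 \<theta> \<omega> v1 v2 =
     (SUP f \<in> {f \<in> cLM p2 \<theta> \<omega> v2. \<not> (AE x in lebesgue. f x = 0)}.
        wnorm lebesgue (ennreal p1) UNIV (\<lambda>x. ennreal (v1 x)) (\<lambda>x. ennreal \<bar>f x\<bar>)
        / cLM_norm p2 \<theta> \<omega> v2 f)"

definition sexp :: "real \<Rightarrow> real \<Rightarrow> ennreal" where
  "sexp p1 p2 = (if p1 = p2 then top else ennreal (p1 * p2 / (p2 - p1)))"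

definition rhoexp :: "real \<Rightarrow> ennreal \<Rightarrow> real" where
  "rhoexp p1 \<theta> = (if \<theta> = top then p1 else p1 * enn2real \<theta> / (enn2real \<theta> - p1))"

definition wquot :: "real \<Rightarrow> real \<Rightarrow> ('a \<Rightarrow> real) \<Rightarrow> ('a \<Rightarrow> real) \<Rightarrow> 'a \<Rightarrow> ennreal" where
  "wquot p1 p2 v1 v2 x = epow (ennreal (v1 x)) (1 / p1) * epow (ennreal (v2 x)) (- 1 / p2)"

definition omnorm :: "ennreal \<Rightarrow> (real \<Rightarrow> real) \<Rightarrow> real \<Rightarrow> ennreal" where
  "omnorm \<theta> \<omega> t = wnorm lebesgue \<theta> {0<..<t} (\<lambda>_. 1) (\<lambda>r. ennreal \<bar>\<omega> r\<bar>)"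

definition omnorm_plus :: "ennreal \<Rightarrow> (real \<Rightarrow> real) \<Rightarrow> real \<Rightarrow> ennreal" where
  "omnorm_plus \<theta> \<omega> t = Lim (at_right t) (\<lambda>s. omnorm \<theta> \<omega> s)"

definition omnorm_inf :: "ennreal \<Rightarrow> (real \<Rightarrow> real) \<Rightarrow> ennreal" where
  "omnorm_inf \<theta> \<omega> = wnorm lebesgue \<theta> {0<..} (\<lambda>_. 1) (\<lambda>r. ennreal \<bar>\<omega> r\<bar>)"

text \<open>Lebesgue--Stieltjes integral over (0,\<infinity>) of a nonnegative h with respect to a
  non-decreasing right-continuous F : (0,\<infinity>) \<rightarrow> R (F may tend to -\<infinity> at 0+).
  The Lebesgue--Stieltjes measure of F restricted to (\<epsilon>,\<infinity>) is that of the
  function t \<mapsto> F (max t \<epsilon>); the integral over (0,\<infinity>) is the supremum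
  (monotone limit) of the integrals over (\<epsilon>,\<infinity>).\<close>
definition LS_integral :: "(real \<Rightarrow> real) \<Rightarrow> (real \<Rightarrow> ennreal) \<Rightarrow> ennreal" where
  "LS_integral F h =
     (SUP \<epsilon> \<in> {0<..}. \<integral>\<^sup>+t\<in>{\<epsilon><..}. h t \<partial>(interval_measure (\<lambda>t. F (max t \<epsilon>))))"

end

(*
  The function W(t) = \<parallel>\<omega>\<parallel>_(\<theta>,(0,t)) splits (0,\<infinity>) into the level sets
  2^k \<le> W < 2^(k+1), and R^n into the corresponding shells E_k.  With a_k the weighted L^(p2)-norm
  of f on E_k and V_k the L^s-norm of v1^(1/p1) v2^(-1/p2) on E_k, the complementary Morrey norm is
  equivalent to the norm of (2^k a_k) in l^\<theta>: the L^\<theta>-mass of \<omega> near level k is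
  comparable to 2^k, and the contribution of the shells further out is absorbed by a discrete Hardy
  inequality.  Hoelder's inequality on every shell and its converse turn the embedding into a
  multiplication operator from l^\<theta> to l^p1 with symbol 2^(-k) V_k, so J is equivalent to the norm
  of (2^(-k) V_k) in l^\<rho>, where \<rho> = \<infinity> if \<theta> \<le> p1.  The same discretization, again with Hardy's
  inequality, identifies the supremum in (a) and the Stieltjes integral plus boundary term in (b) with
  that sequence norm.  Only equivalences are needed, so every elementary inequality is used with a
  crude constant depending on the exponents alone.
*)
theory Submission
  imports Defs
begin

subsection \<open>Powers and quasi-norms of extended nonnegative functions\<close>


text \<open>Two obstacles shape the argument. For exponents below 1 there is no triangle inequality,
  so coverings by shells enter as pointwise suprema rather than sums, and a factor
  \<open>2 powr (d * n)\<close> is sacrificed in order to sum p-th powers geometrically. Hardy's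
  inequality leaves room for this: a shell j levels away costs only \<open>2 powr (j / 2)\<close>,
  while the weight gains \<open>2 powr j\<close>. Secondly, for \<theta> = \<infinity> the function
  \<open>W\<close> may jump. A level may then be empty or consist of a single radius, and the
  Stieltjes measure may have an atom at the edge of a level; moreover \<open>W\<close> is left
  continuous, whereas the integrator is built from right limits. Hence shell norms are recovered
  from balls only after discarding a null sphere, two radii of one level are kept to compare
  \<open>W\<close> with its right limit, and lower bounds for the Stieltjes measure use blocks of
  three consecutive levels. All norms live in [0, \<infinity>] with 0 * \<infinity> = 0; since they
  may be infinite, converse inequalities are proved for values strictly below a norm and then passed
  to the limit.\<close>

lemma epow_top [simp]: "0 < a \<Longrightarrow> epow top a = top"
  by (simp add: epow_def)

lemma epow_zero [simp]: "0 < a \<Longrightarrow> epow 0 a = 0"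
  by (simp add: epow_def)

lemma epow_ennreal: "0 < a \<Longrightarrow> 0 \<le> x \<Longrightarrow> epow (ennreal x) a = ennreal (x powr a)"
  by (auto simp: epow_def)

lemma epow_one_exp [simp]: "epow x 1 = x"
  by (cases x) (auto simp: epow_ennreal)

lemma epow_one [simp]: "0 < a \<Longrightarrow> epow 1 a = 1"
  using epow_ennreal[of a 1] by simp

lemma epow_eq_0_iff [simp]: "0 < a \<Longrightarrow> epow x a = 0 \<longleftrightarrow> x = 0"
  by (cases x) (auto simp: epow_ennreal)

lemma epow_eq_top_iff [simp]: "0 < a \<Longrightarrow> epow x a = top \<longleftrightarrow> x = top"
  by (cases x) (auto simp: epow_ennreal)

lemma epow_mult: "0 < a \<Longrightarrow> epow (x * y) a = epow x a * epow y a"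
proof (cases "x = top \<or> y = top")
  case True
  assume "0 < a"
  then show ?thesis using True
    by (cases "x = 0"; cases "y = 0") (auto simp: ennreal_mult_top ennreal_top_mult)
next
  case False
  assume "0 < a"
  then show ?thesis using False
    by (cases x; cases y) (auto simp: epow_ennreal ennreal_mult[symmetric] powr_mult)
qed

lemma epow_epow: "0 < a \<Longrightarrow> 0 < b \<Longrightarrow> epow (epow x a) b = epow x (a * b)"
  by (cases x) (auto simp: epow_ennreal powr_powr)

lemma epow_add: "0 < a \<Longrightarrow> 0 < b \<Longrightarrow> epow x (a + b) = epow x a * epow x b"
  by (cases x) (auto simp: epow_ennreal powr_add ennreal_mult ennreal_mult_top)

lemma epow_mono: "0 < a \<Longrightarrow> x \<le> y \<Longrightarrow> epow x a \<le> epow y a"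
  by (cases x; cases y) (auto simp: epow_ennreal powr_mono2 top_unique)

lemma epow_inverse_cancel [simp]:
  "0 < a \<Longrightarrow> epow (epow x a) (1 / a) = x" "0 < a \<Longrightarrow> epow (epow x (1 / a)) a = x"
  by (simp_all add: epow_epow)

text \<open>The powers \<open>a\<close> and \<open>1 / a\<close> are mutually inverse order
  isomorphisms of [0, \<infinity>]; this adjunction makes powers commute with arbitrary
  suprema.\<close>

lemma epow_le_iff: "0 < a \<Longrightarrow> epow x a \<le> y \<longleftrightarrow> x \<le> epow y (1 / a)"
  by (metis epow_inverse_cancel epow_mono zero_less_divide_1_iff)

lemma epow_SUP: "0 < a \<Longrightarrow> epow (SUP i\<in>I. f i) a = (SUP i\<in>I. epow (f i) a)"
proof (rule antisym)
  assume a: "0 < a"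
  show "epow (SUP i\<in>I. f i) a \<le> (SUP i\<in>I. epow (f i) a)"
    unfolding epow_le_iff[OF a] by (intro SUP_least, subst epow_le_iff[OF a, symmetric]) (rule SUP_upper)
  show "(SUP i\<in>I. epow (f i) a) \<le> epow (SUP i\<in>I. f i) a"
    by (intro SUP_least epow_mono a SUP_upper)
qed

lemma epow_indicator: "0 < a \<Longrightarrow> epow (indicator A x) a = indicator A x"
  by (simp add: indicator_def)

lemma epow_measurable [measurable]:
  assumes [measurable]: "f \<in> borel_measurable M"
  shows "(\<lambda>x. epow (f x) a) \<in> borel_measurable M"
  unfolding epow_def by measurable

text \<open>Sets and weights are absorbed into the function, at finite exponents the weight as a
  factor \<open>epow (w x) (1 / p)\<close>. Lebesgue, counting and Stieltjes measures and the
  exponent \<infinity> then share one calculus.\<close>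

definition enorm :: "'a measure \<Rightarrow> ennreal \<Rightarrow> ('a \<Rightarrow> ennreal) \<Rightarrow> ennreal" where
  "enorm M p f = (if p = top then esssup M f
     else epow (\<integral>\<^sup>+x. epow (f x) (enn2real p) \<partial>M) (1 / enn2real p))"

lemma wnorm_unweighted: "0 < p \<Longrightarrow> wnorm M p A (\<lambda>_. 1) f = enorm M p (\<lambda>x. indicator A x * f x)"
proof (cases "p = top")
  case False
  assume "0 < p"
  then have "0 < enn2real p" using False by (simp add: enn2real_positive_iff less_top)
  then show ?thesis using False
    by (simp add: wnorm_def enorm_def epow_mult epow_indicator mult.commute)
qed (simp add: wnorm_def enorm_def)

lemma wnorm_weighted:
  "0 < p \<Longrightarrow> wnorm M (ennreal p) A w f = enorm M (ennreal p) (\<lambda>x. indicator A x * (f x * epow (w x) (1 / p)))"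
  by (simp add: wnorm_def enorm_def epow_mult epow_indicator mult.commute)

lemma enorm_finite_exp: "0 < p \<Longrightarrow> enorm M (ennreal p) f = epow (\<integral>\<^sup>+x. epow (f x) p \<partial>M) (1 / p)"
  by (simp add: enorm_def)

lemma epow_enorm: "0 < p \<Longrightarrow> epow (enorm M (ennreal p) f) p = (\<integral>\<^sup>+x. epow (f x) p \<partial>M)"
  by (simp add: enorm_def)

lemma exponent_cases:
  fixes p :: ennreal
  assumes "0 < p"
  obtains (top) "p = top" | (real) r where "p = ennreal r" "0 < r"
  using assms by (cases p) auto

lemma enorm_mono_AE:
  assumes "0 < p" and [measurable]: "f \<in> borel_measurable M" and "AE x in M. f x \<le> g x"
  shows "enorm M p f \<le> enorm M p g"
  using \<open>0 < p\<close>
proof (cases p rule: exponent_cases)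
  case top then show ?thesis using assms by (simp add: enorm_def esssup_AE_mono)
next
  case (real r)
  then show ?thesis using assms
    by (auto simp: enorm_finite_exp intro!: epow_mono nn_integral_mono_AE elim!: eventually_mono)
qed

lemma enorm_mono:
  assumes "0 < p" "f \<in> borel_measurable M" "\<And>x. f x \<le> g x"
  shows "enorm M p f \<le> enorm M p g"
  using assms by (intro enorm_mono_AE) auto

lemma enorm_cong_AE:
  assumes "0 < p" "f \<in> borel_measurable M" "g \<in> borel_measurable M" "AE x in M. f x = g x"
  shows "enorm M p f = enorm M p g"
  using assms by (intro antisym enorm_mono_AE) auto

lemma enorm_eq_0_AE:
  assumes "0 < p" "f \<in> borel_measurable M" "AE x in M. f x = 0"
  shows "enorm M p f = 0"
proof -
  have "enorm M p f \<le> enorm M p (\<lambda>_. 0)" using assms by (intro enorm_mono_AE) auto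
  also have "\<dots> = 0" using \<open>0 < p\<close>
    by (cases p rule: exponent_cases) (auto simp: enorm_def intro!: antisym esssup_I)
  finally show ?thesis by simp
qed

lemma ennreal_mult_inverse_cancel:
  fixes c y :: ennreal
  assumes "c \<noteq> 0" "c \<noteq> top"
  shows "c * (inverse c * y) = y" "inverse c * (c * y) = y"
proof -
  have *: "inverse c * c = 1"
    using assms by (metis divide_ennreal_def ennreal_divide_self less_top mult.commute)
  then show "inverse c * (c * y) = y" by (simp flip: mult.assoc)
  show "c * (inverse c * y) = y" using * by (simp flip: mult.assoc add: mult.commute[of c "inverse c"])
qed

lemma enorm_cmult:
  assumes "0 < p" and [measurable]: "f \<in> borel_measurable M"
  shows "enorm M p (\<lambda>x. c * f x) = c * enorm M p f"
  using \<open>0 < p\<close>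
proof (cases p rule: exponent_cases)
  case (real r)
  then show ?thesis
    by (simp add: enorm_finite_exp epow_mult nn_integral_cmult)
next
  case top
  have up: "esssup M (\<lambda>x. c * f x) \<le> c * esssup M f"
    if [measurable]: "f \<in> borel_measurable M" for c and f :: "'a \<Rightarrow> ennreal"
    using esssup_AE[of f M] by (intro esssup_I) (auto elim!: eventually_mono intro: mult_left_mono)
  consider "c = 0" | "c = top" | "c \<noteq> 0" "c \<noteq> top" by blast
  then have "c * esssup M f \<le> esssup M (\<lambda>x. c * f x)"
  proof cases
    case 2
    show ?thesis
    proof (cases "esssup M f = 0")
      case False
      \<comment> \<open>An infinite factor leaves the essential supremum finite only if
        \<open>f\<close> vanishes almost everywhere.\<close>
      have "AE x in M. f x \<le> 0" if "esssup M (\<lambda>x. c * f x) \<noteq> top"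
        using esssup_AE[of "\<lambda>x. c * f x" M]
      proof eventually_elim
        case (elim x)
        then show ?case using that 2 by (cases "f x = 0") (auto simp: ennreal_top_mult top_unique)
      qed
      then have "esssup M (\<lambda>x. c * f x) \<noteq> top \<Longrightarrow> esssup M f \<le> 0"
        by (intro esssup_I) auto
      with False have "esssup M (\<lambda>x. c * f x) = top" by auto
      then show ?thesis by simp
    qed simp
  next
    case 3
    have "c * esssup M f = c * esssup M (\<lambda>x. inverse c * (c * f x))"
      using 3 by (simp add: ennreal_mult_inverse_cancel)
    also have "\<dots> \<le> c * (inverse c * esssup M (\<lambda>x. c * f x))"
      by (intro mult_left_mono up) auto
    also have "\<dots> = esssup M (\<lambda>x. c * f x)"
      using 3 by (simp add: ennreal_mult_inverse_cancel)
    finally show ?thesis .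
  qed simp
  with up[of f c] show ?thesis by (simp add: top enorm_def antisym)
qed

lemma enorm_SUP:
  assumes "0 < p" and [measurable]: "\<And>n::nat. f n \<in> borel_measurable M"
    and inc: "\<And>x. incseq (\<lambda>n. f n x)"
  shows "enorm M p (\<lambda>x. SUP n. f n x) = (SUP n. enorm M p (f n))"
  using \<open>0 < p\<close>
proof (cases p rule: exponent_cases)
  case (real r)
  have "incseq (\<lambda>n x. epow (f n x) r)"
    using inc real by (auto simp: incseq_def le_fun_def intro!: epow_mono)
  then show ?thesis using real
    by (simp add: enorm_finite_exp epow_SUP nn_integral_monotone_convergence_SUP)
next
  case top
  have "AE x in M. \<forall>n. f n x \<le> esssup M (f n)"
    by (subst AE_all_countable) (auto intro: esssup_AE)
  then have "esssup M (\<lambda>x. SUP n. f n x) \<le> (SUP n. esssup M (f n))"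
    by (intro esssup_I) (auto elim!: eventually_mono intro!: SUP_mono')
  moreover have "(SUP n. esssup M (f n)) \<le> esssup M (\<lambda>x. SUP n. f n x)"
    by (intro SUP_least esssup_mono) (auto intro: SUP_upper)
  ultimately show ?thesis by (simp add: top enorm_def antisym)
qed


section \<open>Geometric summation in place of the triangle inequality\<close>

definition geo_const :: "ennreal \<Rightarrow> real \<Rightarrow> real" where
  "geo_const p d = (if p = top then 1 else (1 / (1 - 2 powr (- d * enn2real p))) powr (1 / enn2real p))"

lemma geo_const_pos: "0 < d \<Longrightarrow> 0 < p \<Longrightarrow> 0 < geo_const p d"
  by (cases p rule: exponent_cases) (auto simp: geo_const_def)

lemma suminf_powr_geometric:
  assumes "0 < a"
  shows "(\<Sum>n. ennreal (2 powr (- (a * real n)))) = ennreal (1 / (1 - 2 powr (- a)))"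
proof -
  have "(\<lambda>n. (2 powr (- a)) ^ n) sums (1 / (1 - 2 powr (- a)))"
    using powr_less_mono[of "- a" 0 2] assms by (intro geometric_sums) auto
  moreover have "(2 powr (- a)) ^ n = 2 powr (- (a * real n))" for n
    by (simp add: powr_realpow[symmetric] powr_powr)
  ultimately show ?thesis by (intro suminf_ennreal_eq) auto
qed

lemma ennreal_le_mult_left: "1 \<le> c \<Longrightarrow> x \<le> c * (x::ennreal)"
  using mult_right_mono[of 1 c x] by simp

text \<open>The p-th power of a supremum is at most the sum of the p-th powers, and their integrals
  decay like \<open>2 powr (- (d * p * n))\<close> relative to the weighted supremum. Hence
  \<open>geo_const p d\<close> is the p-th root of that geometric series, and 1 for p = \<infinity>.
  The argument is indifferent to whether p < 1.\<close>

lemma enorm_SUP_geometric: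
  assumes p: "0 < p" and d: "0 < d" and [measurable]: "\<And>n::nat. f n \<in> borel_measurable M"
  shows "enorm M p (\<lambda>x. SUP n. f n x)
    \<le> ennreal (geo_const p d) * (SUP n. ennreal (2 powr (d * real n)) * enorm M p (f n))"
    (is "_ \<le> _ * ?S")
  using p
proof (cases p rule: exponent_cases)
  case top
  have "enorm M p (f n) \<le> ennreal (2 powr (d * real n)) * enorm M p (f n)" for n
    using d by (intro ennreal_le_mult_left) (auto simp: ge_one_powr_ge_zero)
  then have *: "esssup M (f n) \<le> ?S" for n
    using top by (intro order_trans[OF _ SUP_upper[of n]]) (auto simp: enorm_def)
  have "AE x in M. \<forall>n. f n x \<le> esssup M (f n)"
    by (subst AE_all_countable) (auto intro: esssup_AE)
  then have "AE x in M. (SUP n. f n x) \<le> ?S"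
    by eventually_elim (use * in \<open>auto intro!: SUP_least intro: order_trans\<close>)
  then show ?thesis using top by (simp add: enorm_def geo_const_def esssup_I)
next
  case (real r)
  have le: "enorm M p (f n) \<le> ennreal (2 powr (- (d * real n))) * ?S" for n
  proof -
    have "enorm M p (f n) = ennreal (2 powr (- (d * real n))) * (ennreal (2 powr (d * real n)) * enorm M p (f n))"
      by (simp add: mult.assoc[symmetric] ennreal_mult[symmetric] powr_add[symmetric])
    also have "\<dots> \<le> ennreal (2 powr (- (d * real n))) * ?S"
      by (intro mult_left_mono SUP_upper) auto
    finally show ?thesis .
  qed
  have "(\<integral>\<^sup>+x. epow (SUP n. f n x) r \<partial>M) \<le> (\<integral>\<^sup>+x. (\<Sum>n. epow (f n x) r) \<partial>M)"
    using real by (intro nn_integral_mono) (auto simp: epow_SUP intro!: SUP_least ennreal_suminf_bound_add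
        sum_le_suminf[of _ "{_}", simplified])
  also have "\<dots> = (\<Sum>n. epow (enorm M p (f n)) r)"
    using real by (simp add: nn_integral_suminf epow_enorm)
  also have "\<dots> \<le> (\<Sum>n. ennreal (2 powr (- (d * r * real n))) * epow ?S r)"
  proof (intro suminf_le)
    fix n
    have "epow (enorm M p (f n)) r \<le> epow (ennreal (2 powr (- (d * real n))) * ?S) r"
      using real by (intro epow_mono le) auto
    then show "epow (enorm M p (f n)) r \<le> ennreal (2 powr (- (d * r * real n))) * epow ?S r"
      using real by (simp add: epow_mult epow_ennreal powr_powr mult_ac)
  qed auto
  also have "\<dots> = ennreal (1 / (1 - 2 powr (- (d * r)))) * epow ?S r"
    using real d by (simp only: ennreal_suminf_multc suminf_powr_geometric mult_pos_pos)
  finally have "enorm M p (\<lambda>x. SUP n. f n x) \<le> epow (ennreal (1 / (1 - 2 powr (- (d * r)))) * epow ?S r) (1 / r)"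
    using real by (simp add: enorm_finite_exp epow_mono)
  also have "\<dots> = ennreal (geo_const p d) * ?S"
  proof -
    have "2 powr (- (d * r)) < 1" using real d powr_less_mono[of "- (d * r)" 0 2] by simp
    then show ?thesis using real
      by (simp add: epow_mult epow_ennreal geo_const_def)
  qed
  finally show ?thesis .
qed

text \<open>A two-term supremum padded with zeros: the geometric bound with d = 1 acts as
  quasi-triangle inequality, and the weight \<open>2 powr 1\<close> of the second term is the factor
  2.\<close>

lemma enorm_max:
  assumes p: "0 < p" and [measurable]: "f \<in> borel_measurable M" "g \<in> borel_measurable M"
  shows "enorm M p (\<lambda>x. max (f x) (g x)) \<le> ennreal (2 * geo_const p 1) * max (enorm M p f) (enorm M p g)"
proof -
  define h where "h = (\<lambda>n::nat. if n = 0 then f else if n = 1 then g else (\<lambda>_. 0))"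
  have [measurable]: "h n \<in> borel_measurable M" for n by (simp add: h_def)
  have "max (f x) (g x) \<le> (SUP n. h n x)" for x
    using SUP_upper[of 0 UNIV "\<lambda>n. h n x"] SUP_upper[of 1 UNIV "\<lambda>n. h n x"] by (auto simp: h_def)
  then have "enorm M p (\<lambda>x. max (f x) (g x)) \<le> enorm M p (\<lambda>x. SUP n. h n x)"
    using p by (intro enorm_mono) auto
  also have "\<dots> \<le> ennreal (geo_const p 1) * (SUP n. ennreal (2 powr (1 * real n)) * enorm M p (h n))"
    using p by (intro enorm_SUP_geometric) auto
  also have "\<dots> \<le> ennreal (geo_const p 1) * (2 * max (enorm M p f) (enorm M p g))"
  proof (intro mult_left_mono SUP_least)
    fix n :: nat
    have z: "enorm M p (\<lambda>_. 0) = 0" using p by (intro enorm_eq_0_AE) auto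
    have "enorm M p f \<le> 2 * max (enorm M p f) (enorm M p g)"
      using ennreal_le_mult_left[of 2 "max (enorm M p f) (enorm M p g)"] by (simp add: max_def split: if_splits)
    then show "ennreal (2 powr (1 * real n)) * enorm M p (h n) \<le> 2 * max (enorm M p f) (enorm M p g)"
      by (auto simp: h_def z intro: mult_left_mono)
  qed simp
  finally show ?thesis
    using geo_const_pos[of 1 p] p by (simp add: ennreal_mult mult_ac)
qed

section \<open>Partitions into levels and sequence norms over the integers\<close>

lemma enorm_count_top: "enorm (count_space UNIV) top u = (SUP k. u k)"
  unfolding enorm_def by (auto simp: esssup_eq_AE AE_count_space
      intro!: antisym Inf_lower Inf_greatest SUP_upper SUP_least)

text \<open>The levels are disjoint: Tonelli settles finite exponents, a countable union of null
  sets the exponent \<infinity>.\<close>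

lemma enorm_partition:
  fixes L :: "'a \<Rightarrow> int"
  assumes p: "0 < p" and [measurable]: "f \<in> borel_measurable M" "L \<in> measurable M (count_space UNIV)"
  shows "enorm M p f = enorm (count_space UNIV) p (\<lambda>k. enorm M p (\<lambda>x. indicator {x. L x = k} x * f x))"
  using p
proof (cases p rule: exponent_cases)
  case (real r)
  have [measurable]: "(\<lambda>x. indicator {x. L x = k} x) \<in> borel_measurable M" for k
    by measurable
  have "(\<integral>\<^sup>+x. epow (f x) r \<partial>M) = (\<integral>\<^sup>+x. (\<integral>\<^sup>+k. epow (indicator {x. L x = k} x * f x) r \<partial>count_space UNIV) \<partial>M)"
  proof (rule nn_integral_cong)
    fix x
    show "epow (f x) r = (\<integral>\<^sup>+k. epow (indicator {x. L x = k} x * f x) r \<partial>count_space UNIV)"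
      using real by (subst nn_integral_count_space'[of "{L x}"]) auto
  qed
  also have "\<dots> = (\<integral>\<^sup>+k. (\<integral>\<^sup>+x. epow (indicator {x. L x = k} x * f x) r \<partial>M) \<partial>count_space UNIV)"
    by (rule nn_integral_count_space_nn_integral) auto
  finally show ?thesis using real by (simp add: enorm_finite_exp)
next
  case top
  have "AE x in M. \<forall>k. indicator {x. L x = k} x * f x \<le> esssup M (\<lambda>x. indicator {x. L x = k} x * f x)"
    by (subst AE_all_countable) (auto intro: esssup_AE)
  then have "AE x in M. f x \<le> (SUP k. esssup M (\<lambda>x. indicator {x. L x = k} x * f x))"
  proof eventually_elim
    case (elim x)
    from elim[rule_format, of "L x"] show ?case by (intro SUP_upper2[of "L x"]) auto
  qed
  then have "esssup M f \<le> (SUP k. esssup M (\<lambda>x. indicator {x. L x = k} x * f x))"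
    by (intro esssup_I) auto
  moreover have "(SUP k. esssup M (\<lambda>x. indicator {x. L x = k} x * f x)) \<le> esssup M f"
    by (intro SUP_least esssup_mono) (auto simp: indicator_def)
  ultimately show ?thesis by (simp add: top enorm_count_top) (simp add: enorm_def)
qed

lemma enorm_count_bij:
  assumes "0 < p" "bij g"
  shows "enorm (count_space UNIV) p (\<lambda>k. u (g k)) = enorm (count_space UNIV) p u"
  using \<open>0 < p\<close>
proof (cases p rule: exponent_cases)
  case (real r)
  then show ?thesis
    using nn_integral_bij_count_space[of g UNIV UNIV "\<lambda>x. epow (u x) r"] \<open>bij g\<close>
    by (simp add: enorm_finite_exp)
next
  case top
  have "range g = UNIV" using \<open>bij g\<close> by (simp add: bij_is_surj)
  then show ?thesis by (simp add: top enorm_count_top) (metis image_image)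
qed

lemma enorm_count_ge:
  assumes "0 < p"
  shows "u k \<le> enorm (count_space UNIV) p u"
  using assms
proof (cases p rule: exponent_cases)
  case (real r)
  have "epow (u k) r = (\<integral>\<^sup>+i. epow (u i) r * indicator {k} i \<partial>count_space UNIV)"
    by (subst nn_integral_count_space'[of "{k}"]) auto
  also have "\<dots> \<le> (\<integral>\<^sup>+i. epow (u i) r \<partial>count_space UNIV)"
    by (intro nn_integral_mono) (auto simp: indicator_def)
  finally show ?thesis using real by (simp add: enorm_finite_exp epow_le_iff)
qed (auto simp: enorm_count_top intro: SUP_upper)

text \<open>Every entry is at most the norm \<open>?S\<close> with exponent q, so in the p-th powers
  the factor \<open>epow (u k) (p - q)\<close> may be replaced by
  \<open>epow ?S (p - q)\<close>.\<close>

lemma enorm_count_antimono_exponent: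
  assumes "0 < q" "q \<le> p"
  shows "enorm (count_space UNIV) (ennreal p) u \<le> enorm (count_space UNIV) (ennreal q) u" (is "_ \<le> ?S")
proof (cases "q = p")
  case False
  with assms have pq: "0 < p - q" by simp
  have "(\<integral>\<^sup>+k. epow (u k) p \<partial>count_space UNIV) \<le> (\<integral>\<^sup>+k. epow ?S (p - q) * epow (u k) q \<partial>count_space UNIV)"
  proof (rule nn_integral_mono)
    fix k
    have "epow (u k) p = epow (u k) (p - q) * epow (u k) q"
      using pq assms epow_add[of "p - q" q "u k"] by simp
    also have "\<dots> \<le> epow ?S (p - q) * epow (u k) q"
      using pq assms by (intro mult_right_mono epow_mono enorm_count_ge) auto
    finally show "epow (u k) p \<le> epow ?S (p - q) * epow (u k) q" .
  qed
  also have "\<dots> = epow ?S (p - q) * epow ?S q"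
    using assms by (simp add: nn_integral_cmult epow_enorm)
  also have "\<dots> = epow ?S p"
    using pq assms epow_add[of "p - q" q ?S] by simp
  finally show ?thesis
    using assms epow_mono[of "1 / p"] by (fastforce simp: enorm_finite_exp[of p])
qed simp

text \<open>Near-extremal functions are available only for values strictly below a shell norm, and
  that norm may be 0 or \<infinity>. Testing with finitely supported \<open>c\<close> that are 0 or
  strictly below \<open>v\<close> is the form in which both converse estimates can be
  applied.\<close>

lemma enorm_count_approx:
  fixes v a :: "int \<Rightarrow> ennreal"
  assumes p: "0 < p"
    and X: "\<And>c. finite {k. c k \<noteq> 0} \<Longrightarrow> (\<And>k. c k = 0 \<or> c k < v k) \<Longrightarrow> enorm (count_space UNIV) p (\<lambda>k. a k * c k) \<le> X"
  shows "enorm (count_space UNIV) p (\<lambda>k. a k * v k) \<le> 2 * X"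
proof -
  \<comment> \<open>Halving puts finite positive values strictly below \<open>v k\<close>, the cap
    \<open>n\<close> does so for infinite ones. The halving is the factor 2 of the claim.\<close>
  define c where "c = (\<lambda>n k. if \<bar>k\<bar> \<le> int n then min (v k / 2) (of_nat n) else 0)"
  have inc: "incseq (\<lambda>n. c n k)" for k
    by (auto simp: c_def incseq_def intro: min.coboundedI2)
  have le: "enorm (count_space UNIV) p (\<lambda>k. a k * c n k) \<le> X" for n
  proof (rule X)
    have "{k. c n k \<noteq> 0} \<subseteq> {- int n..int n}" by (auto simp: c_def)
    then show "finite {k. c n k \<noteq> 0}" by (rule finite_subset) simp
    show "c n k = 0 \<or> c n k < v k" for k
    proof (cases "v k" rule: ennreal_cases)
      case (real r)
      have "v k = 0 \<or> v k / 2 < v k" using real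
        by (auto simp: ennreal_divide_numeral ennreal_less_iff)
      then show ?thesis by (auto simp: c_def min_less_iff_disj)
    qed (auto simp: c_def min_less_iff_disj of_nat_less_top)
  qed
  have lim: "v k / 2 \<le> (SUP n. c n k)" for k
  proof (cases "v k / 2" rule: ennreal_cases)
    case (real r)
    obtain n1 where "r \<le> real n1" using real_arch_simple by blast
    then have "r \<le> real (max n1 (nat \<bar>k\<bar>))" by simp
    then have "v k / 2 \<le> c (max n1 (nat \<bar>k\<bar>)) k"
      using real by (auto simp: c_def ennreal_of_nat_eq_real_of_nat simp del: of_nat_max)
    then show ?thesis by (rule SUP_upper2[rotated]) simp
  next
    case top
    have "of_nat n \<le> (SUP n. c n k)" for n
    proof -
      have "of_nat n \<le> c (max n (nat \<bar>k\<bar>)) k" using top by (auto simp: c_def)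
      then show ?thesis by (rule SUP_upper2[rotated]) simp
    qed
    then have "(SUP n. of_nat n :: ennreal) \<le> (SUP n. c n k)" by (rule SUP_least)
    then have "(SUP n. c n k) = top" by (simp add: ennreal_SUP_of_nat_eq_top top_unique)
    then show ?thesis by (simp only: top_greatest)
  qed
  have half: "2 * (v k / 2) = v k" for k
    by (simp add: ennreal_times_divide mult.commute[of 2] mult_divide_eq_ennreal)
  have "enorm (count_space UNIV) p (\<lambda>k. a k * v k) = 2 * enorm (count_space UNIV) p (\<lambda>k. a k * (v k / 2))"
    using p by (subst enorm_cmult[symmetric]) (auto simp: half mult.left_commute[of 2])
  also have "enorm (count_space UNIV) p (\<lambda>k. a k * (v k / 2)) \<le> enorm (count_space UNIV) p (\<lambda>k. SUP n. a k * c n k)"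
    using p by (intro enorm_mono) (auto simp: SUP_mult_left_ennreal[symmetric] intro!: mult_left_mono lim)
  also have "\<dots> = (SUP n. enorm (count_space UNIV) p (\<lambda>k. a k * c n k))"
    using p inc by (intro enorm_SUP) (auto simp: incseq_def intro!: mult_left_mono)
  also have "\<dots> \<le> X" by (intro SUP_least le)
  finally show ?thesis by (simp add: mult_left_mono)
qed

subsection \<open>Hoelder's inequality and its converse; Hardy's inequality\<close>


text \<open>For \<open>a + b = 1\<close> the crude bound \<open>x\<^sup>a y\<^sup>b \<le> x + y\<close> replaces Young's inequality, at the cost
  of the factor 2.\<close>

lemma nn_integral_epow_mult_le:
  assumes ab: "0 < a" "0 < b" "a + b = 1"
    and [measurable]: "f \<in> borel_measurable M" "g \<in> borel_measurable M"
  shows "(\<integral>\<^sup>+x. epow (f x) a * epow (g x) b \<partial>M)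
    \<le> 2 * (epow (\<integral>\<^sup>+x. f x \<partial>M) a * epow (\<integral>\<^sup>+x. g x \<partial>M) b)" (is "?I \<le> 2 * (epow ?F a * epow ?G b)")
proof -
  have zero: "?I = 0" if "?F = 0 \<or> ?G = 0"
  proof -
    have "AE x in M. epow (f x) a * epow (g x) b = 0"
      using that ab by (auto simp: nn_integral_0_iff_AE elim!: eventually_mono)
    then show ?thesis by (simp add: nn_integral_0_iff_AE)
  qed
  show ?thesis
  proof (cases "?F = 0 \<or> ?G = 0 \<or> ?F = top \<or> ?G = top")
    case True
    then show ?thesis using zero ab by (cases "?F = 0 \<or> ?G = 0") (auto simp: ennreal_mult_top ennreal_top_mult)
  next
    case False
    have le: "epow x a * epow y b \<le> x + y" for x y :: ennreal
    proof -
      have "epow x a * epow y b \<le> epow (max x y) a * epow (max x y) b"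
        using ab by (intro mult_mono epow_mono) auto
      also have "\<dots> = max x y" using ab epow_add[of a b "max x y"] by simp
      also have "\<dots> \<le> x + y" by (simp add: max_def)
      finally show ?thesis .
    qed
    have cancel: "epow c d * epow (inverse c * y) d = epow y d" if "c \<noteq> 0" "c \<noteq> top" "0 < d" for c y d
      using that by (simp add: epow_mult[symmetric] ennreal_mult_inverse_cancel)
    \<comment> \<open>With both functions scaled to integral 1, the crude bound integrates to 1 +
      1.\<close>
    have "?I = (\<integral>\<^sup>+x. epow ?F a * epow ?G b * (epow (inverse ?F * f x) a * epow (inverse ?G * g x) b) \<partial>M)"
      using False ab cancel[of ?F a] cancel[of ?G b] by (simp add: mult_ac)
    also have "\<dots> = epow ?F a * epow ?G b * (\<integral>\<^sup>+x. epow (inverse ?F * f x) a * epow (inverse ?G * g x) b \<partial>M)"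
      by (rule nn_integral_cmult) measurable
    also have "\<dots> \<le> epow ?F a * epow ?G b * (\<integral>\<^sup>+x. inverse ?F * f x + inverse ?G * g x \<partial>M)"
      by (intro mult_left_mono nn_integral_mono le) auto
    also have "(\<integral>\<^sup>+x. inverse ?F * f x + inverse ?G * g x \<partial>M) = inverse ?F * ?F + inverse ?G * ?G"
      by (simp add: nn_integral_add nn_integral_cmult)
    also have "\<dots> = 2"
      using False ennreal_mult_inverse_cancel(2)[of ?F 1] ennreal_mult_inverse_cancel(2)[of ?G 1] by simp
    finally show ?thesis by (simp add: mult_ac)
  qed
qed

text \<open>Inversion is an involution on [0, \<infinity>], so an infinite exponent forces the other
  one to equal p; otherwise the relation holds between real reciprocals.\<close>

lemma ennreal_inverse_exponents:
  assumes "0 < p" "0 < r" "0 < s" "inverse (ennreal p) = inverse r + inverse s"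
  obtains (top_left) "r = top" "s = ennreal p"
    | (top_right) "r = ennreal p" "s = top"
    | (finite) r' s' where "r = ennreal r'" "s = ennreal s'" "0 < r'" "0 < s'" "1 / p = 1 / r' + 1 / s'"
proof -
  have inv_inv: "inverse (inverse x) = x" for x :: ennreal
  proof (cases x)
    case (real t)
    then show ?thesis by (cases "t = 0") (simp_all add: inverse_ennreal)
  qed simp
  have inj: "x = y" if "inverse x = inverse y" for x y :: ennreal
    using that by (metis inv_inv)
  show ?thesis
    using \<open>0 < r\<close>
  proof (cases r rule: exponent_cases)
    case top
    have "inverse s = inverse (ennreal p)" unfolding assms(4) top by simp
    then have "s = ennreal p" by (rule inj)
    with top show ?thesis by (rule top_left)
  next
    case r: (real r')
    show ?thesis
      using \<open>0 < s\<close>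
    proof (cases s rule: exponent_cases)
      case top
      have "inverse r = inverse (ennreal p)" unfolding assms(4) top by simp
      then have "r = ennreal p" by (rule inj)
      then show ?thesis using top by (rule top_right)
    next
      case s: (real s')
      have "ennreal (inverse p) = ennreal (inverse r' + inverse s')"
        using assms r s by (simp add: inverse_ennreal)
      then have "inverse p = inverse r' + inverse s'"
        using assms r s by (subst (asm) ennreal_inj) auto
      then show ?thesis using finite[OF r(1) s(1) r(2) s(2)] by (simp add: inverse_eq_divide)
    qed
  qed
qed

lemma enorm_mult_top_le:
  assumes [measurable]: "f \<in> borel_measurable M" "g \<in> borel_measurable M" and "0 < p"
  shows "enorm M p (\<lambda>x. f x * g x) \<le> enorm M top f * enorm M p g"
proof -
  have "AE x in M. f x * g x \<le> esssup M f * g x"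
    using esssup_AE[of f M] by eventually_elim (simp add: mult_right_mono)
  then have "enorm M p (\<lambda>x. f x * g x) \<le> enorm M p (\<lambda>x. esssup M f * g x)"
    using \<open>0 < p\<close> by (intro enorm_mono_AE) auto
  then show ?thesis using \<open>0 < p\<close> by (simp add: enorm_cmult) (simp add: enorm_def)
qed

text \<open>The constant is the p-th root of the 2 lost in the crude Young bound, which is applied
  with the exponents \<open>p / r'\<close> and \<open>p / s'\<close> of sum 1.\<close>

lemma enorm_holder:
  assumes pos: "0 < p" "0 < r" "0 < s" and exps: "inverse (ennreal p) = inverse r + inverse s"
    and [measurable]: "f \<in> borel_measurable M" "g \<in> borel_measurable M"
  shows "enorm M (ennreal p) (\<lambda>x. f x * g x) \<le> ennreal (2 powr (1 / p)) * (enorm M r f * enorm M s g)"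
proof -
  have one: "1 \<le> ennreal (2 powr (1 / p))"
    using \<open>0 < p\<close> by (simp add: ge_one_powr_ge_zero)
  show ?thesis
    using pos exps
  proof (cases rule: ennreal_inverse_exponents)
    case top_left
    then show ?thesis using enorm_mult_top_le[of f M g "ennreal p"] pos ennreal_le_mult_left[OF one] order_trans by force
  next
    case top_right
    then show ?thesis using enorm_mult_top_le[of g M f "ennreal p"] pos ennreal_le_mult_left[OF one] order_trans
      by (force simp: mult.commute)
  next
    case (finite r' s')
    have "(\<integral>\<^sup>+x. epow (f x * g x) p \<partial>M) = (\<integral>\<^sup>+x. epow (epow (f x) r') (p / r') * epow (epow (g x) s') (p / s') \<partial>M)"
      using finite pos by (simp add: epow_epow epow_mult)
    also have "\<dots> \<le> 2 * (epow (\<integral>\<^sup>+x. epow (f x) r' \<partial>M) (p / r') * epow (\<integral>\<^sup>+x. epow (g x) s' \<partial>M) (p / s'))"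
    proof (rule nn_integral_epow_mult_le)
      have "p / r' + p / s' = p * (1 / p)" unfolding finite by (simp add: distrib_left)
      then show "p / r' + p / s' = 1" using pos by simp
    qed (use finite pos in auto)
    also have "\<dots> = 2 * epow (enorm M r f * enorm M s g) p"
      using finite pos by (simp add: enorm_finite_exp epow_mult epow_epow)
    finally have "enorm M (ennreal p) (\<lambda>x. f x * g x) \<le> epow (ennreal 2 * epow (enorm M r f * enorm M s g) p) (1 / p)"
      using pos by (simp add: enorm_finite_exp epow_mono)
    also have "\<dots> = ennreal (2 powr (1 / p)) * (enorm M r f * enorm M s g)"
      using pos by (simp add: epow_mult[where a = "1 / p"] epow_ennreal del: ennreal_numeral)
    finally show ?thesis .
  qed
qed

text \<open>Supplies the finite positive mass that allows an indicator to be normalised when s =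
  \<infinity>.\<close>

lemma (in sigma_finite_measure) finite_part:
  assumes [measurable]: "A \<in> sets M" and "0 < emeasure M A"
  obtains B where "B \<in> sets M" "B \<subseteq> A" "0 < emeasure M B" "emeasure M B < top"
proof -
  obtain S :: "nat \<Rightarrow> 'a set" where S: "range S \<subseteq> sets M" "(\<Union>i. S i) = space M"
    "\<And>i. emeasure M (S i) \<noteq> \<infinity>" "incseq S"
    using sigma_finite_incseq by blast
  then have [measurable]: "S i \<in> sets M" for i by auto
  have "(\<Union>i. A \<inter> S i) = A"
    using S(2) sets.sets_into_space[OF \<open>A \<in> sets M\<close>] by auto
  moreover have "(SUP i. emeasure M (A \<inter> S i)) = emeasure M (\<Union>i. A \<inter> S i)"
    using S(4) by (intro SUP_emeasure_incseq) (auto simp: incseq_def)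
  ultimately obtain i where "0 < emeasure M (A \<inter> S i)"
    using assms(2) less_SUP_iff[of 0 "\<lambda>i. emeasure M (A \<inter> S i)" UNIV] by auto
  moreover have "emeasure M (A \<inter> S i) \<le> emeasure M (S i)" by (intro emeasure_mono) auto
  ultimately show ?thesis using S(3)[of i]
    by (intro that[of "A \<inter> S i"]) (auto simp: less_top top_unique)
qed

text \<open>Equality in Hoelder's inequality, approached from below: \<open>a\<close> is constant if
  r = \<infinity>, a normalised indicator if s = \<infinity>, and a power of a truncation of
  \<open>b\<close> otherwise. The strict inequality for \<open>c\<close> absorbs the truncation and
  admits infinite norms of \<open>b\<close>.\<close>

lemma (in sigma_finite_measure) enorm_reverse_holder:
  assumes pos: "0 < p" "0 < r" "0 < s" and exps: "inverse (ennreal p) = inverse r + inverse s"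
    and [measurable]: "b \<in> borel_measurable M" and c: "c < enorm M s b"
  obtains a :: "'a \<Rightarrow> real" where "a \<in> borel_measurable M" "\<And>x. 0 \<le> a x"
    "enorm M r (\<lambda>x. ennreal (a x)) \<le> 1" "c \<le> enorm M (ennreal p) (\<lambda>x. ennreal (a x) * b x)"
  using pos exps
proof (cases rule: ennreal_inverse_exponents)
  case top_left
  show ?thesis
    by (rule that[of "\<lambda>_. 1"]) (use top_left c in \<open>auto simp: enorm_def intro!: esssup_I\<close>)
next
  case top_right
  then have "0 < emeasure M {x \<in> space M. c < b x}"
    using c by (intro esssup_pos_measure) (auto simp: enorm_def)
  then obtain B where B [measurable]: "B \<in> sets M" and B': "B \<subseteq> {x \<in> space M. c < b x}" "0 < emeasure M B" "emeasure M B < top"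
    using finite_part[of "{x \<in> space M. c < b x}"] by auto
  \<comment> \<open>Here \<open>r\<close> is p, so \<open>m powr (- 1 / p)\<close> normalises the
    indicator of \<open>B\<close> for both exponents at once.\<close>
  define m where "m = enn2real (emeasure M B)"
  have m: "emeasure M B = ennreal m" "0 < m"
    using B' by (auto simp: m_def enn2real_positive_iff less_top)
  have ind: "enorm M (ennreal p) (\<lambda>x. ennreal (m powr (- 1 / p)) * indicator B x) = 1"
  proof -
    have "enorm M (ennreal p) (\<lambda>x. ennreal (m powr (- 1 / p)) * indicator B x)
      = epow (ennreal (m powr -1) * ennreal m) (1 / p)"
      using pos m by (simp add: enorm_finite_exp epow_mult epow_indicator nn_integral_cmult_indicator epow_ennreal[where a = p] powr_powr)
    also have "\<dots> = 1" using m pos by (simp add: ennreal_mult[symmetric] powr_minus)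
    finally show ?thesis .
  qed
  have eq: "ennreal (m powr (- 1 / p) * indicator B x) = ennreal (m powr (- 1 / p)) * indicator B x" for x
    by (auto simp: indicator_def)
  show ?thesis
  proof (rule that[of "\<lambda>x. m powr (- 1 / p) * indicator B x"])
    show "enorm M r (\<lambda>x. ennreal (m powr (- 1 / p) * indicator B x)) \<le> 1"
      using top_right ind unfolding eq by simp
    have "c = enorm M (ennreal p) (\<lambda>x. c * (ennreal (m powr (- 1 / p)) * indicator B x))"
      using enorm_cmult[of "ennreal p" "\<lambda>x. ennreal (m powr (- 1 / p)) * indicator B x" M c] ind pos by simp
    also have "\<dots> \<le> enorm M (ennreal p) (\<lambda>x. ennreal (m powr (- 1 / p) * indicator B x) * b x)"
    proof (rule enorm_mono)
      show "c * (ennreal (m powr (- 1 / p)) * indicator B x) \<le> ennreal (m powr (- 1 / p) * indicator B x) * b x" for x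
        using B'(1) unfolding eq by (auto simp: indicator_def mult.commute[of c] intro!: mult_left_mono)
    qed (use pos in auto)
    finally show "c \<le> enorm M (ennreal p) (\<lambda>x. ennreal (m powr (- 1 / p) * indicator B x) * b x)" .
  qed auto
next
  case (finite r' s')
  obtain S :: "nat \<Rightarrow> 'a set" where S: "range S \<subseteq> sets M" "(\<Union>i. S i) = space M"
    "\<And>i. emeasure M (S i) \<noteq> \<infinity>" "incseq S"
    using sigma_finite_incseq by blast
  then have [measurable]: "S i \<in> sets M" for i by auto
  \<comment> \<open>Cutting off at height n on a set of finite measure makes the norm finite, while
    the cut-offs increase to \<open>b\<close>.\<close>
  define b' where "b' = (\<lambda>n x. indicator (S n) x * min (b x) (of_nat n))"
  have [measurable]: "b' n \<in> borel_measurable M" for n by (simp add: b'_def)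
  have inc: "incseq (\<lambda>n. b' n x)" for x
  proof (rule incseq_SucI)
    fix n
    have "S n \<subseteq> S (Suc n)" using S(4) by (simp add: incseq_SucD)
    then show "b' n x \<le> b' (Suc n) x"
      unfolding b'_def by (intro mult_mono min.mono) (auto simp: indicator_def simp del: of_nat_Suc)
  qed
  have "enorm M s b \<le> enorm M s (\<lambda>x. SUP n. b' n x)"
  proof (rule enorm_mono_AE)
    show "AE x in M. b x \<le> (SUP n. b' n x)"
    proof (rule AE_I2)
      fix x assume "x \<in> space M"
      then obtain i where i: "x \<in> S i" using S(2) by auto
      have in_S: "x \<in> S n" if "n \<ge> i" for n using S(4) i that by (auto simp: incseq_def)
      show "b x \<le> (SUP n. b' n x)"
      proof (cases "b x" rule: ennreal_cases)
        case (real t)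
        obtain n where "t \<le> real n" using real_arch_simple by blast
        then have "t \<le> real (max n i)" by simp
        then have "b x \<le> b' (max n i) x"
          using real in_S[of "max n i"] by (simp add: b'_def ennreal_of_nat_eq_real_of_nat del: of_nat_max)
        then show ?thesis by (rule SUP_upper2[rotated]) simp
      next
        case top
        have "of_nat n \<le> (SUP n. b' n x)" for n
        proof -
          have "of_nat n \<le> b' (max n i) x" using top in_S[of "max n i"] by (auto simp: b'_def)
          then show ?thesis by (rule SUP_upper2[rotated]) simp
        qed
        then have "(SUP n. of_nat n :: ennreal) \<le> (SUP n. b' n x)" by (rule SUP_least)
        then have "(SUP n. b' n x) = top" by (simp add: ennreal_SUP_of_nat_eq_top top_unique)
        then show ?thesis by (simp only: top_greatest)
      qed
    qed
  qed (use pos in auto)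
  also have "\<dots> = (SUP n. enorm M s (b' n))"
    using pos inc by (intro enorm_SUP) auto
  finally obtain n where n: "c < enorm M s (b' n)"
    using c less_SUP_iff[of c "\<lambda>n. enorm M s (b' n)" UNIV] by (auto dest: less_le_trans)
  have "(\<integral>\<^sup>+x. epow (b' n x) s' \<partial>M) \<le> (\<integral>\<^sup>+x. epow (of_nat n) s' * indicator (S n) x \<partial>M)"
    using finite by (intro nn_integral_mono) (auto simp: b'_def indicator_def intro!: epow_mono)
  also have "\<dots> = epow (of_nat n) s' * emeasure M (S n)"
    by (simp add: nn_integral_cmult_indicator)
  also have "\<dots> < top"
    using S(3)[of n] finite by (simp add: less_top[symmetric] ennreal_mult_eq_top_iff)
  finally have fin: "(\<integral>\<^sup>+x. epow (b' n x) s' \<partial>M) < top" .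
  have ne: "enorm M s (b' n) \<noteq> top"
    using fin finite by (simp add: enorm_finite_exp)
  define B where "B = enn2real (enorm M s (b' n))"
  have B: "enorm M s (b' n) = ennreal B" "0 < B"
    using n ne by (auto simp: B_def enn2real_positive_iff less_top intro: le_less_trans)
  have b'_fin: "b' n x \<noteq> top" for x
    by (auto simp: b'_def indicator_def min_def top_unique)
  \<comment> \<open>The equality case of Hoelder's inequality: the power \<open>s' / r'\<close> of
    the quotient of \<open>b' n\<close> by its norm \<open>B\<close>. Its norm with exponent r' is
    1, and the identities \<open>sr\<close> give the product with \<open>b' n\<close> the p-norm
    \<open>B\<close>.\<close>
  define a where "a = (\<lambda>x. enn2real (b' n x) powr (s' / r') * B powr (- s' / r'))"
  have a_eq: "ennreal (a x) = ennreal (B powr (- s' / r')) * epow (b' n x) (s' / r')" for x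
    using finite b'_fin[of x]
    by (cases "b' n x") (auto simp: a_def epow_ennreal ennreal_mult mult.commute)
  have B_s: "(\<integral>\<^sup>+x. epow (b' n x) s' \<partial>M) = ennreal (B powr s')"
    using epow_enorm[of s' M "b' n"] finite B by (simp add: epow_ennreal)
  show ?thesis
  proof (rule that[of a])
    have "(\<integral>\<^sup>+x. epow (ennreal (a x)) r' \<partial>M) = ennreal (B powr (- s')) * ennreal (B powr s')"
      using finite by (simp add: a_eq epow_mult epow_epow epow_ennreal[where a = r'] powr_powr nn_integral_cmult B_s)
    also have "\<dots> = 1"
      using B by (simp add: ennreal_mult[symmetric] powr_add[symmetric])
    finally show "enorm M r (\<lambda>x. ennreal (a x)) \<le> 1"
      using finite by (simp add: enorm_finite_exp)
    have sr: "s' / r' * p + p = s'" "- s' / r' * p + s' = p"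
      using finite pos by (auto simp: field_simps)
    have "(\<integral>\<^sup>+x. epow (ennreal (a x) * b' n x) p \<partial>M)
      = (\<integral>\<^sup>+x. ennreal (B powr (- s' / r' * p)) * epow (b' n x) s' \<partial>M)"
    proof (rule nn_integral_cong)
      fix x
      have "epow (ennreal (a x) * b' n x) p = ennreal (B powr (- s' / r' * p)) * (epow (b' n x) (s' / r' * p) * epow (b' n x) p)"
        using finite pos by (simp add: a_eq epow_mult epow_epow epow_ennreal[where a = p] powr_powr mult.assoc)
      also have "epow (b' n x) (s' / r' * p) * epow (b' n x) p = epow (b' n x) s'"
        using finite pos epow_add[of "s' / r' * p" p "b' n x"] sr by simp
      finally show "epow (ennreal (a x) * b' n x) p = ennreal (B powr (- s' / r' * p)) * epow (b' n x) s'" .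
    qed
    also have "\<dots> = ennreal (B powr (- s' / r' * p)) * ennreal (B powr s')"
      by (simp add: nn_integral_cmult B_s)
    also have "\<dots> = ennreal (B powr p)"
      using B by (simp only: ennreal_mult[symmetric] powr_add[symmetric] sr powr_ge_zero)
    finally have "enorm M (ennreal p) (\<lambda>x. ennreal (a x) * b' n x) = ennreal B"
      using pos B by (simp add: enorm_finite_exp epow_ennreal powr_powr)
    moreover have "enorm M (ennreal p) (\<lambda>x. ennreal (a x) * b' n x) \<le> enorm M (ennreal p) (\<lambda>x. ennreal (a x) * b x)"
      using pos by (intro enorm_mono mult_left_mono) (auto simp: a_def b'_def indicator_def)
    ultimately show "c \<le> enorm M (ennreal p) (\<lambda>x. ennreal (a x) * b x)"
      using n B by (simp add: order_trans[OF less_imp_le])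
  qed (auto simp: a_def)
qed

text \<open>The growth \<open>2\<^sup>m\<close> of \<open>h\<close> along the levels of \<open>L\<close> beats the factors \<open>2\<^sup>j\<^sup>/\<^sup>2\<close>, so that the
  supremum over \<open>j\<close> sums up geometrically.\<close>

lemma enorm_hardy:
  fixes L :: "'a \<Rightarrow> int"
  assumes p: "0 < p" and nonneg: "0 \<le> b" and [measurable]: "h \<in> borel_measurable M" "G \<in> borel_measurable M" "L \<in> measurable M (count_space UNIV)"
    and h: "\<And>m. enorm M p (\<lambda>x. indicator {x. L x = m} x * h x) \<le> ennreal (b * 2 powr m)"
    and G: "AE x in M. h x \<noteq> 0 \<longrightarrow> G x \<le> c * (SUP j::nat. ennreal (2 powr (j / 2)) * u (L x + int j))"
  shows "enorm M p (\<lambda>x. h x * G x)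
    \<le> ennreal (geo_const p (1 / 4) * b) * c * enorm (count_space UNIV) p (\<lambda>k. ennreal (2 powr k) * u k)"
proof -
  let ?K = "enorm (count_space UNIV) p (\<lambda>k. ennreal (2 powr k) * u k)"
  define H where "H = (\<lambda>(j::nat) x. c * ennreal (2 powr (j / 2)) * (h x * u (L x + int j)))"
  have [measurable]: "(\<lambda>x. u (L x + int j)) \<in> borel_measurable M" for j
    by (rule measurable_compose[OF \<open>L \<in> _\<close>]) simp
  have [measurable]: "H j \<in> borel_measurable M" for j by (simp add: H_def)
  have b: "ennreal (b * 2 powr m) = ennreal b * ennreal (2 powr m)" for m :: real
    using nonneg by (simp add: ennreal_mult)
  \<comment> \<open>On level m the factor \<open>u (L x + int j)\<close> is the constant
    \<open>u (m + int j)\<close>. Writing \<open>2 powr m\<close> in terms of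
    \<open>2 powr (m + int j)\<close> gains \<open>2 powr (- real j)\<close>, and the shift by j
    preserves the sequence norm.\<close>
  have shift: "enorm M p (\<lambda>x. h x * u (L x + int j)) \<le> ennreal b * (ennreal (2 powr (- real j)) * ?K)" for j
  proof -
    have "enorm M p (\<lambda>x. h x * u (L x + int j))
      = enorm (count_space UNIV) p (\<lambda>m. enorm M p (\<lambda>x. indicator {x. L x = m} x * (h x * u (L x + int j))))"
      using p by (intro enorm_partition) auto
    also have "\<dots> = enorm (count_space UNIV) p (\<lambda>m. enorm M p (\<lambda>x. u (m + int j) * (indicator {x. L x = m} x * h x)))"
      by (intro arg_cong[where f = "enorm _ _"] ext)
          (simp add: fun_eq_iff indicator_def mult.commute)
    also have "\<dots> \<le> enorm (count_space UNIV) p (\<lambda>m. ennreal b * (ennreal (2 powr (- real j)) * (ennreal (2 powr (m + int j)) * u (m + int j))))"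
    proof (rule enorm_mono)
      fix m
      have "enorm M p (\<lambda>x. u (m + int j) * (indicator {x. L x = m} x * h x)) = u (m + int j) * enorm M p (\<lambda>x. indicator {x. L x = m} x * h x)"
        using p by (intro enorm_cmult) auto
      also have "\<dots> \<le> u (m + int j) * ennreal (b * 2 powr m)"
        by (intro mult_left_mono h) auto
      also have "\<dots> = u (m + int j) * (ennreal b * ennreal (2 powr (- real j) * 2 powr (m + int j)))"
        by (simp add: b powr_add[symmetric])
      also have "\<dots> = ennreal b * (ennreal (2 powr (- real j)) * (ennreal (2 powr (m + int j)) * u (m + int j)))"
        by (subst ennreal_mult) (auto simp: mult_ac)
      finally show "enorm M p (\<lambda>x. u (m + int j) * (indicator {x. L x = m} x * h x)) \<le> \<dots>" .
    qed (use p in auto)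
    also have "\<dots> = ennreal b * (ennreal (2 powr (- real j)) * enorm (count_space UNIV) p (\<lambda>m. ennreal (2 powr (m + int j)) * u (m + int j)))"
      using p by (simp add: enorm_cmult)
    also have "enorm (count_space UNIV) p (\<lambda>m. ennreal (2 powr (m + int j)) * u (m + int j)) = ?K"
      using p enorm_count_bij[of p "\<lambda>m. m + int j" "\<lambda>k. ennreal (2 powr k) * u k"]
      by (simp add: bij_plus_right)
    finally show ?thesis .
  qed
  have "AE x in M. h x * G x \<le> (SUP j. H j x)"
    using G
  proof eventually_elim
    case (elim x)
    show ?case
    proof (cases "h x = 0")
      case False
      with elim have "h x * G x \<le> h x * (c * (SUP j::nat. ennreal (2 powr (j / 2)) * u (L x + int j)))"
        by (intro mult_left_mono) auto
      also have "\<dots> = (SUP j. H j x)"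
        by (simp add: H_def SUP_mult_left_ennreal mult_ac)
      finally show ?thesis .
    qed simp
  qed
  then have "enorm M p (\<lambda>x. h x * G x) \<le> enorm M p (\<lambda>x. SUP j. H j x)"
    using p by (intro enorm_mono_AE) auto
  \<comment> \<open>Of the gain \<open>2 powr (- real j)\<close>, half of the exponent pays for the
    factor in the bound on \<open>G\<close> and a quarter for the geometric summation;
    \<open>2 powr (- (real j / 4))\<close> is left over.\<close>
  also have "\<dots> \<le> ennreal (geo_const p (1 / 4)) * (SUP j. ennreal (2 powr (1 / 4 * real j)) * enorm M p (H j))"
    using p by (intro enorm_SUP_geometric) auto
  also have "\<dots> \<le> ennreal (geo_const p (1 / 4)) * (ennreal b * c * ?K)"
  proof (intro mult_left_mono SUP_least)
    fix j :: nat
    have "ennreal (2 powr (1 / 4 * real j)) * enorm M p (H j)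
      = ennreal (2 powr (1 / 4 * real j)) * (c * ennreal (2 powr (j / 2)) * enorm M p (\<lambda>x. h x * u (L x + int j)))"
      using p by (simp add: H_def enorm_cmult)
    also have "\<dots> \<le> ennreal (2 powr (1 / 4 * real j)) * (c * ennreal (2 powr (j / 2)) * (ennreal b * (ennreal (2 powr (- real j)) * ?K)))"
      by (intro mult_left_mono shift) auto
    also have "\<dots> = ennreal (2 powr (1 / 4 * real j)) * ennreal (2 powr (j / 2)) * ennreal (2 powr (- real j)) * (ennreal b * c * ?K)"
      by (simp add: mult_ac)
    also have "\<dots> = ennreal (2 powr (- (real j / 4))) * (ennreal b * c * ?K)"
      by (simp add: ennreal_mult[symmetric] powr_add[symmetric])
    also have "\<dots> \<le> 1 * (ennreal b * c * ?K)"
      using powr_mono[of "- (real j / 4)" 0 2] by (intro mult_right_mono) auto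
    finally show "ennreal (2 powr (1 / 4 * real j)) * enorm M p (H j) \<le> ennreal b * c * ?K" by simp
  qed simp
  also have "\<dots> = ennreal (geo_const p (1 / 4) * b) * c * ?K"
    using geo_const_pos[of "1 / 4" p] p
    using nonneg by (simp add: ennreal_mult mult_ac)
  finally show ?thesis .
qed

subsection \<open>Level shells of the weight\<close>


lemma cofinal_sequence:
  fixes S :: "real set"
  assumes "S \<noteq> {}"
  obtains t :: "nat \<Rightarrow> real" where "incseq t" "\<And>n. t n \<in> S" "\<And>x. x \<in> S \<Longrightarrow> \<exists>n. x \<le> t n"
proof (cases "\<exists>m\<in>S. \<forall>x\<in>S. x \<le> m")
  case True
  then obtain m where "m \<in> S" "\<And>x. x \<in> S \<Longrightarrow> x \<le> m" by auto
  then show ?thesis by (intro that[of "\<lambda>_. m"]) auto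
next
  case False
  \<comment> \<open>\<open>d n\<close> lies at or above the n-th rational if some element of
    \<open>S\<close> does. Without a maximum, rationals separate each element from a larger one, so
    the running maxima are cofinal; a sequence is what monotone convergence requires.\<close>
  define d where "d n = (SOME y. y \<in> S \<and> (real_of_rat (from_nat n) \<le> y \<or> (\<forall>z\<in>S. z < real_of_rat (from_nat n))))" for n
  have d: "d n \<in> S \<and> (real_of_rat (from_nat n) \<le> d n \<or> (\<forall>z\<in>S. z < real_of_rat (from_nat n)))" for n
    unfolding d_def by (rule someI_ex) (use assms in \<open>meson ex_in_conv not_le\<close>)
  define t where "t n = Max (d ` {..n})" for n
  have 1: "t n \<in> S" for n
  proof -
    have "t n \<in> d ` {..n}" unfolding t_def by (intro Max_in) auto
    then show ?thesis using d by (auto simp del: atMost_iff)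
  qed
  have 2: "incseq t" unfolding t_def by (intro incseq_SucI Max_mono) auto
  show ?thesis
  proof (rule that[OF 2 1])
    fix x assume "x \<in> S"
    with False obtain y where y: "y \<in> S" "x < y" by (meson not_le)
    then obtain q where q: "x < real_of_rat q" "real_of_rat q < y" using of_rat_dense by blast
    have "\<not> (\<forall>z\<in>S. z < real_of_rat q)" using y q by force
    then have "x \<le> d (to_nat q)" using d[of "to_nat q"] q by auto
    also have "\<dots> \<le> t (to_nat q)" unfolding t_def by (intro Max_ge) auto
    finally show "\<exists>n. x \<le> t n" by blast
  qed
qed

lemma coinitial_sequence:
  fixes S :: "real set"
  assumes "S \<noteq> {}"
  obtains t :: "nat \<Rightarrow> real" where "decseq t" "\<And>n. t n \<in> S" "\<And>x. x \<in> S \<Longrightarrow> \<exists>n. t n \<le> x"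
proof -
  from assms have "uminus ` S \<noteq> {}" by simp
  then obtain t where t: "incseq t" "\<And>n. t n \<in> uminus ` S" "\<And>x. x \<in> uminus ` S \<Longrightarrow> \<exists>n. x \<le> t n"
    by (rule cofinal_sequence) blast
  show ?thesis
  proof (rule that[of "\<lambda>n. - t n"])
    show "decseq (\<lambda>n. - t n)" using t(1) by (simp add: incseq_def decseq_def)
    show "- t n \<in> S" for n using t(2)[of n] by auto
    show "\<exists>n. - t n \<le> x" if "x \<in> S" for x using t(3)[of "- x"] that by (auto simp: minus_le_iff)
  qed
qed

lemma indicator_mult_mono: "A \<subseteq> B \<Longrightarrow> indicator A x * y \<le> indicator B x * (y::ennreal)"
  by (auto simp: indicator_def)

lemma incseq_indicator_mult: "incseq A \<Longrightarrow> incseq (\<lambda>n. indicator (A n) x * (y::ennreal))"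
  by (auto simp: incseq_def intro: indicator_mult_mono)

text \<open>Open intervals and balls with radii in \<open>S\<close> miss at most a maximum of
  \<open>S\<close>: a single point here, a single sphere in the version for norms.\<close>

lemma AE_not_max: "AE r::real in lebesgue. \<not> (r \<in> S \<and> (\<forall>s\<in>S. s \<le> r))"
proof (cases "\<exists>m\<in>S. \<forall>s\<in>S. s \<le> m")
  case True
  then obtain m where m: "m \<in> S" "\<forall>s\<in>S. s \<le> m" by auto
  have "AE r in lebesgue. r \<noteq> m"
    by (intro AE_completion AE_lborel_singleton)
  then show ?thesis by eventually_elim (use m in force)
qed auto

lemma AE_norm_not_max: "AE x::'a::euclidean_space in lebesgue. \<not> (norm x \<in> S \<and> (\<forall>s\<in>S. s \<le> norm x))"
proof (cases "\<exists>m\<in>S. \<forall>s\<in>S. s \<le> m")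
  case True
  then obtain m where m: "m \<in> S" "\<forall>s\<in>S. s \<le> m" by auto
  have "sphere (0::'a) m \<in> null_sets lebesgue"
    using negligible_sphere[of "0::'a" m] by (simp add: negligible_iff_null_sets)
  then have "AE x in lebesgue. x \<notin> sphere (0::'a) m" by (rule AE_not_in)
  then show ?thesis by eventually_elim (use m in force)
qed auto

lemma AE_nonzero: "AE x::'a::euclidean_space in lebesgue. x \<noteq> 0"
  by (intro AE_completion AE_lborel_singleton)

lemma greaterThanLessThan_lebesgue [measurable]: "{a<..<b::real} \<in> sets lebesgue"
  by simp

lemma ball_lebesgue [measurable]: "ball (c::'a::euclidean_space) r \<in> sets lebesgue"
  by simp

section \<open>The dyadic level function of a weight and its shells\<close>

locale levels =
  fixes \<theta> :: ennreal and \<omega> :: "real \<Rightarrow> real"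
  assumes theta: "0 < \<theta>" and omega: "\<omega> \<in> cOmega \<theta>"
begin

abbreviation om :: "real \<Rightarrow> ennreal" where "om r \<equiv> ennreal \<bar>\<omega> r\<bar>"
abbreviation W :: "real \<Rightarrow> ennreal" where "W \<equiv> omnorm \<theta> \<omega>"

text \<open>Only positive arguments are meaningful: for \<open>t \<le> 0\<close> the norm
  \<open>W t\<close> is 0 and \<open>L t\<close> a mere default. This is why the origin is discarded
  as a null set and indicators of positive radii are carried along.\<close>

definition L :: "real \<Rightarrow> int" where "L t = \<lfloor>log 2 (enn2real (W t))\<rfloor>"

lemma omega_measurable [measurable]: "\<omega> \<in> borel_measurable lebesgue"
  using omega by (simp add: cOmega_def)

lemma W_eq: "W t = enorm lebesgue \<theta> (\<lambda>r. indicator {0<..<t} r * om r)"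
  using theta by (simp add: omnorm_def wnorm_unweighted)

lemma W_pos: "0 < t \<Longrightarrow> 0 < W t" and W_finite': "0 < t \<Longrightarrow> W t < top"
  using omega by (auto simp: cOmega_def omnorm_def)

lemma W_nonpos: "t \<le> 0 \<Longrightarrow> W t = 0"
  unfolding W_eq by (intro enorm_eq_0_AE theta) auto

lemma W_finite: "W t < top"
  using W_finite' W_nonpos by (cases "0 < t") auto

lemma W_mono: "s \<le> t \<Longrightarrow> W s \<le> W t"
  unfolding W_eq by (intro enorm_mono theta indicator_mult_mono) auto

text \<open>Left continuity of \<open>W\<close>: monotone convergence along intervals ending at
  \<open>t - inverse (Suc n)\<close>.\<close>

lemma W_left_approx:
  assumes "0 < t" "c < W t"
  obtains s where "0 < s" "s < t" "c < W s"
proof -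
  have "W t \<le> enorm lebesgue \<theta> (\<lambda>r. SUP n::nat. indicator {0<..<t - inverse (Suc n)} r * om r)"
    unfolding W_eq
  proof (intro enorm_mono theta)
    fix r
    show "indicator {0<..<t} r * om r \<le> (SUP n::nat. indicator {0<..<t - inverse (Suc n)} r * om r)"
    proof (cases "r \<in> {0<..<t}")
      case True
      then obtain n where "inverse (Suc n) < t - r" using reals_Archimedean[of "t - r"] by auto
      then show ?thesis using True by (intro SUP_upper2[of n]) (auto simp: indicator_def)
    qed auto
  qed measurable
  also have "\<dots> = (SUP n. W (t - inverse (Suc n)))"
    unfolding W_eq
  proof (intro enorm_SUP theta incseq_indicator_mult incseq_SucI)
    fix n
    have "inverse (real (Suc (Suc n))) \<le> inverse (real (Suc n))" by (intro le_imp_inverse_le) auto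
    then have "t - inverse (Suc n) \<le> t - inverse (Suc (Suc n))" by linarith
    then show "{0<..<t - inverse (Suc n)} \<subseteq> {0<..<t - inverse (Suc (Suc n))}"
      by (meson greaterThanLessThan_subseteq_greaterThanLessThan order_refl)
  qed measurable
  finally have "c < (SUP n. W (t - inverse (Suc n)))" using assms by simp
  then obtain n where n: "c < W (t - inverse (Suc n))" by (auto simp: less_SUP_iff)
  show ?thesis
  proof (rule that)
    \<comment> \<open>\<open>t - inverse (Suc n)\<close> may fail to be positive; enlarging it to
      \<open>t / 2\<close> is harmless because \<open>W\<close> is monotone.\<close>
    show "c < W (max (t / 2) (t - inverse (Suc n)))"
      using n W_mono[of "t - inverse (Suc n)" "max (t / 2) (t - inverse (Suc n))"] by (simp add: less_le_trans)
  qed (use \<open>0 < t\<close> in auto)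
qed

lemma mono_enn2real_W: "mono (\<lambda>t. enn2real (W t))"
  using W_mono W_finite by (auto simp: mono_def intro!: enn2real_mono)

lemma L_borel [measurable]: "L \<in> measurable borel (count_space UNIV)"
proof -
  have [measurable]: "(\<lambda>t. enn2real (W t)) \<in> borel_measurable borel"
    by (rule borel_measurable_mono[OF mono_enn2real_W])
  show ?thesis unfolding L_def by measurable
qed

lemma L_lebesgue [measurable]: "L \<in> measurable lebesgue (count_space UNIV)"
  using L_borel by (intro measurable_completion) simp

lemma L_norm_lebesgue [measurable]: "(\<lambda>x::'a::euclidean_space. L (norm x)) \<in> measurable lebesgue (count_space UNIV)"
  by (intro measurable_completion) measurable

lemma le_L_iff:
  assumes "0 < t"
  shows "k \<le> L t \<longleftrightarrow> ennreal (2 powr k) \<le> W t"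
proof -
  obtain w where w: "W t = ennreal w" "0 \<le> w" using W_finite[of t] by (cases "W t") auto
  then have "0 < w" using W_pos[OF assms] by simp
  with w show ?thesis by (simp add: L_def le_floor_iff le_log_iff)
qed

lemma L_less_iff: "0 < t \<Longrightarrow> L t < k \<longleftrightarrow> W t < ennreal (2 powr k)"
  using le_L_iff[of t k] by (simp add: not_le[symmetric])

lemma W_lower: "0 < t \<Longrightarrow> ennreal (2 powr L t) \<le> W t"
  using le_L_iff by blast

lemma W_upper: "0 < t \<Longrightarrow> W t \<le> ennreal (2 powr (L t + 1))"
  using L_less_iff[of t "L t + 1"] by (simp add: less_imp_le)

lemma L_mono: "0 < s \<Longrightarrow> s \<le> t \<Longrightarrow> L s \<le> L t"
  using le_L_iff[of t "L s"] W_lower[of s] W_mono[of s t] by auto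

text \<open>The radii below level m form an interval starting at 0. Up to a possible maximum it is
  exhausted by intervals from 0 to \<open>t n\<close>, each of which has
  \<open>W (t n) < 2 powr m\<close>.\<close>

lemma omega_below_level:
  "enorm lebesgue \<theta> (\<lambda>r. indicator {r. 0 < r \<and> L r < m} r * om r) \<le> ennreal (2 powr m)"
proof -
  define S where "S = {r. 0 < r \<and> L r < m}"
  have "S = {0<..} \<inter> (L -` {..<m} \<inter> space lebesgue)" by (auto simp: S_def)
  also have "\<dots> \<in> sets lebesgue" by (intro sets.Int measurable_sets[OF L_lebesgue]) auto
  finally have [measurable]: "S \<in> sets lebesgue" .
  have "enorm lebesgue \<theta> (\<lambda>r. indicator S r * om r) \<le> ennreal (2 powr m)"
  proof (cases "S = {}")
    case False
    then obtain t where t: "incseq t" "\<And>n. t n \<in> S" "\<And>x. x \<in> S \<Longrightarrow> \<exists>n. x \<le> t n"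
      using cofinal_sequence by blast
    have "enorm lebesgue \<theta> (\<lambda>r. indicator S r * om r)
      \<le> enorm lebesgue \<theta> (\<lambda>r. SUP n. indicator {0<..<t n} r * om r)"
    proof (intro enorm_mono_AE theta)
      show "AE r in lebesgue. indicator S r * om r \<le> (SUP n. indicator {0<..<t n} r * om r)"
        using AE_not_max[of S]
      proof eventually_elim
        case (elim r)
        show ?case
        proof (cases "r \<in> S")
          case True
          with elim obtain s where s: "s \<in> S" "r < s" by (auto simp: not_le)
          from t(3)[OF s(1)] obtain n where "s \<le> t n" by blast
          with s have "r < t n" by simp
          then show ?thesis using True by (intro SUP_upper2[of n]) (auto simp: indicator_def S_def)
        qed auto
      qed
    qed measurable
    also have "\<dots> = (SUP n. W (t n))"
      unfolding W_eq
    proof (intro enorm_SUP theta incseq_indicator_mult)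
      show "incseq (\<lambda>n. {0<..<t n})"
        using t(1) by (simp add: incseq_def greaterThanLessThan_subseteq_greaterThanLessThan)
    qed measurable
    also have "\<dots> \<le> ennreal (2 powr m)"
    proof (rule SUP_least)
      fix n
      show "W (t n) \<le> ennreal (2 powr m)"
        using t(2)[of n] L_less_iff[of "t n" m] by (simp add: S_def less_imp_le)
    qed
    finally show ?thesis .
  next
    case True
    then show ?thesis using enorm_eq_0_AE[of \<theta> "\<lambda>_::real. 0" lebesgue] theta by simp
  qed
  then show ?thesis unfolding S_def .
qed

definition shell :: "int \<Rightarrow> 'a::euclidean_space set" where "shell k = {x. L (norm x) = k}"

lemma shell_lebesgue [measurable]: "shell k \<in> sets lebesgue"
proof -
  have "{x \<in> space lebesgue. L (norm x) = k} \<in> sets lebesgue" by measurable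
  then show ?thesis by (simp add: shell_def)
qed

text \<open>Apart from the origin the ball lies in the shells of level at most \<open>L t\<close>.
  The rate 1/2 is chosen below 1, so that the factor \<open>2 powr (j / 2)\<close> can be paid for
  by the weight, which changes by \<open>2 powr j\<close> over j levels.\<close>

lemma enorm_ball_le:
  fixes q :: "'a::euclidean_space \<Rightarrow> ennreal"
  assumes p: "0 < p" and [measurable]: "q \<in> borel_measurable lebesgue" and t: "0 < t"
  shows "enorm lebesgue p (\<lambda>x. indicator (ball 0 t) x * q x)
    \<le> ennreal (geo_const p (1 / 2)) * (SUP j::nat. ennreal (2 powr (j / 2)) * enorm lebesgue p (\<lambda>x. indicator (shell (L t - int j)) x * q x))"
proof -
  have "enorm lebesgue p (\<lambda>x. indicator (ball 0 t) x * q x)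
    \<le> enorm lebesgue p (\<lambda>x. SUP j::nat. indicator (shell (L t - int j)) x * q x)"
  proof (intro enorm_mono_AE p)
    show "AE x in lebesgue. indicator (ball 0 t) x * q x \<le> (SUP j::nat. indicator (shell (L t - int j)) x * q x)"
      using AE_nonzero
    proof eventually_elim
      case (elim x)
      show ?case
      proof (cases "x \<in> ball 0 t")
        case True
        then have "L (norm x) \<le> L t" using elim by (intro L_mono) auto
        then show ?thesis using True
          by (intro SUP_upper2[of "nat (L t - L (norm x))"]) (auto simp: shell_def)
      qed auto
    qed
  qed measurable
  also have "\<dots> \<le> ennreal (geo_const p (1 / 2)) * (SUP j::nat. ennreal (2 powr (1 / 2 * j)) * enorm lebesgue p (\<lambda>x. indicator (shell (L t - int j)) x * q x))"
    using p by (intro enorm_SUP_geometric) auto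
  finally show ?thesis by simp
qed

lemma enorm_outside_ball_le:
  fixes q :: "'a::euclidean_space \<Rightarrow> ennreal"
  assumes p: "0 < p" and [measurable]: "q \<in> borel_measurable lebesgue" and t: "0 < t"
  shows "enorm lebesgue p (\<lambda>x. indicator (- ball 0 t) x * q x)
    \<le> ennreal (geo_const p (1 / 2)) * (SUP j::nat. ennreal (2 powr (j / 2)) * enorm lebesgue p (\<lambda>x. indicator (shell (L t + int j)) x * q x))"
proof -
  have "enorm lebesgue p (\<lambda>x. indicator (- ball 0 t) x * q x)
    \<le> enorm lebesgue p (\<lambda>x. SUP j::nat. indicator (shell (L t + int j)) x * q x)"
  proof (intro enorm_mono p)
    fix x :: 'a
    show "indicator (- ball 0 t) x * q x \<le> (SUP j::nat. indicator (shell (L t + int j)) x * q x)"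
    proof (cases "x \<in> - ball 0 t")
      case True
      then have "L t \<le> L (norm x)" using t by (intro L_mono) auto
      then show ?thesis using True
        by (intro SUP_upper2[of "nat (L (norm x) - L t)"]) (auto simp: shell_def)
    qed auto
  qed measurable
  also have "\<dots> \<le> ennreal (geo_const p (1 / 2)) * (SUP j::nat. ennreal (2 powr (1 / 2 * j)) * enorm lebesgue p (\<lambda>x. indicator (shell (L t + int j)) x * q x))"
    using p by (intro enorm_SUP_geometric) auto
  finally show ?thesis by simp
qed

text \<open>\<open>T\<close> consists of the radii of level k with a larger one in the same level;
  what it omits is a null sphere. The second radius \<open>t\<close> serves to bound the right limit
  of \<open>W\<close> at \<open>s\<close> by \<open>W t\<close>, hence by
  \<open>2 powr (k + 1)\<close>.\<close>

lemma enorm_shell_approx_ball: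
  fixes q :: "'a::euclidean_space \<Rightarrow> ennreal"
  assumes p: "0 < p" and [measurable]: "q \<in> borel_measurable lebesgue"
    and c: "c < enorm lebesgue p (\<lambda>x. indicator (shell k) x * q x)"
  obtains s t where "0 < s" "s < t" "L s = k" "L t = k" "c < enorm lebesgue p (\<lambda>x. indicator (ball 0 s) x * q x)"
proof -
  define I where "I = {s. 0 < s \<and> L s = k}"
  define T where "T = {s \<in> I. \<exists>t\<in>I. s < t}"
  have near: "AE x in lebesgue. x \<in> shell k \<longrightarrow> (\<exists>s\<in>T. norm (x::'a) < s)"
    using AE_nonzero AE_norm_not_max[of I]
  proof eventually_elim
    case (elim x)
    show ?case
    proof
      assume "x \<in> shell k"
      then have x: "norm x \<in> I" "0 < norm x" using elim(1) by (auto simp: I_def shell_def)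
      with elim(2) obtain t where t: "t \<in> I" "norm x < t" by (auto simp: not_le)
      define s where "s = (norm x + t) / 2"
      have s: "norm x < s" "s < t" using t by (auto simp: s_def)
      then have "0 < s" using x by linarith
      have "L (norm x) \<le> L s" "L s \<le> L t" using L_mono[of "norm x" s] L_mono[of s t] s x(2) \<open>0 < s\<close> by auto
      then have "s \<in> I" using x t \<open>0 < s\<close> by (auto simp: I_def)
      then show "\<exists>s\<in>T. norm x < s" using s t by (auto simp: T_def)
    qed
  qed
  \<comment> \<open>If the level has at most one radius, the shell is null and cannot carry a norm
    above \<open>c\<close>.\<close>
  have "T \<noteq> {}"
  proof
    assume "T = {}"
    with near have "AE x in lebesgue. indicator (shell k :: 'a set) x * q x = 0" by (auto simp: indicator_def)
    then have "enorm lebesgue p (\<lambda>x. indicator (shell k) x * q x) = 0" using p by (intro enorm_eq_0_AE) auto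
    with c show False by simp
  qed
  then obtain t where t: "incseq t" "\<And>n. t n \<in> T" "\<And>x. x \<in> T \<Longrightarrow> \<exists>n. x \<le> t n"
    using cofinal_sequence by blast
  have "enorm lebesgue p (\<lambda>x. indicator (shell k) x * q x)
    \<le> enorm lebesgue p (\<lambda>x. SUP n. indicator (ball 0 (t n)) x * q x)"
  proof (intro enorm_mono_AE p)
    show "AE x in lebesgue. indicator (shell k) x * q x \<le> (SUP n. indicator (ball 0 (t n)) x * q x)"
      using near
    proof eventually_elim
      case (elim x)
      show ?case
      proof (cases "x \<in> shell k")
        case True
        with elim obtain s where "s \<in> T" "norm x < s" by auto
        moreover from t(3)[OF this(1)] obtain n where "s \<le> t n" by blast
        ultimately have "norm x < t n" by simp
        then show ?thesis using True by (intro SUP_upper2[of n]) (auto simp: indicator_def)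
      qed auto
    qed
  qed measurable
  also have "\<dots> = (SUP n. enorm lebesgue p (\<lambda>x. indicator (ball 0 (t n)) x * q x))"
  proof (intro enorm_SUP p incseq_indicator_mult)
    show "incseq (\<lambda>n. ball (0::'a) (t n))"
      using t(1) unfolding incseq_def by (intro allI impI subset_ball) simp
  qed measurable
  finally have "c < (SUP n. enorm lebesgue p (\<lambda>x. indicator (ball 0 (t n)) x * q x))"
    using c by (rule less_le_trans[rotated])
  then obtain n where "c < enorm lebesgue p (\<lambda>x. indicator (ball 0 (t n)) x * q x)"
    unfolding less_SUP_iff by blast
  with t(2)[of n] that show ?thesis by (auto simp: T_def I_def)
qed

text \<open>Complements of open balls contain the bounding sphere, so radii coinitial in the level
  exhaust the shell even if the level has a least radius.\<close>

lemma enorm_shell_approx_outside_ball: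
  fixes q :: "'a::euclidean_space \<Rightarrow> ennreal"
  assumes p: "0 < p" and [measurable]: "q \<in> borel_measurable lebesgue"
    and c: "c < enorm lebesgue p (\<lambda>x. indicator (shell k) x * q x)"
  obtains t where "0 < t" "L t = k" "c < enorm lebesgue p (\<lambda>x. indicator (- ball 0 t) x * (indicator (shell k) x * q x))"
proof -
  define I where "I = {s. 0 < s \<and> L s = k}"
  have near: "AE x in lebesgue. x \<in> shell k \<longrightarrow> norm (x::'a) \<in> I"
    using AE_nonzero by eventually_elim (auto simp: I_def shell_def)
  have "I \<noteq> {}"
  proof
    assume "I = {}"
    with near have "AE x in lebesgue. indicator (shell k :: 'a set) x * q x = 0" by (auto simp: indicator_def)
    then have "enorm lebesgue p (\<lambda>x. indicator (shell k) x * q x) = 0" using p by (intro enorm_eq_0_AE) auto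
    with c show False by simp
  qed
  then obtain t where t: "decseq t" "\<And>n. t n \<in> I" "\<And>x. x \<in> I \<Longrightarrow> \<exists>n. t n \<le> x"
    using coinitial_sequence by blast
  have "enorm lebesgue p (\<lambda>x. indicator (shell k) x * q x)
    \<le> enorm lebesgue p (\<lambda>x. SUP n. indicator (- ball 0 (t n)) x * (indicator (shell k) x * q x))"
  proof (intro enorm_mono_AE p)
    show "AE x in lebesgue. indicator (shell k) x * q x \<le> (SUP n. indicator (- ball 0 (t n)) x * (indicator (shell k) x * q x))"
      using near
    proof eventually_elim
      case (elim x)
      show ?case
      proof (cases "x \<in> shell k")
        case True
        with elim t(3) obtain n where "t n \<le> norm x" by auto
        then show ?thesis using True by (intro SUP_upper2[of n]) (auto simp: indicator_def)
      qed auto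
    qed
  qed measurable
  also have "\<dots> = (SUP n. enorm lebesgue p (\<lambda>x. indicator (- ball 0 (t n)) x * (indicator (shell k) x * q x)))"
  proof (intro enorm_SUP p incseq_indicator_mult)
    show "incseq (\<lambda>n. - ball (0::'a) (t n))"
      using t(1) unfolding incseq_def decseq_def Compl_subset_Compl_iff by (intro allI impI subset_ball) simp
  qed measurable
  finally have "c < (SUP n. enorm lebesgue p (\<lambda>x. indicator (- ball 0 (t n)) x * (indicator (shell k) x * q x)))"
    using c by (rule less_le_trans[rotated])
  then obtain n where "c < enorm lebesgue p (\<lambda>x. indicator (- ball 0 (t n)) x * (indicator (shell k) x * q x))"
    unfolding less_SUP_iff by blast
  with t(2)[of n] that show ?thesis by (auto simp: I_def)
qed

end


section \<open>Morrey norms and ball norms against shell norms\<close>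

lemma antimono_borel_ennreal:
  fixes g :: "real \<Rightarrow> ennreal"
  assumes "\<And>s t. s \<le> t \<Longrightarrow> g t \<le> g s"
  shows "g \<in> borel_measurable borel"
proof (rule borel_measurableI_less)
  fix y
  have "is_interval {x. g x < y}"
    unfolding is_interval_1 using assms by (blast intro: le_less_trans)
  then show "{x \<in> space borel. g x < y} \<in> sets borel"
    by (simp add: real_interval_borel_measurable)
qed

lemma mono_borel_ennreal:
  fixes g :: "real \<Rightarrow> ennreal"
  assumes "\<And>s t. s \<le> t \<Longrightarrow> g s \<le> g t"
  shows "g \<in> borel_measurable borel"
proof (rule borel_measurableI_less)
  fix y
  have "is_interval {x. g x < y}"
    unfolding is_interval_1 using assms by (blast intro: le_less_trans)
  then show "{x \<in> space borel. g x < y} \<in> sets borel"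
    by (simp add: real_interval_borel_measurable)
qed

lemma ennreal_le_by_less:
  fixes a n :: ennreal
  assumes "0 < \<kappa>" "\<And>c. c < a \<Longrightarrow> ennreal \<kappa> * c \<le> n"
  shows "ennreal \<kappa> * a \<le> n"
proof -
  have "a \<le> inverse (ennreal \<kappa>) * n"
  proof (rule dense_le)
    fix c assume "c < a"
    then have "inverse (ennreal \<kappa>) * (ennreal \<kappa> * c) \<le> inverse (ennreal \<kappa>) * n"
      by (intro mult_left_mono assms) auto
    then show "c \<le> inverse (ennreal \<kappa>) * n"
      using \<open>0 < \<kappa>\<close> by (simp add: ennreal_mult_inverse_cancel)
  qed
  then have "ennreal \<kappa> * a \<le> ennreal \<kappa> * (inverse (ennreal \<kappa>) * n)"
    by (intro mult_left_mono) auto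
  then show ?thesis
    using \<open>0 < \<kappa>\<close> by (simp add: ennreal_mult_inverse_cancel)
qed

lemma ennreal_inverse_antimono: "x \<le> y \<Longrightarrow> inverse y \<le> inverse (x::ennreal)"
proof (cases "x = 0 \<or> y = top")
  case False
  assume "x \<le> y"
  with False show ?thesis
    by (cases x; cases y) (auto simp: inverse_ennreal le_imp_inverse_le less_le top_unique)
qed auto

lemma greaterThan_lebesgue [measurable]: "{a::real<..} \<in> sets lebesgue"
  by simp

definition gap_const :: "ennreal \<Rightarrow> real" where
  "gap_const p = (if p = top then 1 else (1 - 2 powr (- enn2real p)) powr (1 / enn2real p))"

lemma gap_const_pos: "0 < p \<Longrightarrow> 0 < gap_const p"
proof (cases "p = top")
  case False
  assume "0 < p"
  then have "0 < enn2real p" using False by (simp add: enn2real_positive_iff less_top)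
  then have "2 powr (- enn2real p) < 1"
    using powr_less_mono[of "- enn2real p" 0 2] by simp
  then show ?thesis using False \<open>0 < enn2real p\<close> by (simp add: gap_const_def)
qed (simp add: gap_const_def)

text \<open>At a finite exponent r the r-th powers of the norms are subadditive in the set, so
  \<open>B\<close> keeps at least \<open>l powr r - (l / 2) powr r\<close>, and
  \<open>gap_const\<close> is the r-th root of the remaining fraction. At \<infinity> a part with
  norm at most \<open>l / 2\<close> cannot produce \<open>l\<close>, so \<open>B\<close> keeps all
  of it.\<close>

lemma enorm_gap:
  assumes p: "0 < p" and [measurable]: "h \<in> borel_measurable M" "A \<in> sets M" "B \<in> sets M" "D \<in> sets M"
    and D: "D \<subseteq> A \<union> B" and l: "0 < l"
    and A: "enorm M p (\<lambda>x. indicator A x * h x) \<le> ennreal (l / 2)"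
    and AB: "ennreal l \<le> enorm M p (\<lambda>x. indicator D x * h x)"
  shows "ennreal (gap_const p * l) \<le> enorm M p (\<lambda>x. indicator B x * h x)"
  using p
proof (cases p rule: exponent_cases)
  case top
  let ?b = "esssup M (\<lambda>x. indicator B x * h x)"
  have "AE x in M. indicator D x * h x \<le> max (ennreal (l / 2)) ?b"
    using esssup_AE[of "\<lambda>x. indicator A x * h x" M] esssup_AE[of "\<lambda>x. indicator B x * h x" M]
  proof eventually_elim
    case (elim x)
    then show ?case using D A top
      by (cases "x \<in> D"; cases "x \<in> A"; cases "x \<in> B")
        (auto simp: enorm_def le_max_iff_disj intro: order_trans)
  qed
  then have "esssup M (\<lambda>x. indicator D x * h x) \<le> max (ennreal (l / 2)) ?b"
    by (intro esssup_I) auto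
  with AB top have "ennreal l \<le> max (ennreal (l / 2)) ?b" by (simp add: enorm_def)
  moreover have "\<not> ennreal l \<le> ennreal (l / 2)" using l by simp
  ultimately have "ennreal l \<le> ?b" by (auto simp: le_max_iff_disj)
  then show ?thesis using top by (simp add: enorm_def gap_const_def)
next
  case (real r)
  let ?X = "\<integral>\<^sup>+x. epow (indicator B x * h x) r \<partial>M"
  have "ennreal (l powr r) = epow (ennreal l) r" using l real by (simp add: epow_ennreal)
  also have "\<dots> \<le> (\<integral>\<^sup>+x. epow (indicator D x * h x) r \<partial>M)"
    using AB real epow_mono[of r "ennreal l" "enorm M p (\<lambda>x. indicator D x * h x)"] by (simp add: epow_enorm)
  also have "\<dots> \<le> (\<integral>\<^sup>+x. epow (indicator A x * h x) r + epow (indicator B x * h x) r \<partial>M)"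
    using D real by (intro nn_integral_mono) (auto simp: indicator_def)
  also have "\<dots> = (\<integral>\<^sup>+x. epow (indicator A x * h x) r \<partial>M) + ?X"
    by (intro nn_integral_add) auto
  also have "(\<integral>\<^sup>+x. epow (indicator A x * h x) r \<partial>M) \<le> ennreal ((l / 2) powr r)"
    using A l real epow_mono[of r "enorm M p (\<lambda>x. indicator A x * h x)" "ennreal (l / 2)"]
    by (simp add: epow_enorm epow_ennreal)
  finally have le: "ennreal (l powr r) \<le> ennreal ((l / 2) powr r) + ?X" by (simp add: add_right_mono)
  have half: "(l / 2) powr r = l powr r * 2 powr (- r)"
    using l by (simp add: powr_divide powr_minus_divide)
  have lt: "2 powr (- r) < 1"
    using powr_less_mono[of "- r" 0 2] real by simp
  have "ennreal (l powr r * (1 - 2 powr (- r))) = ennreal (l powr r) - ennreal ((l / 2) powr r)"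
    by (simp add: half ennreal_minus right_diff_distrib)
  also have "\<dots> \<le> ?X"
    using le by (simp add: ennreal_minus_le_iff)
  finally have "epow (ennreal (l powr r * (1 - 2 powr (- r)))) (1 / r) \<le> epow ?X (1 / r)"
    using real by (intro epow_mono) auto
  moreover have "epow (ennreal (l powr r * (1 - 2 powr (- r)))) (1 / r) = ennreal (gap_const p * l)"
    using l lt real by (simp add: epow_ennreal powr_mult powr_powr gap_const_def mult.commute)
  ultimately show ?thesis using real by (simp add: enorm_finite_exp)
qed

context levels
begin

definition outer_norm :: "real \<Rightarrow> ('a::euclidean_space \<Rightarrow> ennreal) \<Rightarrow> real \<Rightarrow> ennreal" where
  "outer_norm p q r = enorm lebesgue (ennreal p) (\<lambda>x. indicator (- ball 0 r) x * q x)"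

text \<open>In terms of \<open>q = |f| v\<^sup>1\<^sup>/\<^sup>p\<close> this is the norm of \<open>f\<close> in the complementary Morrey space.\<close>

definition morrey :: "real \<Rightarrow> ('a::euclidean_space \<Rightarrow> ennreal) \<Rightarrow> ennreal" where
  "morrey p q = enorm lebesgue \<theta> (\<lambda>r. indicator {0<..} r * om r * outer_norm p q r)"

definition shell_norm :: "ennreal \<Rightarrow> ('a::euclidean_space \<Rightarrow> ennreal) \<Rightarrow> int \<Rightarrow> ennreal" where
  "shell_norm p q k = enorm lebesgue p (\<lambda>x. indicator (shell k) x * q x)"

lemma outer_norm_antimono:
  assumes "0 < p" "q \<in> borel_measurable lebesgue" "s \<le> t"
  shows "outer_norm p q t \<le> outer_norm p q s"
proof -
  have "- ball 0 t \<subseteq> - ball (0::'a) s" using \<open>s \<le> t\<close> by (simp add: subset_ball)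
  then show ?thesis unfolding outer_norm_def using assms
    by (intro enorm_mono indicator_mult_mono) auto
qed

lemma outer_norm_measurable [measurable]:
  assumes "0 < p" "q \<in> borel_measurable lebesgue"
  shows "outer_norm p q \<in> borel_measurable lebesgue"
  using antimono_borel_ennreal[of "outer_norm p q", OF outer_norm_antimono[OF assms]]
  by (intro measurable_completion) simp

lemma enorm_om_shell:
  "enorm lebesgue \<theta> (\<lambda>r. indicator {r. L r = m} r * (indicator {0<..} r * om r)) \<le> ennreal (2 * 2 powr m)"
proof -
  have "enorm lebesgue \<theta> (\<lambda>r. indicator {r. L r = m} r * (indicator {0<..} r * om r))
    \<le> enorm lebesgue \<theta> (\<lambda>r. indicator {r. 0 < r \<and> L r < m + 1} r * om r)"
  proof (intro enorm_mono theta)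
    show "(\<lambda>r. indicator {r. L r = m} r * (indicator {0<..} r * om r)) \<in> borel_measurable lebesgue"
      by measurable
  qed (auto simp: indicator_def)
  also have "\<dots> \<le> ennreal (2 powr real_of_int (m + 1))" by (rule omega_below_level)
  finally show ?thesis by (simp add: powr_add mult.commute)
qed

text \<open>Hardy's inequality with \<omega> on the positive radii as \<open>h\<close> and the outer
  norm as \<open>G\<close>. The mass of \<omega> on a level gives b = 2, and covering the complement
  of a ball by the outer shells gives the pointwise bound.\<close>

lemma morrey_le_shells:
  assumes p: "0 < p" and [measurable]: "q \<in> borel_measurable lebesgue"
  shows "morrey p q \<le> ennreal (geo_const \<theta> (1 / 4) * 2) * ennreal (geo_const (ennreal p) (1 / 2))
    * enorm (count_space UNIV) \<theta> (\<lambda>k. ennreal (2 powr k) * shell_norm (ennreal p) q k)"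
  unfolding morrey_def
proof (rule enorm_hardy[where L = L])
  have [measurable]: "outer_norm p q \<in> borel_measurable lebesgue" using p by measurable
  show "outer_norm p q \<in> borel_measurable lebesgue" by measurable
  have "outer_norm p q r \<le> ennreal (geo_const (ennreal p) (1 / 2))
      * (SUP j::nat. ennreal (2 powr (real j / 2)) * shell_norm (ennreal p) q (L r + int j))" if "0 < r" for r
    unfolding outer_norm_def shell_norm_def using p that by (intro enorm_outside_ball_le) auto
  then show "AE r in lebesgue. indicator {0<..} r * om r \<noteq> 0 \<longrightarrow> outer_norm p q r
      \<le> ennreal (geo_const (ennreal p) (1 / 2)) * (SUP j::nat. ennreal (2 powr (real j / 2)) * shell_norm (ennreal p) q (L r + int j))"
    by (intro AE_I2 impI) (simp split: split_indicator_asm)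
qed (use theta enorm_om_shell in auto)

text \<open>For a suitable t of level k and r < t, the outer norm at r dominates almost the whole
  norm of shell k, so \<omega> must have mass of order \<open>2 powr k\<close> before t. Level k
  alone may contain no radius before t, but everything below level k - 1 carries at most
  \<open>2 powr (k - 1)\<close>, so levels k - 1 and k together suffice.\<close>

lemma shells_le_morrey:
  assumes p: "0 < p" and [measurable]: "q \<in> borel_measurable lebesgue"
  shows "enorm (count_space UNIV) \<theta> (\<lambda>k. ennreal (2 powr k) * shell_norm (ennreal p) q k)
    \<le> ennreal (1 / gap_const \<theta>) * (ennreal (2 * geo_const \<theta> 1) * (ennreal (2 * geo_const \<theta> 1) * morrey p q))"
proof -
  have [measurable]: "outer_norm p q \<in> borel_measurable lebesgue" using p by measurable
  define F where "F r = indicator {0<..} r * om r * outer_norm p q r" for r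
  have [measurable]: "F \<in> borel_measurable lebesgue" unfolding F_def by measurable
  define n where "n k = enorm lebesgue \<theta> (\<lambda>r. indicator {r. L r = k} r * F r)" for k
  have step: "ennreal (2 powr k) * shell_norm (ennreal p) q k
    \<le> ennreal (1 / gap_const \<theta>) * (ennreal (2 * geo_const \<theta> 1) * max (n (k - 1)) (n k))" for k
  proof -
    have "ennreal (gap_const \<theta> * 2 powr k) * shell_norm (ennreal p) q k \<le> ennreal (2 * geo_const \<theta> 1) * max (n (k - 1)) (n k)"
    proof (rule ennreal_le_by_less)
      fix c assume "c < shell_norm (ennreal p) q k"
      then obtain t where t: "0 < t" "L t = k"
        "c < enorm lebesgue (ennreal p) (\<lambda>x. indicator (- ball 0 t) x * (indicator (shell k) x * q x))"
        unfolding shell_norm_def using p by (elim enorm_shell_approx_outside_ball[rotated 2]) auto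
      have c: "c \<le> outer_norm p q r" if "r < t" for r
      proof -
        have "c \<le> enorm lebesgue (ennreal p) (\<lambda>x. indicator (- ball 0 t) x * (indicator (shell k) x * q x))"
          using t by simp
        also have "\<dots> \<le> outer_norm p q t"
          unfolding outer_norm_def
        proof (intro enorm_mono mult_left_mono)
          show "indicator (shell k) x * q x \<le> q x" for x by (simp split: split_indicator)
        qed (use p in auto)
        also have "\<dots> \<le> outer_norm p q r"
          using that p by (intro outer_norm_antimono) auto
        finally show ?thesis .
      qed
      define A where "A = {r. 0 < r \<and> L r < k - 1}"
      define B where "B = {r. 0 < r \<and> r < t \<and> k - 1 \<le> L r}"
      have "A = {0<..} \<inter> (L -` {..<k - 1} \<inter> space lebesgue)" by (auto simp: A_def)
      also have "\<dots> \<in> sets lebesgue" by (intro sets.Int measurable_sets[OF L_lebesgue]) auto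
      finally have [measurable]: "A \<in> sets lebesgue" .
      have "B = {0<..<t} \<inter> (L -` {k - 1..} \<inter> space lebesgue)" by (auto simp: B_def)
      also have "\<dots> \<in> sets lebesgue" by (intro sets.Int measurable_sets[OF L_lebesgue]) auto
      finally have [measurable]: "B \<in> sets lebesgue" .
      have "ennreal (gap_const \<theta> * 2 powr k) \<le> enorm lebesgue \<theta> (\<lambda>r. indicator B r * om r)"
      proof (rule enorm_gap[where D = "{0<..<t}" and A = A])
        show "enorm lebesgue \<theta> (\<lambda>r. indicator A r * om r) \<le> ennreal (2 powr k / 2)"
          using omega_below_level[of "k - 1"] unfolding A_def by (simp add: powr_diff)
        show "ennreal (2 powr k) \<le> enorm lebesgue \<theta> (\<lambda>r. indicator {0<..<t} r * om r)"
          using W_lower[of t] t unfolding W_eq by simp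
      qed (use theta in \<open>auto simp: A_def B_def\<close>)
      then have "ennreal (gap_const \<theta> * 2 powr k) * c \<le> c * enorm lebesgue \<theta> (\<lambda>r. indicator B r * om r)"
        by (subst mult.commute) (intro mult_left_mono, auto)
      also have "\<dots> = enorm lebesgue \<theta> (\<lambda>r. c * (indicator B r * om r))"
        using theta by (intro enorm_cmult[symmetric]) auto
      also have "\<dots> \<le> enorm lebesgue \<theta> (\<lambda>r. max (indicator {r. L r = k - 1} r * F r) (indicator {r. L r = k} r * F r))"
      proof (intro enorm_mono theta)
        fix r
        show "c * (indicator B r * om r) \<le> max (indicator {r. L r = k - 1} r * F r) (indicator {r. L r = k} r * F r)"
        proof (cases "r \<in> B")
          case True
          then have r: "0 < r" "r < t" "k - 1 \<le> L r" by (auto simp: B_def)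
          then have "L r \<le> k" using L_mono[of r t] t by simp
          then have "L r = k - 1 \<or> L r = k" using r by linarith
          moreover have "c * om r \<le> F r"
            using c[OF r(2)] r by (simp add: F_def mult.commute[of c] mult_left_mono)
          ultimately show ?thesis using True by (auto simp: le_max_iff_disj)
        qed simp
      qed measurable
      also have "\<dots> \<le> ennreal (2 * geo_const \<theta> 1) * max (n (k - 1)) (n k)"
        unfolding n_def using theta by (intro enorm_max) measurable
      finally show "ennreal (gap_const \<theta> * 2 powr k) * c \<le> ennreal (2 * geo_const \<theta> 1) * max (n (k - 1)) (n k)" .
    qed (use gap_const_pos[OF theta] in simp)
    then have "ennreal (1 / gap_const \<theta>) * (ennreal (gap_const \<theta> * 2 powr k) * shell_norm (ennreal p) q k)
      \<le> ennreal (1 / gap_const \<theta>) * (ennreal (2 * geo_const \<theta> 1) * max (n (k - 1)) (n k))"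
      by (intro mult_left_mono) auto
    moreover have "ennreal (1 / gap_const \<theta>) * ennreal (gap_const \<theta> * 2 powr k) = ennreal (2 powr k)"
      using gap_const_pos[OF theta] by (simp add: ennreal_mult[symmetric])
    ultimately show ?thesis by (simp add: mult.assoc[symmetric])
  qed
  have "enorm (count_space UNIV) \<theta> (\<lambda>k. ennreal (2 powr k) * shell_norm (ennreal p) q k)
    \<le> enorm (count_space UNIV) \<theta> (\<lambda>k. ennreal (1 / gap_const \<theta>) * (ennreal (2 * geo_const \<theta> 1) * max (n (k - 1)) (n k)))"
    using step theta by (intro enorm_mono) auto
  also have "\<dots> = ennreal (1 / gap_const \<theta>) * (ennreal (2 * geo_const \<theta> 1) * enorm (count_space UNIV) \<theta> (\<lambda>k. max (n (k - 1)) (n k)))"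
    using theta by (simp add: enorm_cmult)
  \<comment> \<open>The second quasi-triangle factor: after the two levels have been separated as
    functions, the sequence \<open>n\<close> and its shift by one have to be separated as
    well.\<close>
  also have "\<dots> \<le> ennreal (1 / gap_const \<theta>) * (ennreal (2 * geo_const \<theta> 1) * (ennreal (2 * geo_const \<theta> 1)
      * max (enorm (count_space UNIV) \<theta> (\<lambda>k. n (k - 1))) (enorm (count_space UNIV) \<theta> n)))"
    using theta by (intro mult_left_mono enorm_max) auto
  also have "enorm (count_space UNIV) \<theta> (\<lambda>k. n (k - 1)) = enorm (count_space UNIV) \<theta> n"
    by (intro enorm_count_bij theta bij_betw_byWitness[where f' = "\<lambda>k. k + 1"]) auto
  also have "enorm (count_space UNIV) \<theta> n = morrey p q"
    unfolding n_def morrey_def F_def[symmetric] using theta by (intro enorm_partition[symmetric]) measurable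
  finally show ?thesis by simp
qed

text \<open>Since \<open>W t\<close> is positive, a finite Morrey norm makes every outer norm
  finite, which is the other membership condition of \<open>cLM\<close>.\<close>

lemma W_outer_norm_le_morrey:
  assumes p: "0 < p" and [measurable]: "q \<in> borel_measurable lebesgue" and "0 < t"
  shows "W t * outer_norm p q t \<le> morrey p q"
proof -
  have [measurable]: "outer_norm p q \<in> borel_measurable lebesgue" using p by measurable
  have "W t * outer_norm p q t = enorm lebesgue \<theta> (\<lambda>r. outer_norm p q t * (indicator {0<..<t} r * om r))"
    using theta by (simp add: W_eq enorm_cmult mult.commute)
  also have "\<dots> \<le> morrey p q"
    unfolding morrey_def
  proof (intro enorm_mono theta)
    fix r
    show "outer_norm p q t * (indicator {0<..<t} r * om r) \<le> indicator {0<..} r * om r * outer_norm p q r"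
      using outer_norm_antimono[of p q r t] p
      by (cases "r \<in> {0<..<t}") (auto simp: mult.commute[of "outer_norm p q t"] intro!: mult_left_mono)
  qed measurable
  finally show ?thesis .
qed

definition ball_norm :: "ennreal \<Rightarrow> ('a::euclidean_space \<Rightarrow> ennreal) \<Rightarrow> real \<Rightarrow> ennreal" where
  "ball_norm s q t = enorm lebesgue s (\<lambda>x. indicator (ball 0 t) x * q x)"

lemma ball_norm_mono:
  assumes "0 < s" "q \<in> borel_measurable lebesgue" "t \<le> u"
  shows "ball_norm s q t \<le> ball_norm s q u"
  unfolding ball_norm_def using assms by (intro enorm_mono indicator_mult_mono subset_ball) auto

lemma ball_norm_measurable:
  assumes "0 < s" "q \<in> borel_measurable lebesgue"
  shows "ball_norm s q \<in> borel_measurable borel"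
  by (intro mono_borel_ennreal ball_norm_mono assms)

lemma inverse_W_le: "0 < t \<Longrightarrow> inverse (W t) \<le> ennreal (2 powr (- real_of_int (L t)))"
  using ennreal_inverse_antimono[of "ennreal (2 powr L t)" "W t"] W_lower[of t]
  by (simp add: inverse_ennreal powr_minus)

lemma inverse_W_ge: "0 < t \<Longrightarrow> ennreal (2 powr (- (L t + 1))) \<le> inverse (W t)"
  using ennreal_inverse_antimono[of "W t" "ennreal (2 powr (L t + 1))"] W_upper[of t]
  by (simp add: inverse_ennreal powr_minus[symmetric])

text \<open>Hardy's inequality for suprema needs no summation beyond that over shells:
  \<open>j / 2 \<le> j\<close> turns the loss \<open>2 powr (j / 2)\<close> into the weight of level
  \<open>L t - int j\<close>.\<close>

lemma inverse_W_ball_norm_le: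
  fixes q :: "'a::euclidean_space \<Rightarrow> ennreal"
  assumes s: "0 < s" and q: "q \<in> borel_measurable lebesgue" and t: "0 < t"
  shows "inverse (W t) * ball_norm s q t
    \<le> ennreal (geo_const s (1 / 2)) * enorm (count_space UNIV) top (\<lambda>k. ennreal (2 powr (- real_of_int k)) * shell_norm s q k)"
    (is "_ \<le> _ * ?K")
proof -
  have "inverse (W t) * ball_norm s q t \<le> ennreal (2 powr (- real_of_int (L t))) * (ennreal (geo_const s (1 / 2)) *
      (SUP j::nat. ennreal (2 powr (j / 2)) * shell_norm s q (L t - int j)))"
    unfolding ball_norm_def shell_norm_def by (intro mult_mono inverse_W_le enorm_ball_le s q t) auto
  also have "\<dots> = ennreal (geo_const s (1 / 2)) *
      (SUP j::nat. ennreal (2 powr (- real_of_int (L t))) * (ennreal (2 powr (j / 2)) * shell_norm s q (L t - int j)))"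
    by (simp add: SUP_mult_left_ennreal mult.left_commute)
  also have "\<dots> \<le> ennreal (geo_const s (1 / 2)) * ?K"
  proof (intro mult_left_mono SUP_least)
    fix j :: nat
    have "ennreal (2 powr (- real_of_int (L t))) * (ennreal (2 powr (j / 2)) * shell_norm s q (L t - int j))
      = ennreal (2 powr (- real_of_int (L t) + j / 2)) * shell_norm s q (L t - int j)"
      by (simp add: mult.assoc[symmetric] ennreal_mult[symmetric] powr_add[symmetric])
    also have "\<dots> \<le> ennreal (2 powr (- real_of_int (L t - int j))) * shell_norm s q (L t - int j)"
      by (intro mult_right_mono ennreal_leI powr_mono) auto
    also have "\<dots> \<le> ?K"
      by (rule enorm_count_ge[where u = "\<lambda>k. ennreal (2 powr (- real_of_int k)) * shell_norm s q k"]) simp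
    finally show "ennreal (2 powr (- real_of_int (L t))) * (ennreal (2 powr (j / 2)) * shell_norm s q (L t - int j)) \<le> ?K" .
  qed auto
  finally show ?thesis .
qed

text \<open>A ball with radius in level k captures almost the norm of that shell; at this radius
  \<open>W\<close> is at most \<open>2 powr (k + 1)\<close>, which costs the factor 2.\<close>

lemma shell_norm_le_SUP_balls:
  fixes q :: "'a::euclidean_space \<Rightarrow> ennreal"
  assumes s: "0 < s" and q: "q \<in> borel_measurable lebesgue"
  shows "enorm (count_space UNIV) top (\<lambda>k. ennreal (2 powr (- real_of_int k)) * shell_norm s q k)
    \<le> 2 * (SUP t\<in>{0<..}. inverse (W t) * ball_norm s q t)" (is "_ \<le> 2 * ?A")
proof -
  have *: "ennreal (2 powr (- real_of_int k)) * c \<le> 2 * ?A" if "c < shell_norm s q k" for k c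
  proof -
  from that obtain t where t: "0 < t" "L t = k" "c < ball_norm s q t"
    unfolding shell_norm_def ball_norm_def by (rule enorm_shell_approx_ball[OF s q])
  have "ennreal (2 powr (- real_of_int k)) * c \<le> (2 * inverse (W t)) * ball_norm s q t"
  proof (intro mult_mono)
    have "ennreal (2 powr (- real_of_int k)) = 2 * ennreal (2 powr (- (L t + 1)))"
      using t by (simp add: powr_diff ennreal_mult[symmetric] flip: ennreal_numeral)
    also have "\<dots> \<le> 2 * inverse (W t)" by (intro mult_left_mono inverse_W_ge t) auto
    finally show "ennreal (2 powr (- real_of_int k)) \<le> 2 * inverse (W t)" .
  qed (use t in auto)
  also have "\<dots> \<le> 2 * ?A"
    unfolding mult.assoc using t by (intro mult_left_mono SUP_upper) auto
  finally show ?thesis .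
  qed
  show ?thesis
    unfolding enorm_count_top by (rule SUP_least, rule ennreal_le_by_less[OF _ *]) auto
qed

lemma omnorm_inf_eq: "omnorm_inf \<theta> \<omega> = enorm lebesgue \<theta> (\<lambda>r. indicator {0<..} r * om r)"
  using theta by (simp add: omnorm_inf_def wnorm_unweighted)

lemma W_le_inf: "W t \<le> omnorm_inf \<theta> \<omega>"
  unfolding W_eq omnorm_inf_eq by (intro enorm_mono theta indicator_mult_mono) auto

text \<open>The limit of the ball estimate for growing radii, since \<open>W\<close> never exceeds
  the full norm of \<omega>.\<close>

lemma total_norm_le:
  fixes q :: "'a::euclidean_space \<Rightarrow> ennreal"
  assumes s: "0 < s" and q [measurable]: "q \<in> borel_measurable lebesgue"
  shows "inverse (omnorm_inf \<theta> \<omega>) * enorm lebesgue s q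
    \<le> ennreal (geo_const s (1 / 2)) * enorm (count_space UNIV) top (\<lambda>k. ennreal (2 powr (- real_of_int k)) * shell_norm s q k)"
    (is "_ \<le> ?R")
proof -
  have "enorm lebesgue s q \<le> enorm lebesgue s (\<lambda>x. SUP n. indicator (ball 0 (real (Suc n))) x * q x)"
  proof (intro enorm_mono s q)
    fix x :: 'a
    obtain n where "norm x < real n" using reals_Archimedean2 by blast
    then show "q x \<le> (SUP n. indicator (ball 0 (real (Suc n))) x * q x)"
      by (intro SUP_upper2[of n]) (auto simp: indicator_def)
  qed
  also have "\<dots> = (SUP n. ball_norm s q (real (Suc n)))"
    unfolding ball_norm_def
  proof (intro enorm_SUP s incseq_indicator_mult)
    show "incseq (\<lambda>n. ball (0::'a) (real (Suc n)))"
      unfolding incseq_def by (intro allI impI subset_ball) simp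
  qed measurable
  finally have "inverse (omnorm_inf \<theta> \<omega>) * enorm lebesgue s q
    \<le> inverse (omnorm_inf \<theta> \<omega>) * (SUP n. ball_norm s q (real (Suc n)))"
    by (intro mult_left_mono) auto
  also have "\<dots> = (SUP n. inverse (omnorm_inf \<theta> \<omega>) * ball_norm s q (real (Suc n)))"
    by (simp add: SUP_mult_left_ennreal)
  also have "\<dots> \<le> ?R"
  proof (rule SUP_least)
    fix n
    have "inverse (omnorm_inf \<theta> \<omega>) * ball_norm s q (real (Suc n)) \<le> inverse (W (real (Suc n))) * ball_norm s q (real (Suc n))"
      by (intro mult_right_mono ennreal_inverse_antimono W_le_inf) auto
    also have "\<dots> \<le> ?R" by (intro inverse_W_ball_norm_le s q) simp
    finally show "inverse (omnorm_inf \<theta> \<omega>) * ball_norm s q (real (Suc n)) \<le> ?R" .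
  qed
  finally show ?thesis .
qed

end

subsection \<open>The Lebesgue--Stieltjes integral\<close>


context levels
begin

abbreviation Wp :: "real \<Rightarrow> ennreal" where "Wp \<equiv> omnorm_plus \<theta> \<omega>"

lemma omnorm_plus_eq: "Wp t = (INF u\<in>{t<..}. W u)"
proof -
  have "(W \<longlongrightarrow> (INF u\<in>{t<..}. W u)) (at_right t)"
  proof (rule order_tendstoI)
    fix a assume "a < (INF u\<in>{t<..}. W u)"
    then show "eventually (\<lambda>u. a < W u) (at_right t)"
      by (auto simp: eventually_at_right_field intro!: exI[of _ "t + 1"] intro: less_le_trans INF_lower)
  next
    fix a assume "(INF u\<in>{t<..}. W u) < a"
    then obtain u where "t < u" "W u < a" by (auto simp: INF_less_iff)
    then show "eventually (\<lambda>u. W u < a) (at_right t)"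
      by (auto simp: eventually_at_right_field intro!: exI[of _ u] intro: le_less_trans W_mono less_imp_le)
  qed
  then show ?thesis unfolding omnorm_plus_def by (intro tendsto_Lim) auto
qed

lemma W_le_Wp: "W t \<le> Wp t"
  unfolding omnorm_plus_eq by (intro INF_greatest W_mono) simp

lemma Wp_le_W: "t < u \<Longrightarrow> Wp t \<le> W u"
  unfolding omnorm_plus_eq by (intro INF_lower) simp

lemma Wp_mono: "t \<le> u \<Longrightarrow> Wp t \<le> Wp u"
  unfolding omnorm_plus_eq by (intro INF_superset_mono) auto

lemma Wp_finite: "Wp t < top"
  using Wp_le_W[of t "t + 1"] W_finite[of "t + 1"] by simp

lemma Wp_pos: "0 < t \<Longrightarrow> 0 < Wp t"
  using W_pos W_le_Wp less_le_trans by blast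

definition wr :: "real \<Rightarrow> real" where "wr t = enn2real (Wp t)"

lemma ennreal_wr: "ennreal (wr t) = Wp t"
  using Wp_finite by (simp add: wr_def)

lemma wr_pos: "0 < t \<Longrightarrow> 0 < wr t"
  using Wp_pos Wp_finite by (simp add: wr_def enn2real_positive_iff)

lemma wr_mono: "t \<le> u \<Longrightarrow> wr t \<le> wr u"
  unfolding wr_def using Wp_mono Wp_finite by (intro enn2real_mono)

text \<open>The clamp is the one in \<open>LS_integral\<close>. As a right limit, \<open>Wp\<close>
  is an infimum over larger radii; it is nearly attained at some u, and every point before u
  inherits the bound.\<close>

lemma wr_right_continuous: "continuous (at_right a) (\<lambda>t. wr (max t \<epsilon>))"
proof (subst continuous_at_right_real_increasing)
  show "wr (max x \<epsilon>) \<le> wr (max y \<epsilon>)" if "x \<le> y" for x y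
    using that by (intro wr_mono) auto
  show "\<forall>e>0. \<exists>d>0. wr (max (a + d) \<epsilon>) - wr (max a \<epsilon>) < e"
  proof (intro allI impI)
    fix e :: real assume "0 < e"
    have "Wp (max a \<epsilon>) < ennreal (wr (max a \<epsilon>) + e)"
      unfolding ennreal_wr[symmetric] using \<open>0 < e\<close> by (intro ennreal_lessI) (auto simp: wr_def add_nonneg_pos)
    then obtain u where u: "max a \<epsilon> < u" "W u < ennreal (wr (max a \<epsilon>) + e)"
      unfolding omnorm_plus_eq by (auto simp: INF_less_iff)
    define d where "d = (u - max a \<epsilon>) / 2"
    have d: "0 < d" "max (a + d) \<epsilon> < u" using u(1) by (auto simp: d_def max_def field_simps)
    have "ennreal (wr (max (a + d) \<epsilon>)) < ennreal (wr (max a \<epsilon>) + e)"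
      unfolding ennreal_wr using Wp_le_W[OF d(2)] u(2) by (rule le_less_trans)
    then have "wr (max (a + d) \<epsilon>) < wr (max a \<epsilon>) + e"
      by (subst (asm) ennreal_less_iff) (auto simp: wr_def)
    then show "\<exists>d>0. wr (max (a + d) \<epsilon>) - wr (max a \<epsilon>) < e"
      using d by (intro exI[of _ d]) auto
  qed
qed

definition LS :: "real \<Rightarrow> real \<Rightarrow> real measure" where
  "LS \<rho> \<epsilon> = interval_measure (\<lambda>t. - (wr (max t \<epsilon>) powr (- \<rho>)))"

lemma sets_LS [simp, measurable_cong]: "sets (LS \<rho> \<epsilon>) = sets borel"
  by (simp add: LS_def)

lemma emeasure_LS_Ioc:
  assumes "0 < \<rho>" "0 < \<epsilon>" "\<epsilon> \<le> a" "a \<le> b"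
  shows "emeasure (LS \<rho> \<epsilon>) {a<..b} = ennreal (wr a powr (- \<rho>) - wr b powr (- \<rho>))"
proof -
  have "emeasure (LS \<rho> \<epsilon>) {a<..b} = ennreal (- (wr (max b \<epsilon>) powr (- \<rho>)) - - (wr (max a \<epsilon>) powr (- \<rho>)))"
    unfolding LS_def
  proof (rule emeasure_interval_measure_Ioc[OF \<open>a \<le> b\<close>])
    have pos: "0 < wr (max c \<epsilon>)" for c
      using assms by (intro wr_pos) (simp add: less_max_iff_disj)
    show "- (wr (max x \<epsilon>) powr (- \<rho>)) \<le> - (wr (max y \<epsilon>) powr (- \<rho>))" if "x \<le> y" for x y
      using that assms pos[of x] by (auto intro!: powr_mono2' wr_mono)
    show "continuous (at_right c) (\<lambda>t. - (wr (max t \<epsilon>) powr (- \<rho>)))" for c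
      using pos[of c]
      by (intro continuous_intros wr_right_continuous continuous_at_within_powr) auto
  qed
  then show ?thesis using assms by (simp add: max_absorb1)
qed

lemma emeasure_LS_Ioi:
  assumes "0 < \<rho>" "0 < \<epsilon>" "\<epsilon> \<le> a"
  shows "emeasure (LS \<rho> \<epsilon>) {a<..} \<le> ennreal (wr a powr (- \<rho>))"
proof -
  have "{a<..} = (\<Union>n. {a<..a + real n})"
  proof (intro set_eqI iffI)
    fix x assume "x \<in> {a<..}"
    moreover obtain n where "x - a \<le> real n" using real_arch_simple by blast
    ultimately show "x \<in> (\<Union>n. {a<..a + real n})" by (auto intro!: exI[of _ n])
  qed auto
  then have "emeasure (LS \<rho> \<epsilon>) {a<..} = (SUP n. emeasure (LS \<rho> \<epsilon>) {a<..a + real n})"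
    by (subst SUP_emeasure_incseq) (auto simp: incseq_def)
  also have "\<dots> \<le> ennreal (wr a powr (- \<rho>))"
    using assms by (intro SUP_least) (simp add: emeasure_LS_Ioc ennreal_leI)
  finally show ?thesis .
qed

text \<open>Let \<beta> be the infimum of the radii where \<open>W\<close> reaches l. If it is one
  of them, the Stieltjes measure may have an atom there, so b must lie strictly before it, and left
  continuity keeps \<open>W b\<close> above \<open>l / 2\<close>. Otherwise \<beta> itself serves,
  because the right limit there is at least l; in this case b may be 0.\<close>

lemma threshold:
  assumes l: "0 < l" and r: "0 < r" "ennreal l \<le> W r"
  obtains b where "0 \<le> b" "\<And>r. 0 < r \<Longrightarrow> ennreal l \<le> W r \<Longrightarrow> b < r" "l / 2 \<le> wr b"
proof -
  define S where "S = {r. 0 < r \<and> ennreal l \<le> W r}"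
  define \<beta> where "\<beta> = Inf S"
  have ne: "S \<noteq> {}" using r by (auto simp: S_def)
  have bdd: "bdd_below S" unfolding S_def by (intro bdd_belowI[of _ 0]) auto
  have \<beta>: "\<beta> \<le> r" if "r \<in> S" for r unfolding \<beta>_def using that bdd by (rule cInf_lower)
  have "0 \<le> \<beta>" unfolding \<beta>_def using ne by (intro cInf_greatest) (auto simp: S_def)
  have wr: "l / 2 \<le> wr b" if "ennreal (l / 2) \<le> Wp b" for b
    using that unfolding ennreal_wr[symmetric] by (subst (asm) ennreal_le_iff) (auto simp: wr_def)
  show ?thesis
  proof (cases "\<beta> \<in> S")
    case True
    then have "0 < \<beta>" and "ennreal l \<le> W \<beta>" by (auto simp: S_def)
    have "ennreal (l / 2) < ennreal l" using l by (simp add: ennreal_less_iff)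
    then have "ennreal (l / 2) < W \<beta>" using \<open>ennreal l \<le> W \<beta>\<close> by (rule less_le_trans)
    with \<open>0 < \<beta>\<close> obtain b where b: "0 < b" "b < \<beta>" "ennreal (l / 2) < W b"
      by (rule W_left_approx)
    show ?thesis
    proof (rule that)
      show "l / 2 \<le> wr b" using b W_le_Wp[of b] by (intro wr) simp
      show "b < r" if "0 < r" "ennreal l \<le> W r" for r
        using \<beta>[of r] that b by (auto simp: S_def)
    qed (use b in simp)
  next
    case False
    show ?thesis
    proof (rule that[OF \<open>0 \<le> \<beta>\<close>])
      show "\<beta> < r" if "0 < r" "ennreal l \<le> W r" for r
        using \<beta>[of r] that False by (auto simp: S_def less_le)
      have "ennreal l \<le> Wp \<beta>"
        unfolding omnorm_plus_eq
      proof (rule INF_greatest)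
        fix u assume "u \<in> {\<beta><..}"
        then obtain r where "r \<in> S" "r < u" unfolding \<beta>_def using cInf_less_iff[OF ne bdd] by auto
        then show "ennreal l \<le> W u" using W_mono[of r u] by (auto simp: S_def)
      qed
      moreover have "ennreal (l / 2) \<le> ennreal l" using l by (intro ennreal_leI) simp
      ultimately show "l / 2 \<le> wr \<beta>" by (intro wr) simp
    qed
  qed
qed

text \<open>Each truncated integral is a power of an \<open>enorm\<close> over a Stieltjes measure,
  which makes Hardy's inequality applicable.\<close>

lemma LS_integral_eq:
  assumes "0 < s" "q \<in> borel_measurable lebesgue" "0 < \<rho>"
  shows "LS_integral (\<lambda>t. - (enn2real (Wp t) powr (- \<rho>))) (\<lambda>t. epow (ball_norm s q t) \<rho>)
    = (SUP \<epsilon>\<in>{0<..}. epow (enorm (LS \<rho> \<epsilon>) (ennreal \<rho>) (\<lambda>t. indicator {\<epsilon><..} t * ball_norm s q t)) \<rho>)"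
  using assms by (simp add: LS_integral_def LS_def wr_def epow_enorm epow_mult epow_indicator mult.commute)

text \<open>The radii in question lie beyond a threshold b with \<open>wr b\<close> at least
  \<open>2 powr (- m) / 2\<close>, so their mass is at most \<open>wr b powr (- \<rho>)\<close>. The
  level is counted with reversed sign because the integrator lives on the scale of the inverse of
  \<open>W\<close>.\<close>

lemma LS_level_mass:
  assumes "0 < \<rho>" "0 < \<epsilon>"
  shows "enorm (LS \<rho> \<epsilon>) (ennreal \<rho>) (\<lambda>t. indicator {t. - L t = m} t * indicator {\<epsilon><..} t) \<le> ennreal (2 * 2 powr m)"
proof (cases "\<exists>r>0. L r = - m")
  case True
  then obtain r where r: "0 < r" "L r = - m" by auto
  then have "ennreal (2 powr (- real_of_int m)) \<le> W r" using W_lower[of r] by simp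
  with r(1) obtain b where b: "0 \<le> b" "\<And>r. 0 < r \<Longrightarrow> ennreal (2 powr (- real_of_int m)) \<le> W r \<Longrightarrow> b < r"
    "2 powr (- real_of_int m) / 2 \<le> wr b"
    by (rule threshold[rotated]) auto
  let ?b = "max b \<epsilon>"
  have "(\<integral>\<^sup>+t. epow (indicator {t. - L t = m} t * indicator {\<epsilon><..} t) \<rho> \<partial>LS \<rho> \<epsilon>)
    \<le> (\<integral>\<^sup>+t. indicator {?b<..} t \<partial>LS \<rho> \<epsilon>)"
  proof (rule nn_integral_mono)
    fix t
    show "epow (indicator {t. - L t = m} t * indicator {\<epsilon><..} t) \<rho> \<le> indicator {?b<..} t"
    proof (cases "L t = - m \<and> \<epsilon> < t")
      case True
      then have "ennreal (2 powr (- real_of_int m)) \<le> W t" using W_lower[of t] assms by simp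
      then have "b < t" using True assms by (intro b) auto
      then show ?thesis using True assms by simp
    qed (use assms in \<open>auto simp: indicator_def\<close>)
  qed
  also have "\<dots> = emeasure (LS \<rho> \<epsilon>) {?b<..}" by simp
  also have "\<dots> \<le> ennreal (wr ?b powr (- \<rho>))" using assms by (intro emeasure_LS_Ioi) auto
  also have "\<dots> \<le> ennreal ((2 powr (- real_of_int m) / 2) powr (- \<rho>))"
    using assms b wr_mono[of b ?b] by (intro ennreal_leI powr_mono2') auto
  also have "(2 powr (- real_of_int m) / 2) powr (- \<rho>) = (2 * 2 powr m) powr \<rho>"
    by (simp add: powr_minus powr_divide powr_mult inverse_eq_divide)
  also have "ennreal \<dots> = epow (ennreal (2 * 2 powr m)) \<rho>"
    using assms by (simp add: epow_ennreal)
  finally show ?thesis using assms by (simp add: enorm_finite_exp epow_le_iff[symmetric] epow_le_iff)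
next
  case False
  have no: "L t \<noteq> - m" if "\<epsilon> < t" for t
    using False that assms less_trans by blast
  have "enorm (LS \<rho> \<epsilon>) (ennreal \<rho>) (\<lambda>t. indicator {t. - L t = m} t * indicator {\<epsilon><..} t) = 0"
  proof (rule enorm_eq_0_AE)
    show "AE t in LS \<rho> \<epsilon>. indicator {t. - L t = m} t * indicator {\<epsilon><..} t = (0::ennreal)"
    proof (rule AE_I2)
      fix t
      show "indicator {t. - L t = m} t * indicator {\<epsilon><..} t = (0::ennreal)"
        using no[of t] by (cases "\<epsilon> < t") auto
    qed
    show "(\<lambda>t. indicator {t. - L t = m} t * indicator {\<epsilon><..} t :: ennreal) \<in> borel_measurable (LS \<rho> \<epsilon>)"
      by measurable
  qed (use assms in simp)
  then show ?thesis by simp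
qed

text \<open>Hardy's inequality with level function \<open>- L\<close>: a ball meets shells of levels
  at or below \<open>L t\<close>, which are the larger ones after reversal. The bounds do not depend
  on \<epsilon>, and a reflection restores the indexing at the end.\<close>

lemma LS_integral_le_shells:
  fixes q :: "'a::euclidean_space \<Rightarrow> ennreal"
  assumes s: "0 < s" and q: "q \<in> borel_measurable lebesgue" and \<rho>: "0 < \<rho>"
  shows "epow (LS_integral (\<lambda>t. - (enn2real (Wp t) powr (- \<rho>))) (\<lambda>t. epow (ball_norm s q t) \<rho>)) (1 / \<rho>)
    \<le> ennreal (geo_const (ennreal \<rho>) (1 / 4) * 2) * ennreal (geo_const s (1 / 2))
      * enorm (count_space UNIV) (ennreal \<rho>) (\<lambda>k. ennreal (2 powr (- real_of_int k)) * shell_norm s q k)"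
    (is "_ \<le> ?R")
proof -
  have [measurable]: "ball_norm s q \<in> borel_measurable borel" by (intro ball_norm_measurable s q)
  have "enorm (LS \<rho> \<epsilon>) (ennreal \<rho>) (\<lambda>t. indicator {\<epsilon><..} t * ball_norm s q t) \<le> ?R" if "0 < \<epsilon>" for \<epsilon>
  proof -
    have "enorm (LS \<rho> \<epsilon>) (ennreal \<rho>) (\<lambda>t. indicator {\<epsilon><..} t * ball_norm s q t)
      \<le> ennreal (geo_const (ennreal \<rho>) (1 / 4) * 2) * ennreal (geo_const s (1 / 2))
      * enorm (count_space UNIV) (ennreal \<rho>) (\<lambda>k. ennreal (2 powr real_of_int k) * shell_norm s q (- k))"
    proof (rule enorm_hardy[where L = "\<lambda>t. - L t"])
      show "(\<lambda>t. - L t) \<in> measurable (LS \<rho> \<epsilon>) (count_space UNIV)" by measurable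
      have "ball_norm s q t \<le> ennreal (geo_const s (1 / 2)) * (SUP j::nat. ennreal (2 powr (real j / 2)) * shell_norm s q (- (- L t + int j)))"
        if "0 < t" for t
        using enorm_ball_le[OF s q that] by (simp add: ball_norm_def shell_norm_def)
      then show "AE t in LS \<rho> \<epsilon>. indicator {\<epsilon><..} t \<noteq> (0::ennreal) \<longrightarrow> ball_norm s q t
          \<le> ennreal (geo_const s (1 / 2)) * (SUP j::nat. ennreal (2 powr (real j / 2)) * shell_norm s q (- (- L t + int j)))"
        using \<open>0 < \<epsilon>\<close> by (intro AE_I2 impI) (auto split: split_indicator_asm)
      show "ball_norm s q \<in> borel_measurable (LS \<rho> \<epsilon>)" by measurable
      show "enorm (LS \<rho> \<epsilon>) (ennreal \<rho>) (\<lambda>t. indicator {t. - L t = m} t * indicator {\<epsilon><..} t) \<le> ennreal (2 * 2 powr real_of_int m)" for m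
        by (intro LS_level_mass \<rho> that)
    qed (use \<rho> in auto)
    also have "enorm (count_space UNIV) (ennreal \<rho>) (\<lambda>k. ennreal (2 powr real_of_int k) * shell_norm s q (- k))
      = enorm (count_space UNIV) (ennreal \<rho>) (\<lambda>k. ennreal (2 powr (- real_of_int k)) * shell_norm s q k)"
      using \<rho> enorm_count_bij[of "ennreal \<rho>" uminus "\<lambda>k. ennreal (2 powr (- real_of_int k)) * shell_norm s q k"]
      by (simp add: bij_uminus)
    finally show ?thesis .
  qed
  then have "(SUP \<epsilon>\<in>{0<..}. epow (enorm (LS \<rho> \<epsilon>) (ennreal \<rho>) (\<lambda>t. indicator {\<epsilon><..} t * ball_norm s q t)) \<rho>) \<le> epow ?R \<rho>"
    using \<rho> by (intro SUP_least epow_mono) auto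
  then have "epow (LS_integral (\<lambda>t. - (enn2real (Wp t) powr (- \<rho>))) (\<lambda>t. epow (ball_norm s q t) \<rho>)) (1 / \<rho>) \<le> epow (epow ?R \<rho>) (1 / \<rho>)"
    unfolding LS_integral_eq[OF s q \<rho>] using \<rho> by (intro epow_mono) auto
  then show ?thesis using \<rho> by simp
qed

text \<open>The radius \<tau> bounds the right limit of \<open>W\<close> at \<sigma> by
  \<open>2 powr (k + 1)\<close>. As \<open>W\<close> reaches \<open>2 powr (k + 3)\<close>, a
  threshold b has right limit at least \<open>2 powr (k + 2)\<close>. From \<sigma> to b the
  integrator thus gains a fixed multiple of \<open>2 powr (- k * \<rho>)\<close>, the ball norm
  stays above its value at \<sigma>, and no level beyond k + 2 is met.\<close>

lemma LS_interval_ge: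
  fixes q :: "'a::euclidean_space \<Rightarrow> ennreal"
  assumes s: "0 < s" and q: "q \<in> borel_measurable lebesgue" and \<rho>: "0 < \<rho>"
    and k: "0 < \<sigma>" "\<sigma> < \<tau>" "L \<sigma> = k" "L \<tau> = k"
    and r: "0 < r" "k + 3 \<le> L r" and \<epsilon>: "0 < \<epsilon>" "\<epsilon> \<le> \<sigma>"
  shows "ennreal (2 powr (- \<rho>) - 4 powr (- \<rho>)) * epow (ennreal (2 powr (- real_of_int k)) * ball_norm s q \<sigma>) \<rho>
    \<le> (\<integral>\<^sup>+t. epow (indicator {\<epsilon><..} t * ball_norm s q t) \<rho> * indicator {t. k \<le> L t \<and> L t \<le> k + 2} t \<partial>LS \<rho> \<epsilon>)"
proof -
  have [measurable]: "ball_norm s q \<in> borel_measurable borel" by (intro ball_norm_measurable s q)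
  have "ennreal (2 powr real_of_int (k + 3)) \<le> W r" using le_L_iff r by blast
  with r(1) obtain b where b: "0 \<le> b" "\<And>r. 0 < r \<Longrightarrow> ennreal (2 powr real_of_int (k + 3)) \<le> W r \<Longrightarrow> b < r"
    "2 powr real_of_int (k + 3) / 2 \<le> wr b"
    by (rule threshold[rotated]) auto
  have wb: "2 powr (real_of_int k + 2) \<le> wr b" using b(3) by (simp add: powr_add)
  have "ennreal (wr \<sigma>) \<le> W \<tau>" unfolding ennreal_wr using k by (intro Wp_le_W)
  also have "\<dots> \<le> ennreal (2 powr (real_of_int k + 1))" using W_upper[of \<tau>] k by simp
  finally have w\<sigma>: "wr \<sigma> \<le> 2 powr (real_of_int k + 1)" by simp
  have "2 powr (real_of_int k + 1) < 2 powr (real_of_int k + 2)" by simp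
  then have "wr \<sigma> < wr b" using wb w\<sigma> by linarith
  then have "\<sigma> < b" using wr_mono[of b \<sigma>] by linarith
  have sub: "\<epsilon> < t \<and> k \<le> L t \<and> L t \<le> k + 2" if "\<sigma> < t" "t \<le> b" for t
  proof -
    have "0 < t" using that k by simp
    have "k \<le> L t" using L_mono[of \<sigma> t] that k by simp
    moreover have "\<not> k + 3 \<le> L t" using b(2)[of t] that \<open>0 < t\<close> le_L_iff[of t "k + 3"] by auto
    ultimately show ?thesis using that \<epsilon> by auto
  qed
  have "2 powr (- real_of_int k * \<rho>) * (2 powr (- \<rho>) - 4 powr (- \<rho>))
    = (2 powr (real_of_int k + 1)) powr (- \<rho>) - (2 powr (real_of_int k + 2)) powr (- \<rho>)"
  proof -
    have "4 powr (- \<rho>) = 2 powr (- (2 * \<rho>))"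
      using powr_powr[of 2 2 "- \<rho>"] by simp
    then show ?thesis by (simp add: powr_powr algebra_simps powr_add[symmetric])
  qed
  also have "\<dots> \<le> wr \<sigma> powr (- \<rho>) - wr b powr (- \<rho>)"
    using w\<sigma> wb wr_pos[OF k(1)] \<rho> by (intro diff_mono powr_mono2') auto
  finally have "ennreal (2 powr (- real_of_int k * \<rho>) * (2 powr (- \<rho>) - 4 powr (- \<rho>))) \<le> emeasure (LS \<rho> \<epsilon>) {\<sigma><..b}"
    using \<rho> \<epsilon> \<open>\<sigma> < b\<close> by (subst emeasure_LS_Ioc) (auto intro: ennreal_leI)
  then have "epow (ball_norm s q \<sigma>) \<rho> * ennreal (2 powr (- real_of_int k * \<rho>) * (2 powr (- \<rho>) - 4 powr (- \<rho>)))
    \<le> epow (ball_norm s q \<sigma>) \<rho> * emeasure (LS \<rho> \<epsilon>) {\<sigma><..b}"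
    by (intro mult_left_mono) auto
  also have "\<dots> = (\<integral>\<^sup>+t. epow (ball_norm s q \<sigma>) \<rho> * indicator {\<sigma><..b} t \<partial>LS \<rho> \<epsilon>)"
    by (subst nn_integral_cmult_indicator) auto
  also have "\<dots> \<le> (\<integral>\<^sup>+t. epow (indicator {\<epsilon><..} t * ball_norm s q t) \<rho> * indicator {t. k \<le> L t \<and> L t \<le> k + 2} t \<partial>LS \<rho> \<epsilon>)"
  proof (rule nn_integral_mono)
    fix t
    show "epow (ball_norm s q \<sigma>) \<rho> * indicator {\<sigma><..b} t
      \<le> epow (indicator {\<epsilon><..} t * ball_norm s q t) \<rho> * indicator {t. k \<le> L t \<and> L t \<le> k + 2} t"
    proof (cases "\<sigma> < t \<and> t \<le> b")
      case True
      have "epow (ball_norm s q \<sigma>) \<rho> \<le> epow (ball_norm s q t) \<rho>"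
        using True \<rho> by (intro epow_mono ball_norm_mono s q) auto
      then show ?thesis using True sub[of t] by simp
    qed auto
  qed
  finally have *: "epow (ball_norm s q \<sigma>) \<rho> * ennreal (2 powr (- real_of_int k * \<rho>) * (2 powr (- \<rho>) - 4 powr (- \<rho>)))
    \<le> (\<integral>\<^sup>+t. epow (indicator {\<epsilon><..} t * ball_norm s q t) \<rho> * indicator {t. k \<le> L t \<and> L t \<le> k + 2} t \<partial>LS \<rho> \<epsilon>)" .
  have "4 powr (- \<rho>) \<le> 2 powr (- \<rho>)" using \<rho> by (intro powr_mono2') auto
  then have "ennreal (2 powr (- real_of_int k * \<rho>) * (2 powr (- \<rho>) - 4 powr (- \<rho>)))
    = ennreal (2 powr (- \<rho>) - 4 powr (- \<rho>)) * epow (ennreal (2 powr (- real_of_int k))) \<rho>"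
    using \<rho> by (simp add: ennreal_mult epow_ennreal powr_powr mult.commute)
  with * show ?thesis using \<rho> by (simp add: epow_mult mult_ac)
qed

text \<open>Bounded overlap of the blocks: only k from \<open>L t - 2\<close> to \<open>L t\<close>
  contribute.\<close>

lemma three_levels_sum:
  assumes "finite K"
  shows "(\<Sum>k\<in>K. indicator {t. k \<le> L t \<and> L t \<le> k + 2} t :: ennreal) \<le> 3"
proof -
  have "(\<Sum>k\<in>K. indicator {t. k \<le> L t \<and> L t \<le> k + 2} t :: ennreal) = of_nat (card (K \<inter> {k. k \<le> L t \<and> L t \<le> k + 2}))"
    using assms by (simp add: indicator_def sum.If_cases of_bool_def)
  also have "card (K \<inter> {k. k \<le> L t \<and> L t \<le> k + 2}) \<le> card {L t - 2..L t}"
    by (intro card_mono) auto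
  also have "card {L t - 2..L t} = 3" by simp
  finally show ?thesis by simp
qed

lemma shells_le_LS_integral:
  fixes q :: "'a::euclidean_space \<Rightarrow> ennreal"
  assumes s: "0 < s" and q: "q \<in> borel_measurable lebesgue" and \<rho>: "0 < \<rho>"
  shows "enorm (count_space UNIV) (ennreal \<rho>) (\<lambda>k. ennreal (2 powr (- real_of_int k)) * shell_norm s q k)
    \<le> 2 * (ennreal ((3 / (2 powr (- \<rho>) - 4 powr (- \<rho>)) + 3 * 8 powr \<rho>) powr (1 / \<rho>))
      * (epow (LS_integral (\<lambda>t. - (enn2real (Wp t) powr (- \<rho>))) (\<lambda>t. epow (ball_norm s q t) \<rho>)) (1 / \<rho>)
        + inverse (omnorm_inf \<theta> \<omega>) * enorm lebesgue s q))"
    (is "_ \<le> 2 * (ennreal (?D powr (1 / \<rho>)) * (epow ?I (1 / \<rho>) + ?B))")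
proof (rule enorm_count_approx)
  fix c :: "int \<Rightarrow> ennreal"
  assume fin: "finite {k. c k \<noteq> 0}" and c: "\<And>k. c k = 0 \<or> c k < shell_norm s q k"
  have [measurable]: "ball_norm s q \<in> borel_measurable borel" by (intro ball_norm_measurable s q)
  define \<kappa> where "\<kappa> = 2 powr (- \<rho>) - 4 powr (- \<rho>)"
  have \<kappa>: "0 < \<kappa>" using \<rho> by (simp add: \<kappa>_def powr_less_mono2_neg)
  define K where "K = {k. c k \<noteq> 0}"
  have "\<exists>\<sigma> \<tau>. 0 < \<sigma> \<and> \<sigma> < \<tau> \<and> L \<sigma> = k \<and> L \<tau> = k \<and> c k < ball_norm s q \<sigma>" if "k \<in> K" for k
  proof -
    have "c k < enorm lebesgue s (\<lambda>x. indicator (shell k) x * q x)"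
      using c[of k] that by (auto simp: K_def shell_norm_def)
    then show ?thesis unfolding ball_norm_def by (rule enorm_shell_approx_ball[OF s q]) blast
  qed
  then obtain \<sigma> \<tau> where st: "\<And>k. k \<in> K \<Longrightarrow> 0 < \<sigma> k \<and> \<sigma> k < \<tau> k \<and> L (\<sigma> k) = k \<and> L (\<tau> k) = k \<and> c k < ball_norm s q (\<sigma> k)"
    by metis
  \<comment> \<open>Where \<open>W\<close> still climbs to level k + 3, the Stieltjes measure has
    enough mass on the block above k. The indices near the top, without such room, are charged to
    the boundary term.\<close>
  define K1 where "K1 = {k \<in> K. \<exists>r>0. k + 3 \<le> L r}"
  define K2 where "K2 = {k \<in> K. \<forall>r>0. L r < k + 3}"
  have K12: "K = K1 \<union> K2" "K1 \<inter> K2 = {}" by (auto simp: K1_def K2_def not_le)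
  have finK: "finite K" "finite K1" "finite K2" using fin by (auto simp: K_def K1_def K2_def)
  let ?a = "\<lambda>k. epow (ennreal (2 powr (- real_of_int k)) * c k) \<rho>"
  have sum1: "(\<Sum>k\<in>K1. ?a k) \<le> ennreal (3 / \<kappa>) * ?I"
  proof -
    \<comment> \<open>Finiteness of \<open>K1\<close> lets one truncation serve all its indices; the
      1 covers the empty case.\<close>
    define \<epsilon> where "\<epsilon> = Min (insert 1 (\<sigma> ` K1))"
    have \<epsilon>: "0 < \<epsilon>" "\<And>k. k \<in> K1 \<Longrightarrow> \<epsilon> \<le> \<sigma> k"
      using st finK by (auto simp: \<epsilon>_def K1_def)
    let ?h = "\<lambda>t. epow (indicator {\<epsilon><..} t * ball_norm s q t) \<rho>"
    have "ennreal \<kappa> * (\<Sum>k\<in>K1. ?a k) = (\<Sum>k\<in>K1. ennreal \<kappa> * ?a k)"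
      by (simp add: sum_distrib_left)
    also have "\<dots> \<le> (\<Sum>k\<in>K1. \<integral>\<^sup>+t. ?h t * indicator {t. k \<le> L t \<and> L t \<le> k + 2} t \<partial>LS \<rho> \<epsilon>)"
    proof (rule sum_mono)
      fix k assume k: "k \<in> K1"
      then obtain r where r: "0 < r" "k + 3 \<le> L r" by (auto simp: K1_def)
      have stk: "0 < \<sigma> k" "\<sigma> k < \<tau> k" "L (\<sigma> k) = k" "L (\<tau> k) = k" "c k < ball_norm s q (\<sigma> k)"
        using st[of k] k by (auto simp: K1_def)
      have "ennreal \<kappa> * ?a k \<le> ennreal \<kappa> * epow (ennreal (2 powr (- real_of_int k)) * ball_norm s q (\<sigma> k)) \<rho>"
        using stk \<rho> by (intro mult_left_mono epow_mono) auto
      also have "\<dots> \<le> (\<integral>\<^sup>+t. ?h t * indicator {t. k \<le> L t \<and> L t \<le> k + 2} t \<partial>LS \<rho> \<epsilon>)"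
        unfolding \<kappa>_def by (rule LS_interval_ge[OF s q \<rho> stk(1-4) r \<epsilon>(1) \<epsilon>(2)[OF k]])
      finally show "ennreal \<kappa> * ?a k \<le> (\<integral>\<^sup>+t. ?h t * indicator {t. k \<le> L t \<and> L t \<le> k + 2} t \<partial>LS \<rho> \<epsilon>)" .
    qed
    also have "\<dots> = (\<integral>\<^sup>+t. (\<Sum>k\<in>K1. ?h t * indicator {t. k \<le> L t \<and> L t \<le> k + 2} t) \<partial>LS \<rho> \<epsilon>)"
      by (rule nn_integral_sum[symmetric]) measurable
    also have "\<dots> \<le> (\<integral>\<^sup>+t. 3 * ?h t \<partial>LS \<rho> \<epsilon>)"
      unfolding sum_distrib_left[symmetric] using three_levels_sum[OF finK(2)]
      by (intro nn_integral_mono) (simp add: mult.commute[of _ "sum _ _"] mult_right_mono)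
    also have "\<dots> = 3 * (\<integral>\<^sup>+t. ?h t \<partial>LS \<rho> \<epsilon>)"
      by (rule nn_integral_cmult) measurable
    also have "(\<integral>\<^sup>+t. ?h t \<partial>LS \<rho> \<epsilon>) \<le> ?I"
      unfolding LS_integral_eq[OF s q \<rho>] epow_enorm[OF \<rho>, symmetric] using \<epsilon>(1) by (intro SUP_upper) auto
    finally have le: "ennreal \<kappa> * (\<Sum>k\<in>K1. ?a k) \<le> 3 * ?I" by (simp add: mult_left_mono)
    have "(\<Sum>k\<in>K1. ?a k) = inverse (ennreal \<kappa>) * (ennreal \<kappa> * (\<Sum>k\<in>K1. ?a k))"
      using \<kappa> by (subst ennreal_mult_inverse_cancel(2)) auto
    also have "\<dots> \<le> inverse (ennreal \<kappa>) * (3 * ?I)"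
      by (intro mult_left_mono le) auto
    also have "\<dots> = ennreal (3 / \<kappa>) * ?I"
      using \<kappa> by (simp add: inverse_ennreal divide_inverse mult.assoc[symmetric] ennreal_mult mult.commute)
    finally show ?thesis .
  qed
  have sum2: "(\<Sum>k\<in>K2. ?a k) \<le> ennreal (3 * 8 powr \<rho>) * epow ?B \<rho>"
  proof (cases "K2 = {}")
    case False
    define m where "m = Min K2"
    have "m \<in> K2" using finK False by (simp add: m_def)
    \<comment> \<open>Every index in \<open>K2\<close> is an attained level, while membership of the
      least index m excludes attained levels from m + 3 on.\<close>
    have "K2 \<subseteq> {m..m + 2}"
    proof
      fix k assume k: "k \<in> K2"
      then have "m \<le> k" using finK by (simp add: m_def)
      moreover have "L (\<sigma> k) = k" "0 < \<sigma> k" using st[of k] k by (auto simp: K2_def)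
      then have "k < m + 3" using \<open>m \<in> K2\<close> by (auto simp: K2_def)
      ultimately show "k \<in> {m..m + 2}" by simp
    qed
    then have card: "card K2 \<le> 3" using card_mono[of "{m..m + 2}" K2] by simp
    have "?a k \<le> epow (8 * ?B) \<rho>" if k: "k \<in> K2" for k
    proof -
      \<comment> \<open>No radius reaches level k + 3, so all of \<omega> has norm at most
        \<open>2 powr (k + 3)\<close>. This is the origin of the factor 8.\<close>
      have "omnorm_inf \<theta> \<omega> = enorm lebesgue \<theta> (\<lambda>r. indicator {r. 0 < r \<and> L r < k + 3} r * om r)"
        unfolding omnorm_inf_eq using k by (intro arg_cong[where f = "enorm _ _"] ext) (auto simp: K2_def indicator_def)
      also have "\<dots> \<le> ennreal (2 powr real_of_int (k + 3))" by (rule omega_below_level)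
      finally have "inverse (ennreal (2 powr real_of_int (k + 3))) \<le> inverse (omnorm_inf \<theta> \<omega>)"
        by (rule ennreal_inverse_antimono)
      then have "8 * ennreal (2 powr (- real_of_int (k + 3))) \<le> 8 * inverse (omnorm_inf \<theta> \<omega>)"
        by (intro mult_left_mono) (simp_all add: inverse_ennreal powr_minus[symmetric])
      moreover have "8 * ennreal (2 powr (- real_of_int (k + 3))) = ennreal (2 powr (- real_of_int k))"
      proof -
        have "2 powr (- real_of_int (k + 3)) = 2 powr (- real_of_int k) / 8"
          by (simp add: powr_diff)
        then show ?thesis by (simp add: ennreal_mult[symmetric] flip: ennreal_numeral)
      qed
      ultimately have "ennreal (2 powr (- real_of_int k)) * c k \<le> (8 * inverse (omnorm_inf \<theta> \<omega>)) * enorm lebesgue s q"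
      proof (intro mult_mono)
        have "c k \<le> shell_norm s q k" using c[of k] by auto
        also have "\<dots> \<le> enorm lebesgue s q"
          unfolding shell_norm_def using s q by (intro enorm_mono) (auto simp: indicator_def)
        finally show "c k \<le> enorm lebesgue s q" .
      qed auto
      then show ?thesis using \<rho> by (intro epow_mono) (simp_all add: mult.assoc)
    qed
    then have "(\<Sum>k\<in>K2. ?a k) \<le> of_nat (card K2) * epow (8 * ?B) \<rho>"
      using sum_bounded_above[of K2 ?a "epow (8 * ?B) \<rho>"] by simp
    also have "\<dots> \<le> of_nat 3 * epow (8 * ?B) \<rho>"
      using card by (intro mult_right_mono of_nat_mono) auto
    also have "\<dots> = ennreal (3 * 8 powr \<rho>) * epow ?B \<rho>"
      using \<rho> epow_ennreal[of \<rho> 8] by (simp add: epow_mult ennreal_mult mult.assoc)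
    finally show ?thesis .
  qed simp
  have "(\<integral>\<^sup>+k. ?a k \<partial>count_space UNIV) = (\<Sum>k\<in>K. ?a k)"
    using finK \<rho> by (intro nn_integral_count_space') (auto simp: K_def)
  also have "\<dots> = (\<Sum>k\<in>K1. ?a k) + (\<Sum>k\<in>K2. ?a k)"
    unfolding K12(1) by (intro sum.union_disjoint finK K12)
  also have "\<dots> \<le> ennreal (3 / \<kappa>) * ?I + ennreal (3 * 8 powr \<rho>) * epow ?B \<rho>"
    by (intro add_mono sum1 sum2)
  \<comment> \<open>Both terms are dominated by the same power of the full right-hand side, so the
    two constants add up to \<open>?D\<close>.\<close>
  also have "\<dots> \<le> ennreal (3 / \<kappa>) * epow (epow ?I (1 / \<rho>) + ?B) \<rho> + ennreal (3 * 8 powr \<rho>) * epow (epow ?I (1 / \<rho>) + ?B) \<rho>"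
  proof (intro add_mono mult_left_mono)
    have "epow (epow ?I (1 / \<rho>)) \<rho> \<le> epow (epow ?I (1 / \<rho>) + ?B) \<rho>"
      using \<rho> by (intro epow_mono) auto
    then show "?I \<le> epow (epow ?I (1 / \<rho>) + ?B) \<rho>" using \<rho> by simp
    show "epow ?B \<rho> \<le> epow (epow ?I (1 / \<rho>) + ?B) \<rho>"
      using \<rho> by (intro epow_mono) auto
  qed auto
  also have "\<dots> = ennreal ?D * epow (epow ?I (1 / \<rho>) + ?B) \<rho>"
    using \<kappa> by (simp add: \<kappa>_def distrib_right[symmetric] ennreal_plus[symmetric] del: ennreal_plus)
  finally have "epow (\<integral>\<^sup>+k. ?a k \<partial>count_space UNIV) (1 / \<rho>) \<le> epow (ennreal ?D * epow (epow ?I (1 / \<rho>) + ?B) \<rho>) (1 / \<rho>)"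
    using \<rho> by (intro epow_mono) auto
  also have "\<dots> = epow (ennreal ?D) (1 / \<rho>) * (epow ?I (1 / \<rho>) + ?B)"
    using \<rho> by (simp add: epow_mult[where a = "1 / \<rho>"])
  also have "epow (ennreal ?D) (1 / \<rho>) = ennreal (?D powr (1 / \<rho>))"
    using \<rho> \<kappa> by (intro epow_ennreal) (auto simp: \<kappa>_def)
  finally show "enorm (count_space UNIV) (ennreal \<rho>) (\<lambda>k. ennreal (2 powr (- real_of_int k)) * c k)
    \<le> ennreal (?D powr (1 / \<rho>)) * (epow ?I (1 / \<rho>) + ?B)"
    using \<rho> by (simp add: enorm_finite_exp)
qed (use \<rho> in simp)

end

subsection \<open>The embedding\<close>


lemma sigma_finite_lebesgue: "sigma_finite_measure (lebesgue :: 'a::euclidean_space measure)"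
proof
  obtain A :: "'a set set" where "countable A" "A \<subseteq> sets lborel" "\<Union>A = space lborel"
    "\<forall>a\<in>A. emeasure lborel a \<noteq> \<infinity>"
    using lborel.sigma_finite_countable by blast
  then show "\<exists>A. countable A \<and> A \<subseteq> sets (lebesgue :: 'a measure) \<and> \<Union>A = space lebesgue
    \<and> (\<forall>a\<in>A. emeasure lebesgue a \<noteq> \<infinity>)"
    by (intro exI[of _ A]) (auto simp: emeasure_completion subset_iff)
qed

text \<open>\<open>z * inverse z \<le> 1\<close> holds throughout [0, \<infinity>]; at 0 and at
  \<infinity> the product is 0.\<close>

lemma ennreal_divide_le_of_le_mult: "x \<le> y * z \<Longrightarrow> x / z \<le> (y::ennreal)"
proof -
  assume "x \<le> y * z"
  then have "x * inverse z \<le> y * z * inverse z" by (intro mult_right_mono) auto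
  also have "\<dots> = y * (z * inverse z)" by (simp add: mult.assoc)
  also have "\<dots> \<le> y * 1"
    by (cases "z = 0 \<or> z = top")
      (auto intro!: mult_left_mono simp: ennreal_mult_inverse_cancel(1)[of z 1, simplified])
  finally show ?thesis by (simp add: divide_ennreal_def)
qed

text \<open>The exponent \<open>\<kappa>\<close> dual to the pair \<open>(p, \<theta>)\<close>: in the range \<open>\<theta> \<le> p\<close> the embedding
  of the sequence spaces replaces Hoelder's inequality, and \<open>\<kappa> = \<infinity>\<close>.\<close>
definition dual_exponent :: "real \<Rightarrow> ennreal \<Rightarrow> ennreal \<Rightarrow> bool" where
  "dual_exponent p \<theta> \<kappa> \<longleftrightarrow> 0 < \<kappa> \<and>
    (\<theta> \<le> ennreal p \<and> \<kappa> = top \<or> inverse (ennreal p) = inverse \<theta> + inverse \<kappa>)"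

lemma enorm_count_holder:
  assumes p: "0 < p" "0 < \<theta>" and \<kappa>: "dual_exponent p \<theta> \<kappa>"
  shows "enorm (count_space UNIV) (ennreal p) (\<lambda>k. a k * b k)
    \<le> ennreal (2 powr (1 / p)) * (enorm (count_space UNIV) \<theta> a * enorm (count_space UNIV) \<kappa> b)"
proof (cases "inverse (ennreal p) = inverse \<theta> + inverse \<kappa>")
  case True
  then show ?thesis using p \<kappa> by (intro enorm_holder) (auto simp: dual_exponent_def)
next
  case False
  then have *: "\<theta> \<le> ennreal p" "\<kappa> = top" using \<kappa> by (auto simp: dual_exponent_def)
  then obtain r where r: "\<theta> = ennreal r" "0 < r" "r \<le> p"
    using p by (cases \<theta>) (auto simp: top_unique)
  have "enorm (count_space UNIV) (ennreal p) (\<lambda>k. a k * b k)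
    \<le> enorm (count_space UNIV) top b * enorm (count_space UNIV) (ennreal p) a"
    using enorm_mult_top_le[of b "count_space UNIV" a "ennreal p"] p by (simp add: mult.commute)
  also have "\<dots> \<le> enorm (count_space UNIV) top b * enorm (count_space UNIV) \<theta> a"
    unfolding r(1) using r by (intro mult_left_mono enorm_count_antimono_exponent) auto
  also have "\<dots> \<le> ennreal (2 powr (1 / p)) * (enorm (count_space UNIV) top b * enorm (count_space UNIV) \<theta> a)"
    using p by (intro ennreal_le_mult_left) (simp add: ge_one_powr_ge_zero)
  finally show ?thesis using * by (simp add: mult.commute)
qed

text \<open>Under the reciprocal relation near-extremal sequences exist by the reverse Hoelder
  inequality. In the remaining case the dual norm is a supremum, which unit vectors already
  detect.\<close>

lemma enorm_count_dual_le:
  fixes b :: "int \<Rightarrow> ennreal"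
  assumes p: "0 < p" "0 < \<theta>" and \<kappa>: "dual_exponent p \<theta> \<kappa>"
    and X: "\<And>\<alpha>::int \<Rightarrow> real. (\<And>k. 0 \<le> \<alpha> k) \<Longrightarrow> enorm (count_space UNIV) \<theta> (\<lambda>k. ennreal (\<alpha> k)) \<le> 1 \<Longrightarrow>
      enorm (count_space UNIV) (ennreal p) (\<lambda>k. ennreal (\<alpha> k) * b k) \<le> X"
  shows "enorm (count_space UNIV) \<kappa> b \<le> X"
proof (cases "inverse (ennreal p) = inverse \<theta> + inverse \<kappa>")
  case True
  interpret sigma_finite_measure "count_space (UNIV :: int set)"
    by (rule sigma_finite_measure_count_space)
  show ?thesis
  proof (rule dense_le)
    fix c assume "c < enorm (count_space UNIV) \<kappa> b"
    then obtain \<alpha> :: "int \<Rightarrow> real" where "\<And>k. 0 \<le> \<alpha> k" "enorm (count_space UNIV) \<theta> (\<lambda>k. ennreal (\<alpha> k)) \<le> 1"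
      "c \<le> enorm (count_space UNIV) (ennreal p) (\<lambda>k. ennreal (\<alpha> k) * b k)"
      using p \<kappa> True by (elim enorm_reverse_holder[rotated 5]) (auto simp: dual_exponent_def)
    then show "c \<le> X" using X[of \<alpha>] by auto
  qed
next
  case False
  then have *: "\<theta> \<le> ennreal p" "\<kappa> = top" using \<kappa> by (auto simp: dual_exponent_def)
  then obtain r where r: "\<theta> = ennreal r" "0 < r"
    using p by (cases \<theta>) (auto simp: top_unique)
  show ?thesis
    unfolding *(2) enorm_count_top
  proof (rule SUP_least)
    fix k
    have "enorm (count_space UNIV) \<theta> (\<lambda>i::int. ennreal (of_bool (i = k))) = 1"
    proof -
      have "(\<integral>\<^sup>+i. epow (ennreal (of_bool (i = k))) r \<partial>count_space UNIV) = 1"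
        using r by (subst nn_integral_count_space'[of "{k}"]) auto
      then show ?thesis using r by (simp add: enorm_finite_exp)
    qed
    then have "enorm (count_space UNIV) (ennreal p) (\<lambda>i. ennreal (of_bool (i = k)) * b i) \<le> X"
      by (intro X) auto
    moreover have "b k \<le> enorm (count_space UNIV) (ennreal p) (\<lambda>i. ennreal (of_bool (i = k)) * b i)"
      using enorm_count_ge[of "ennreal p" "\<lambda>i. ennreal (of_bool (i = k)) * b i" k] p by simp
    ultimately show "b k \<le> X" by simp
  qed
qed

definition weighted :: "real \<Rightarrow> ('a \<Rightarrow> real) \<Rightarrow> ('a \<Rightarrow> real) \<Rightarrow> 'a \<Rightarrow> ennreal" where
  "weighted p v f x = ennreal \<bar>f x\<bar> * epow (ennreal (v x)) (1 / p)"

locale embedding = levels +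
  fixes v1 v2 :: "'a::euclidean_space \<Rightarrow> real" and p1 p2 :: real and \<kappa> :: ennreal
  assumes p1: "0 < p1" and p12: "p1 \<le> p2"
    and v1: "v1 \<in> weights" and v2: "v2 \<in> weights"
    and dual: "dual_exponent p1 \<theta> \<kappa>"
begin

abbreviation s where "s \<equiv> sexp p1 p2"
abbreviation Q where "Q \<equiv> wquot p1 p2 v1 v2"
abbreviation J where "J \<equiv> embed_norm p1 p2 \<theta> \<omega> v1 v2"

definition K :: ennreal where
  "K = enorm (count_space UNIV) \<kappa> (\<lambda>k. ennreal (2 powr (- real_of_int k)) * shell_norm s Q k)"

lemma p2: "0 < p2"
  using p1 p12 by simp

lemma s_pos: "0 < s"
  using p1 p12 by (auto simp: sexp_def)

lemma s_exponent: "inverse (ennreal p1) = inverse (ennreal p2) + inverse s"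
proof (cases "p1 = p2")
  case False
  define d where "d = p1 * p2 / (p2 - p1)"
  have d: "0 < d" "s = ennreal d" using False p1 p12 by (auto simp: d_def sexp_def)
  have "inverse (ennreal p2) + inverse s = ennreal (inverse p2 + inverse d)"
    using d p2 by (simp add: inverse_ennreal)
  also have "inverse p2 + inverse d = inverse p1"
    using p1 p2 by (simp add: d_def field_simps)
  finally show ?thesis using p1 by (simp add: inverse_ennreal)
qed (simp add: sexp_def)

lemma weights_measurable [measurable]: "v1 \<in> borel_measurable lebesgue" "v2 \<in> borel_measurable lebesgue"
  using v1 v2 by (auto simp: weights_def)

lemma Q_measurable [measurable]: "Q \<in> borel_measurable lebesgue"
  unfolding wquot_def by measurable

lemma weighted_measurable [measurable]:
  assumes [measurable]: "f \<in> borel_measurable lebesgue"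
  shows "weighted p1 v1 f \<in> borel_measurable lebesgue" "weighted p2 v2 f \<in> borel_measurable lebesgue"
  unfolding weighted_def by measurable

text \<open>Where \<open>v2\<close> is positive its powers \<open>1 / p2\<close> and
  \<open>- 1 / p2\<close> cancel. The embedding thereby becomes multiplication by \<open>Q\<close>,
  to which Hoelder's inequality on a shell applies.\<close>

lemma weighted_factor: "AE x in lebesgue. weighted p1 v1 f x = weighted p2 v2 f x * Q x"
proof -
  have "AE x in lebesgue. 0 < v2 x" using v2 by (simp add: weights_def)
  then show ?thesis
  proof eventually_elim
    case (elim x)
    have "epow (ennreal (v2 x)) (1 / p2) * epow (ennreal (v2 x)) (- 1 / p2) = 1"
      using elim p2 by (simp add: epow_def ennreal_mult[symmetric] powr_add[symmetric])
    then show ?case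
      unfolding weighted_def wquot_def by (metis (no_types, opaque_lifting) mult.assoc mult.left_commute mult_1_right)
  qed
qed

lemma target_norm: "wnorm lebesgue (ennreal p1) UNIV (\<lambda>x. ennreal (v1 x)) (\<lambda>x. ennreal \<bar>f x\<bar>)
    = enorm lebesgue (ennreal p1) (weighted p1 v1 f)"
  using p1 by (simp add: wnorm_weighted weighted_def[abs_def])

lemma outer_norm_weighted:
  "wnorm lebesgue (ennreal p2) (- ball 0 t) (\<lambda>x. ennreal (v2 x)) (\<lambda>x. ennreal \<bar>f x\<bar>) = outer_norm p2 (weighted p2 v2 f) t"
  using p2 by (simp add: wnorm_weighted weighted_def outer_norm_def)

lemma source_norm: "cLM_norm p2 \<theta> \<omega> v2 f = morrey p2 (weighted p2 v2 f)"
  using theta by (simp add: cLM_norm_def outer_norm_weighted wnorm_unweighted morrey_def mult.assoc)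

lemma shell_norm_weighted_le:
  assumes [measurable]: "f \<in> borel_measurable lebesgue"
  shows "shell_norm (ennreal p1) (weighted p1 v1 f) k
    \<le> ennreal (2 powr (1 / p1)) * (shell_norm (ennreal p2) (weighted p2 v2 f) k * shell_norm s Q k)"
proof -
  have "shell_norm (ennreal p1) (weighted p1 v1 f) k
    = enorm lebesgue (ennreal p1) (\<lambda>x. (indicator (shell k) x * weighted p2 v2 f x) * (indicator (shell k) x * Q x))"
    unfolding shell_norm_def
  proof (rule enorm_cong_AE)
    show "AE x in lebesgue. indicator (shell k) x * weighted p1 v1 f x
      = (indicator (shell k) x * weighted p2 v2 f x) * (indicator (shell k) x * Q x)"
      using weighted_factor[of f] by eventually_elim (simp add: indicator_def)
  qed (use p1 in auto)
  also have "\<dots> \<le> ennreal (2 powr (1 / p1)) * (shell_norm (ennreal p2) (weighted p2 v2 f) k * shell_norm s Q k)"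
    unfolding shell_norm_def using p1 p2 s_pos s_exponent by (intro enorm_holder) measurable
  finally show ?thesis .
qed

lemma enorm_shells:
  assumes "0 < p" "g \<in> borel_measurable lebesgue"
  shows "enorm lebesgue p g = enorm (count_space UNIV) p (shell_norm p (g :: 'a \<Rightarrow> ennreal))"
  using enorm_partition[OF assms L_norm_lebesgue] by (simp add: shell_norm_def[abs_def] shell_def)

lemma powr_cancel: "ennreal (2 powr x) * ennreal (2 powr (- x)) = 1"
  by (simp add: ennreal_mult[symmetric] powr_add[symmetric])

text \<open>Inserting \<open>2 powr k\<close> and its inverse splits a shell term into an entry of
  the Morrey sequence and one of the sequence defining \<open>K\<close>. Hoelder's inequality is
  used twice, on shells and on sequences, hence the repeated \<open>2 powr (1 / p1)\<close>.\<close>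

lemma target_norm_le:
  assumes [measurable]: "f \<in> borel_measurable lebesgue"
  shows "enorm lebesgue (ennreal p1) (weighted p1 v1 f)
    \<le> ennreal (2 powr (1 / p1)) * ennreal (2 powr (1 / p1)) * ennreal (1 / gap_const \<theta>) * ennreal (2 * geo_const \<theta> 1)
      * ennreal (2 * geo_const \<theta> 1) * K * cLM_norm p2 \<theta> \<omega> v2 f"
proof -
  let ?a = "shell_norm (ennreal p2) (weighted p2 v2 f)"
  have "enorm lebesgue (ennreal p1) (weighted p1 v1 f)
    = enorm (count_space UNIV) (ennreal p1) (shell_norm (ennreal p1) (weighted p1 v1 f))"
    using p1 by (intro enorm_shells) auto
  also have "\<dots> \<le> enorm (count_space UNIV) (ennreal p1)
      (\<lambda>k. ennreal (2 powr (1 / p1)) * ((ennreal (2 powr k) * ?a k) * (ennreal (2 powr (- real_of_int k)) * shell_norm s Q k)))"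
  proof (rule enorm_mono)
    fix k :: int
    have "(ennreal (2 powr k) * ?a k) * (ennreal (2 powr (- real_of_int k)) * shell_norm s Q k)
      = (ennreal (2 powr k) * ennreal (2 powr (- real_of_int k))) * (?a k * shell_norm s Q k)"
      by (simp only: mult_ac)
    then show "shell_norm (ennreal p1) (weighted p1 v1 f) k
      \<le> ennreal (2 powr (1 / p1)) * ((ennreal (2 powr k) * ?a k) * (ennreal (2 powr (- real_of_int k)) * shell_norm s Q k))"
      using shell_norm_weighted_le[of f k] by (simp only: powr_cancel mult_1_left assms)
  qed (use p1 in auto)
  also have "\<dots> = ennreal (2 powr (1 / p1)) * enorm (count_space UNIV) (ennreal p1)
      (\<lambda>k. (ennreal (2 powr k) * ?a k) * (ennreal (2 powr (- real_of_int k)) * shell_norm s Q k))"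
    using p1 by (intro enorm_cmult) auto
  also have "\<dots> \<le> ennreal (2 powr (1 / p1)) * (ennreal (2 powr (1 / p1)) * (enorm (count_space UNIV) \<theta> (\<lambda>k. ennreal (2 powr k) * ?a k) * K))"
    unfolding K_def using p1 theta dual by (intro mult_left_mono enorm_count_holder) auto
  also have "\<dots> \<le> ennreal (2 powr (1 / p1)) * (ennreal (2 powr (1 / p1)) * (ennreal (1 / gap_const \<theta>)
      * (ennreal (2 * geo_const \<theta> 1) * (ennreal (2 * geo_const \<theta> 1) * morrey p2 (weighted p2 v2 f))) * K))"
    using p2 by (intro mult_left_mono mult_right_mono shells_le_morrey) auto
  finally show ?thesis by (simp only: source_norm mult_ac)
qed

lemma embed_norm_le_K:
  "J \<le> ennreal (2 powr (1 / p1)) * ennreal (2 powr (1 / p1)) * ennreal (1 / gap_const \<theta>) * ennreal (2 * geo_const \<theta> 1)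
      * ennreal (2 * geo_const \<theta> 1) * K"
  unfolding embed_norm_def
  by (intro SUP_least ennreal_divide_le_of_le_mult) (auto simp: target_norm cLM_def intro: target_norm_le)

lemma target_norm_le_embed_norm:
  assumes f: "f \<in> cLM p2 \<theta> \<omega> v2"
  shows "enorm lebesgue (ennreal p1) (weighted p1 v1 f) \<le> J * cLM_norm p2 \<theta> \<omega> v2 f" (is "?n \<le> J * ?N")
proof -
  have [measurable]: "f \<in> borel_measurable lebesgue" and fin: "?N < top" using f by (auto simp: cLM_def)
  show ?thesis
  proof (cases "?N = 0 \<or> (AE x in lebesgue. f x = 0)")
    case True
    then have "?n = 0"
    proof
      \<comment> \<open>The upper estimate makes the target norm vanish even if \<open>K\<close> is
        infinite, because 0 * \<infinity> = 0.\<close>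
      assume "?N = 0"
      then show ?thesis using target_norm_le[of f] by simp
    next
      assume "AE x in lebesgue. f x = 0"
      then have "AE x in lebesgue. weighted p1 v1 f x = 0"
        by eventually_elim (simp add: weighted_def)
      then show ?thesis using p1 by (intro enorm_eq_0_AE) auto
    qed
    then show ?thesis by simp
  next
    case False
    then have "?n / ?N \<le> J"
      unfolding embed_norm_def using f by (intro SUP_upper2[of f]) (auto simp: target_norm)
    then have "?N * (inverse ?N * ?n) \<le> ?N * J"
      by (intro mult_left_mono) (auto simp: divide_ennreal_def mult.commute)
    then show ?thesis using False fin by (simp add: ennreal_mult_inverse_cancel mult.commute)
  qed
qed

lemma extremal_function:
  assumes c: "c = 0 \<or> c < shell_norm s Q k"
  shows "\<exists>g :: 'a \<Rightarrow> real. g \<in> borel_measurable lebesgue \<and> shell_norm (ennreal p2) (weighted p2 v2 g) k \<le> 1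
    \<and> c \<le> shell_norm (ennreal p1) (weighted p1 v1 g) k"
  using c
proof
  assume "c = 0"
  have "shell_norm (ennreal p2) (weighted p2 v2 (\<lambda>_. 0)) k = 0"
    unfolding shell_norm_def using p2 by (intro enorm_eq_0_AE) (auto simp: weighted_def)
  with \<open>c = 0\<close> show ?thesis by (intro exI[of _ "\<lambda>_. 0"]) auto
next
  interpret sigma_finite_measure "lebesgue :: 'a measure" by (rule sigma_finite_lebesgue)
  assume "c < shell_norm s Q k"
  then obtain a :: "'a \<Rightarrow> real" where [measurable]: "a \<in> borel_measurable lebesgue" and a: "\<And>x. 0 \<le> a x"
    "enorm lebesgue (ennreal p2) (\<lambda>x. ennreal (a x)) \<le> 1"
    "c \<le> enorm lebesgue (ennreal p1) (\<lambda>x. ennreal (a x) * (indicator (shell k) x * Q x))"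
    unfolding shell_norm_def using p1 p2 s_pos s_exponent by (elim enorm_reverse_holder[rotated 5]) auto
  define g where "g x = a x * (if 0 < v2 x then v2 x powr (- 1 / p2) else 0)" for x
  have [measurable]: "g \<in> borel_measurable lebesgue" unfolding g_def by measurable
  have "AE x in lebesgue. 0 < v2 x" using v2 by (simp add: weights_def)
  then have g: "AE x in lebesgue. weighted p2 v2 g x = ennreal (a x)"
  proof eventually_elim
    case (elim x)
    then show ?case using a(1)[of x] p2
      by (simp add: weighted_def g_def epow_ennreal ennreal_mult[symmetric] abs_mult mult.assoc powr_add[symmetric])
  qed
  show ?thesis
  proof (intro exI[of _ g] conjI)
    have "shell_norm (ennreal p2) (weighted p2 v2 g) k \<le> enorm lebesgue (ennreal p2) (\<lambda>x. ennreal (a x))"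
      unfolding shell_norm_def
    proof (intro enorm_mono_AE)
      show "AE x in lebesgue. indicator (shell k) x * weighted p2 v2 g x \<le> ennreal (a x)"
        using g by eventually_elim (simp add: indicator_def)
    qed (use p2 in auto)
    also note a(2)
    finally show "shell_norm (ennreal p2) (weighted p2 v2 g) k \<le> 1" .
    have "enorm lebesgue (ennreal p1) (\<lambda>x. ennreal (a x) * (indicator (shell k) x * Q x)) \<le> shell_norm (ennreal p1) (weighted p1 v1 g) k"
      unfolding shell_norm_def
    proof (intro enorm_mono_AE)
      show "AE x in lebesgue. ennreal (a x) * (indicator (shell k) x * Q x) \<le> indicator (shell k) x * weighted p1 v1 g x"
        using g weighted_factor[of g] by eventually_elim (simp add: indicator_def)
    qed (use p1 in auto)
    with a(3) show "c \<le> shell_norm (ennreal p1) (weighted p1 v1 g) k" by simp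
  qed measurable
qed

text \<open>Only the piece \<open>g k\<close> is seen on shell k, so the shell norms of a glued
  function can be prescribed independently of each other.\<close>

lemma shell_norm_glue:
  fixes g :: "int \<Rightarrow> 'a \<Rightarrow> real"
  assumes p: "0 < p" and [measurable]: "\<And>k. weighted p v (g k) \<in> borel_measurable lebesgue" and b: "\<And>k. 0 \<le> b k"
  shows "shell_norm (ennreal p) (weighted p v (\<lambda>x. b (L (norm x)) * g (L (norm x)) x)) k
    = ennreal (b k) * shell_norm (ennreal p) (weighted p v (g k)) k"
proof -
  have "indicator (shell k) x * weighted p v (\<lambda>x. b (L (norm x)) * g (L (norm x)) x) x
    = ennreal (b k) * (indicator (shell k) x * weighted p v (g k) x)" for x :: 'a
    using b by (auto simp: indicator_def shell_def weighted_def abs_mult ennreal_mult mult.assoc)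
  then show ?thesis
    unfolding shell_norm_def using p by (simp add: enorm_cmult)
qed

text \<open>For \<alpha> in the unit ball with exponent \<theta>, gluing
  \<open>2 powr (- k) * \<alpha> k\<close> times a near-extremal function of shell k gives a Morrey
  norm of at most \<open>?C\<close>. Testing \<open>J\<close> on it and letting \<alpha> vary
  recovers the dual sequence norm.\<close>

lemma K_le_embed_norm:
  "K \<le> 2 * (J * (ennreal (geo_const \<theta> (1 / 4) * 2) * ennreal (geo_const (ennreal p2) (1 / 2))))"
    (is "_ \<le> 2 * (J * ?C)")
  unfolding K_def
proof (rule enorm_count_approx)
  show "0 < \<kappa>" using dual by (simp add: dual_exponent_def)
  fix c :: "int \<Rightarrow> ennreal"
  assume "\<And>k. c k = 0 \<or> c k < shell_norm s Q k"
  then have "\<forall>k. \<exists>g :: 'a \<Rightarrow> real. g \<in> borel_measurable lebesgue \<and> shell_norm (ennreal p2) (weighted p2 v2 g) k \<le> 1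
    \<and> c k \<le> shell_norm (ennreal p1) (weighted p1 v1 g) k"
    by (intro allI extremal_function)
  then obtain g :: "int \<Rightarrow> 'a \<Rightarrow> real" where [measurable]: "\<And>k. g k \<in> borel_measurable lebesgue"
    and g: "\<And>k. shell_norm (ennreal p2) (weighted p2 v2 (g k)) k \<le> 1"
      "\<And>k. c k \<le> shell_norm (ennreal p1) (weighted p1 v1 (g k)) k"
    by metis
  show "enorm (count_space UNIV) \<kappa> (\<lambda>k. ennreal (2 powr (- real_of_int k)) * c k) \<le> J * ?C"
  proof (rule enorm_count_dual_le[OF p1 theta dual])
    fix \<alpha> :: "int \<Rightarrow> real"
    assume \<alpha>: "\<And>k. 0 \<le> \<alpha> k" "enorm (count_space UNIV) \<theta> (\<lambda>k. ennreal (\<alpha> k)) \<le> 1"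
    define b where "b k = 2 powr (- real_of_int k) * \<alpha> k" for k
    define f where "f x = b (L (norm x)) * g (L (norm x)) x" for x
    have b: "0 \<le> b k" for k using \<alpha> by (simp add: b_def)
    have [measurable]: "f \<in> borel_measurable lebesgue"
      unfolding f_def by (rule measurable_compose_countable[OF _ L_norm_lebesgue, of "\<lambda>k x. b k * g k x"]) measurable
    have "morrey p2 (weighted p2 v2 f)
      \<le> ?C * enorm (count_space UNIV) \<theta> (\<lambda>k. ennreal (2 powr k) * shell_norm (ennreal p2) (weighted p2 v2 f) k)"
      using p2 by (intro morrey_le_shells) auto
    also have "\<dots> \<le> ?C * enorm (count_space UNIV) \<theta> (\<lambda>k. ennreal (\<alpha> k))"
    proof (intro mult_left_mono enorm_mono theta)
      fix k :: int
      have "ennreal (2 powr k) * shell_norm (ennreal p2) (weighted p2 v2 f) k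
        = ennreal (2 powr k * b k) * shell_norm (ennreal p2) (weighted p2 v2 (g k)) k"
        unfolding f_def using p2 b by (subst shell_norm_glue) (auto simp: ennreal_mult mult.assoc)
      also have "\<dots> \<le> ennreal (2 powr k * b k) * 1"
        by (intro mult_left_mono g) auto
      also have "2 powr k * b k = \<alpha> k" by (simp add: b_def mult.assoc[symmetric] powr_add[symmetric])
      finally show "ennreal (2 powr k) * shell_norm (ennreal p2) (weighted p2 v2 f) k \<le> ennreal (\<alpha> k)" by simp
    qed auto
    also have "\<dots> \<le> ?C * 1" by (intro mult_left_mono \<alpha>) auto
    finally have N: "morrey p2 (weighted p2 v2 f) \<le> ?C" by simp
    also have "?C < top" by (simp add: ennreal_mult_less_top)
    finally have fin: "morrey p2 (weighted p2 v2 f) < top" .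
    have outer: "outer_norm p2 (weighted p2 v2 f) t < top" if "0 < t" for t
    proof (rule ccontr)
      assume "\<not> outer_norm p2 (weighted p2 v2 f) t < top"
      then have "outer_norm p2 (weighted p2 v2 f) t = top" by (simp add: less_top[symmetric])
      then have "W t * top \<le> morrey p2 (weighted p2 v2 f)"
        using W_outer_norm_le_morrey[of p2 "weighted p2 v2 f" t] that p2 by auto
      then show False using W_pos[OF that] fin by (auto simp: ennreal_mult_top top_unique split: if_splits)
    qed
    have "f \<in> cLM p2 \<theta> \<omega> v2"
      using fin outer by (auto simp: cLM_def source_norm outer_norm_weighted)
    then have "enorm lebesgue (ennreal p1) (weighted p1 v1 f) \<le> J * ?C"
      using target_norm_le_embed_norm[of f] N unfolding source_norm
      by (meson mult_left_mono order_trans zero_le)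
    moreover have "enorm (count_space UNIV) (ennreal p1) (\<lambda>k. ennreal (\<alpha> k) * (ennreal (2 powr (- real_of_int k)) * c k))
      \<le> enorm lebesgue (ennreal p1) (weighted p1 v1 f)"
    proof -
      have "enorm (count_space UNIV) (ennreal p1) (\<lambda>k. ennreal (\<alpha> k) * (ennreal (2 powr (- real_of_int k)) * c k))
        \<le> enorm (count_space UNIV) (ennreal p1) (shell_norm (ennreal p1) (weighted p1 v1 f))"
      proof (rule enorm_mono)
        fix k :: int
        have "ennreal (\<alpha> k) * (ennreal (2 powr (- real_of_int k)) * c k) = ennreal (b k) * c k"
          using \<alpha> by (simp add: b_def ennreal_mult mult_ac)
        also have "\<dots> \<le> ennreal (b k) * shell_norm (ennreal p1) (weighted p1 v1 (g k)) k"
          by (intro mult_left_mono g) auto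
        also have "\<dots> = shell_norm (ennreal p1) (weighted p1 v1 f) k"
          unfolding f_def using p1 b by (subst shell_norm_glue) auto
        finally show "ennreal (\<alpha> k) * (ennreal (2 powr (- real_of_int k)) * c k) \<le> shell_norm (ennreal p1) (weighted p1 v1 f) k" .
      qed (use p1 in auto)
      also have "\<dots> = enorm lebesgue (ennreal p1) (weighted p1 v1 f)"
        using p1 by (intro enorm_shells[symmetric]) auto
      finally show ?thesis .
    qed
    ultimately show "enorm (count_space UNIV) (ennreal p1) (\<lambda>k. ennreal (\<alpha> k) * (ennreal (2 powr (- real_of_int k)) * c k)) \<le> J * ?C"
      by simp
  qed
qed

end


section \<open>Explicit constants and the two-sided bounds\<close>

definition upper_const :: "ennreal \<Rightarrow> real \<Rightarrow> real" where
  "upper_const \<theta> p = 2 powr (1 / p) * 2 powr (1 / p) * (1 / gap_const \<theta>) * (2 * geo_const \<theta> 1) * (2 * geo_const \<theta> 1)"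

definition lower_const :: "ennreal \<Rightarrow> real \<Rightarrow> real" where
  "lower_const \<theta> p = 2 * (geo_const \<theta> (1 / 4) * 2 * geo_const (ennreal p) (1 / 2))"

definition LS_const :: "real \<Rightarrow> real" where
  "LS_const \<rho> = 2 * (3 / (2 powr (- \<rho>) - 4 powr (- \<rho>)) + 3 * 8 powr \<rho>) powr (1 / \<rho>)"

context embedding
begin

lemma J_le: "J \<le> ennreal (upper_const \<theta> p1) * K"
proof -
  have "0 \<le> 1 / gap_const \<theta>" "0 \<le> 2 * geo_const \<theta> 1"
    using gap_const_pos[OF theta] geo_const_pos[OF zero_less_one theta] by auto
  then show ?thesis
    using embed_norm_le_K by (simp only: upper_const_def ennreal_mult'' powr_ge_zero)
qed

lemma K_le: "K \<le> ennreal (lower_const \<theta> p2) * J"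
  using K_le_embed_norm geo_const_pos[of "1 / 4" \<theta>] geo_const_pos[of "1 / 2" "ennreal p2"] theta p2
  by (simp add: lower_const_def ennreal_mult mult_ac)

text \<open>The boundary term of the Stieltjes case is controlled by the supremum of the sequence;
  this passes from there to \<open>K\<close>.\<close>

lemma sup_le: "enorm (count_space UNIV) top (\<lambda>k. ennreal (2 powr (- real_of_int k)) * shell_norm s Q k) \<le> K"
  unfolding K_def enorm_count_top using dual
  by (intro SUP_least enorm_count_ge[where u = "\<lambda>k. ennreal (2 powr (- real_of_int k)) * shell_norm s Q k"])
    (simp add: dual_exponent_def)

lemma ball_norm_eq: "wnorm lebesgue s (ball 0 t) (\<lambda>_. 1) Q = ball_norm s Q t"
  using s_pos by (simp add: wnorm_unweighted ball_norm_def)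

lemma total_norm_eq: "wnorm lebesgue s UNIV (\<lambda>_. 1) Q = enorm lebesgue s Q"
  using s_pos by (simp add: wnorm_unweighted)

lemma embed_norm_sup_bounds:
  assumes "\<kappa> = top"
  shows "J \<le> ennreal (upper_const \<theta> p1 * 2) * (SUP t\<in>{0<..}. inverse (W t) * ball_norm s Q t)" (is "_ \<le> _ * ?A")
    and "(SUP t\<in>{0<..}. inverse (W t) * ball_norm s Q t) \<le> ennreal (geo_const s (1 / 2) * lower_const \<theta> p2) * J"
proof -
  have U: "0 \<le> upper_const \<theta> p1"
    using gap_const_pos[OF theta] by (simp add: upper_const_def)
  have K: "K = enorm (count_space UNIV) top (\<lambda>k. ennreal (2 powr (- real_of_int k)) * shell_norm s Q k)"
    unfolding K_def unfolding assms ..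
  have "K \<le> 2 * ?A"
    unfolding K by (intro shell_norm_le_SUP_balls s_pos Q_measurable)
  then have "ennreal (upper_const \<theta> p1) * K \<le> ennreal (upper_const \<theta> p1) * (2 * ?A)"
    by (intro mult_left_mono) auto
  with J_le show "J \<le> ennreal (upper_const \<theta> p1 * 2) * ?A"
    using U by (simp add: ennreal_mult mult.assoc)
  have "?A \<le> ennreal (geo_const s (1 / 2)) * K"
    unfolding K by (intro SUP_least inverse_W_ball_norm_le s_pos Q_measurable) auto
  also have "\<dots> \<le> ennreal (geo_const s (1 / 2)) * (ennreal (lower_const \<theta> p2) * J)"
    by (intro mult_left_mono K_le) auto
  finally show "?A \<le> ennreal (geo_const s (1 / 2) * lower_const \<theta> p2) * J"
    using geo_const_pos[of "1 / 2" s] s_pos by (simp add: ennreal_mult' mult.assoc)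
qed

lemma embed_norm_LS_bounds:
  fixes \<rho> :: real
  assumes "0 < \<rho>" "\<kappa> = ennreal \<rho>"
  defines "R \<equiv> epow (LS_integral (\<lambda>t. - (enn2real (Wp t) powr (- \<rho>))) (\<lambda>t. epow (ball_norm s Q t) \<rho>)) (1 / \<rho>)
    + inverse (omnorm_inf \<theta> \<omega>) * enorm lebesgue s Q"
  shows "J \<le> ennreal (upper_const \<theta> p1 * LS_const \<rho>) * R"
    and "R \<le> ennreal ((geo_const (ennreal \<rho>) (1 / 4) * 2 * geo_const s (1 / 2) + geo_const s (1 / 2)) * lower_const \<theta> p2) * J"
proof -
  have U: "0 \<le> upper_const \<theta> p1"
    using gap_const_pos[OF theta] by (simp add: upper_const_def)
  have geo: "0 < geo_const s (1 / 2)" "0 < geo_const (ennreal \<rho>) (1 / 4)"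
    using s_pos \<open>0 < \<rho>\<close> by (auto intro!: geo_const_pos)
  have K: "K = enorm (count_space UNIV) (ennreal \<rho>) (\<lambda>k. ennreal (2 powr (- real_of_int k)) * shell_norm s Q k)"
    unfolding K_def unfolding \<open>\<kappa> = ennreal \<rho>\<close> ..
  have "K \<le> ennreal (LS_const \<rho>) * R"
    using shells_le_LS_integral[OF s_pos Q_measurable \<open>0 < \<rho>\<close>]
    by (simp add: K R_def LS_const_def ennreal_mult mult.assoc)
  then have "ennreal (upper_const \<theta> p1) * K \<le> ennreal (upper_const \<theta> p1) * (ennreal (LS_const \<rho>) * R)"
    by (intro mult_left_mono) auto
  with J_le show "J \<le> ennreal (upper_const \<theta> p1 * LS_const \<rho>) * R"
    using U by (simp add: ennreal_mult' mult.assoc)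
  have "R \<le> ennreal (geo_const (ennreal \<rho>) (1 / 4) * 2) * ennreal (geo_const s (1 / 2)) * K + ennreal (geo_const s (1 / 2)) * K"
    unfolding R_def
  proof (rule add_mono)
    show "epow (LS_integral (\<lambda>t. - (enn2real (Wp t) powr (- \<rho>))) (\<lambda>t. epow (ball_norm s Q t) \<rho>)) (1 / \<rho>)
      \<le> ennreal (geo_const (ennreal \<rho>) (1 / 4) * 2) * ennreal (geo_const s (1 / 2)) * K"
      using LS_integral_le_shells[OF s_pos Q_measurable \<open>0 < \<rho>\<close>] by (simp add: K)
    have "inverse (omnorm_inf \<theta> \<omega>) * enorm lebesgue s Q \<le> ennreal (geo_const s (1 / 2))
        * enorm (count_space UNIV) top (\<lambda>k. ennreal (2 powr (- real_of_int k)) * shell_norm s Q k)"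
      by (intro total_norm_le s_pos Q_measurable)
    also have "\<dots> \<le> ennreal (geo_const s (1 / 2)) * K"
      by (intro mult_left_mono sup_le) auto
    finally show "inverse (omnorm_inf \<theta> \<omega>) * enorm lebesgue s Q \<le> ennreal (geo_const s (1 / 2)) * K" .
  qed
  also have "\<dots> = ennreal (geo_const (ennreal \<rho>) (1 / 4) * 2 * geo_const s (1 / 2) + geo_const s (1 / 2)) * K"
    using geo by (simp add: ennreal_mult distrib_right)
  also have "\<dots> \<le> ennreal (geo_const (ennreal \<rho>) (1 / 4) * 2 * geo_const s (1 / 2) + geo_const s (1 / 2)) * (ennreal (lower_const \<theta> p2) * J)"
    by (intro mult_left_mono K_le) auto
  finally show "R \<le> ennreal ((geo_const (ennreal \<rho>) (1 / 4) * 2 * geo_const s (1 / 2) + geo_const s (1 / 2)) * lower_const \<theta> p2) * J"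
    using geo by (simp add: ennreal_mult' mult.assoc)
qed

end

text \<open>For \<theta> = \<infinity> the exponent is p and the reciprocal of \<theta> is 0, so the
  same relation covers both branches of \<open>rhoexp\<close>.\<close>

lemma rhoexp_dual:
  assumes "0 < p" "ennreal p < \<theta>"
  shows "0 < rhoexp p \<theta>" "inverse (ennreal p) = inverse \<theta> + inverse (ennreal (rhoexp p \<theta>))"
proof -
  have "0 < rhoexp p \<theta> \<and> inverse (ennreal p) = inverse \<theta> + inverse (ennreal (rhoexp p \<theta>))"
  proof (cases \<theta>)
    case (real t)
    then have t: "0 < p" "p < t" using assms by (auto simp: ennreal_less_iff)
    define d where "d = p * t / (t - p)"
    have d: "0 < d" "rhoexp p \<theta> = d" using t real by (auto simp: d_def rhoexp_def)
    have "inverse t + inverse d = inverse p" using t by (simp add: d_def field_simps)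
    then have "inverse (ennreal p) = ennreal (inverse t + inverse d)" using t by (simp add: inverse_ennreal)
    also have "\<dots> = inverse \<theta> + inverse (ennreal d)" using t d real by (simp add: inverse_ennreal)
    finally show ?thesis using d by simp
  qed (use assms in \<open>simp add: rhoexp_def\<close>)
  then show "0 < rhoexp p \<theta>" "inverse (ennreal p) = inverse \<theta> + inverse (ennreal (rhoexp p \<theta>))" by auto
qed

lemma ennreal_mult_weaken:
  assumes "x \<le> ennreal a * y" "a \<le> b"
  shows "x \<le> ennreal b * (y :: ennreal)"
  using assms by (meson ennreal_leI mult_right_mono order_trans zero_le)

theorem theorem4p2:
  fixes v1 v2 :: "'a::euclidean_space \<Rightarrow> real" and p1 p2 :: real and \<theta> :: ennreal
  assumes "0 < p1" and "p1 \<le> p2" and "0 < \<theta>"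
    and "v1 \<in> weights" and "v2 \<in> weights"
  shows
    "(\<theta> \<le> ennreal p1 \<longrightarrow>
       (\<exists>C>0. \<forall>\<omega>\<in>cOmega \<theta>.
          embed_norm p1 p2 \<theta> \<omega> v1 v2
            \<le> ennreal C * (SUP t\<in>{0<..}. inverse (omnorm \<theta> \<omega> t) *
                  wnorm lebesgue (sexp p1 p2) (ball 0 t) (\<lambda>_. 1) (wquot p1 p2 v1 v2)) \<and>
          (SUP t\<in>{0<..}. inverse (omnorm \<theta> \<omega> t) *
                  wnorm lebesgue (sexp p1 p2) (ball 0 t) (\<lambda>_. 1) (wquot p1 p2 v1 v2))
            \<le> ennreal C * embed_norm p1 p2 \<theta> \<omega> v1 v2)) \<and>
     (ennreal p1 < \<theta> \<longrightarrow>
       (\<exists>C>0. \<forall>\<omega>\<in>cOmega \<theta>.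
          (let \<rho> = rhoexp p1 \<theta>;
               R = epow (LS_integral (\<lambda>t. - (enn2real (omnorm_plus \<theta> \<omega> t) powr (- \<rho>)))
                          (\<lambda>t. epow (wnorm lebesgue (sexp p1 p2) (ball 0 t) (\<lambda>_. 1) (wquot p1 p2 v1 v2)) \<rho>))
                        (1 / \<rho>)
                   + inverse (omnorm_inf \<theta> \<omega>) *
                     wnorm lebesgue (sexp p1 p2) UNIV (\<lambda>_. 1) (wquot p1 p2 v1 v2)
           in embed_norm p1 p2 \<theta> \<omega> v1 v2 \<le> ennreal C * R \<and>
              R \<le> ennreal C * embed_norm p1 p2 \<theta> \<omega> v1 v2)))"
proof (intro conjI impI)
  assume "\<theta> \<le> ennreal p1"
  define C1 where "C1 = upper_const \<theta> p1 * 2"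
  define C2 where "C2 = geo_const (sexp p1 p2) (1 / 2) * lower_const \<theta> p2"
  show "\<exists>C>0. \<forall>\<omega>\<in>cOmega \<theta>.
      embed_norm p1 p2 \<theta> \<omega> v1 v2
        \<le> ennreal C * (SUP t\<in>{0<..}. inverse (omnorm \<theta> \<omega> t) *
              wnorm lebesgue (sexp p1 p2) (ball 0 t) (\<lambda>_. 1) (wquot p1 p2 v1 v2)) \<and>
      (SUP t\<in>{0<..}. inverse (omnorm \<theta> \<omega> t) *
              wnorm lebesgue (sexp p1 p2) (ball 0 t) (\<lambda>_. 1) (wquot p1 p2 v1 v2))
        \<le> ennreal C * embed_norm p1 p2 \<theta> \<omega> v1 v2"
  \<comment> \<open>The constants are built from the exponents alone, before \<omega> is fixed; the
    1 secures positivity.\<close>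
  proof (intro exI[of _ "max 1 (max C1 C2)"] conjI ballI)
    fix \<omega> assume "\<omega> \<in> cOmega \<theta>"
    with assms \<open>\<theta> \<le> ennreal p1\<close> interpret embedding \<theta> \<omega> v1 v2 p1 p2 top
      by unfold_locales (auto simp: dual_exponent_def)
    show "embed_norm p1 p2 \<theta> \<omega> v1 v2 \<le> ennreal (max 1 (max C1 C2)) * (SUP t\<in>{0<..}. inverse (omnorm \<theta> \<omega> t) *
        wnorm lebesgue (sexp p1 p2) (ball 0 t) (\<lambda>_. 1) (wquot p1 p2 v1 v2))"
      unfolding ball_norm_eq by (rule ennreal_mult_weaken[OF embed_norm_sup_bounds(1)]) (auto simp: C1_def)
    show "(SUP t\<in>{0<..}. inverse (omnorm \<theta> \<omega> t) *
        wnorm lebesgue (sexp p1 p2) (ball 0 t) (\<lambda>_. 1) (wquot p1 p2 v1 v2)) \<le> ennreal (max 1 (max C1 C2)) * embed_norm p1 p2 \<theta> \<omega> v1 v2"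
      unfolding ball_norm_eq by (rule ennreal_mult_weaken[OF embed_norm_sup_bounds(2)]) (auto simp: C2_def)
  qed simp
next
  assume \<theta>: "ennreal p1 < \<theta>"
  define \<rho> where "\<rho> = rhoexp p1 \<theta>"
  have \<rho>: "0 < \<rho>" "inverse (ennreal p1) = inverse \<theta> + inverse (ennreal \<rho>)"
    unfolding \<rho>_def using rhoexp_dual[OF assms(1) \<theta>] by auto
  define C1 where "C1 = upper_const \<theta> p1 * LS_const \<rho>"
  define C2 where "C2 = (geo_const (ennreal \<rho>) (1 / 4) * 2 * geo_const (sexp p1 p2) (1 / 2) + geo_const (sexp p1 p2) (1 / 2)) * lower_const \<theta> p2"
  show "\<exists>C>0. \<forall>\<omega>\<in>cOmega \<theta>.
      (let \<rho> = rhoexp p1 \<theta>;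
           R = epow (LS_integral (\<lambda>t. - (enn2real (omnorm_plus \<theta> \<omega> t) powr (- \<rho>)))
                      (\<lambda>t. epow (wnorm lebesgue (sexp p1 p2) (ball 0 t) (\<lambda>_. 1) (wquot p1 p2 v1 v2)) \<rho>))
                    (1 / \<rho>)
               + inverse (omnorm_inf \<theta> \<omega>) *
                 wnorm lebesgue (sexp p1 p2) UNIV (\<lambda>_. 1) (wquot p1 p2 v1 v2)
       in embed_norm p1 p2 \<theta> \<omega> v1 v2 \<le> ennreal C * R \<and>
          R \<le> ennreal C * embed_norm p1 p2 \<theta> \<omega> v1 v2)"
    unfolding Let_def \<rho>_def[symmetric]
  proof (intro exI[of _ "max 1 (max C1 C2)"] conjI ballI)
    fix \<omega> assume "\<omega> \<in> cOmega \<theta>"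
    with assms \<rho> interpret embedding \<theta> \<omega> v1 v2 p1 p2 "ennreal \<rho>"
      by unfold_locales (auto simp: dual_exponent_def)
    let ?R = "epow (LS_integral (\<lambda>t. - (enn2real (omnorm_plus \<theta> \<omega> t) powr (- \<rho>)))
          (\<lambda>t. epow (wnorm lebesgue (sexp p1 p2) (ball 0 t) (\<lambda>_. 1) (wquot p1 p2 v1 v2)) \<rho>)) (1 / \<rho>)
        + inverse (omnorm_inf \<theta> \<omega>) * wnorm lebesgue (sexp p1 p2) UNIV (\<lambda>_. 1) (wquot p1 p2 v1 v2)"
    show "embed_norm p1 p2 \<theta> \<omega> v1 v2 \<le> ennreal (max 1 (max C1 C2)) * ?R"
      unfolding ball_norm_eq total_norm_eq
      by (rule ennreal_mult_weaken[OF embed_norm_LS_bounds(1)[OF \<rho>(1)]]) (auto simp: C1_def)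
    show "?R \<le> ennreal (max 1 (max C1 C2)) * embed_norm p1 p2 \<theta> \<omega> v1 v2"
      unfolding ball_norm_eq total_norm_eq
      by (rule ennreal_mult_weaken[OF embed_norm_LS_bounds(2)[OF \<rho>(1)]]) (auto simp: C2_def)
  qed simp
qed

end
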